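(* Let $X\subset\mathbb{C}^n$ be an irreducible variety of codimension $c$, and let $f_u\colon\mathbb{C}^n\times\mathbb{C}^n\to\mathbb{C}$ be a holomorphic function that is gradient-solvable in $u$ and such that the pair $(f_u,X)$ is compatible. Let $\mathcal{F}_X\subset\mathbb{C}^n_x\times\mathbb{C}^n_u$ be the optimization correspondence and $\pi_2\colon\mathcal{F}_X\to\mathbb{C}^n_u$, $(x,u)\mapsto u$, the second projection. Then over general data points $u\in\mathbb{C}^n$ the fibers $\pi_2^{-1}(u)$ are finite of constant cardinality.
   Context: "General $u$" means all $u$ in some nonempty Zariski open subset of $\mathbb{C}^n$. All closures are Zariski closures; $\perp$ is with respect to the bilinear form $v\cdot w=\sum_i v_iw_i$; $X_{\mathrm{sm}}$, $X_{\mathrm{sing}}$ are the smooth and singular loci of $X$; $\nabla f_u$ is the gradient with respect to $x$; subscripts $N$, $D$ denote numerator and denominator of a rational function. Gradient-solvable: a holomorphic function $f_u\colon\mathbb{C}^n\times\mathbb{C}^n\to\mathbb{C}$, depending on $x\in\mathbb{C}^n$ and a data vector $u\in\mathbb{C}^n$, is gradient-solvable in $u$ if (i) for all $i\in\{1,\dots,n\}$ the partial derivative $\partial f_u/\partial x_i$ lies in $\mathbb{C}(u_i,x)$ and depends on $u_i$; (ii) for all $i$ and all $g\in\mathbb{C}[x]$, the equation $\partial f_u/\partial x_i=g$ is, after clearing denominators, solvable in $u_i$ by radicals. Critical point: $x\in X_{\mathrm{sm}}$ is critical for $f_u$ if $\nabla f_u(x)\perp T_xX$. Optimization correspondence: $$\mathcal{F}_X=\overline{\{(x,u)\in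 (X\times\mathbb{C}^n)\setminus H \mid x\in X_{\mathrm{sm}},\ x \text{ a critical point of } f_u\}},$$ where $H$ is defined by $\prod_{i=1}^n(\partial f_u/\partial x_i)_D=0$. Radical parametrization: a radical tower over $k_0=\mathbb{C}(t)$, $t=(t_1,\dots,t_N)$, is a tower of fields $k_0\subset k_1\subset\dots\subset k_m$ with $k_i=k_{i-1}(\delta_i)$, $\delta_i\ne0$, $\delta_i^{d_i}=\alpha_i\in k_{i-1}$, $d_i\in\mathbb{N}$. A radical parametrization is a tuple of elements of $k_m$ whose Jacobian with respect to $t$ has rank $N$, together with a choice of branches of the $\delta_i$ (specified by values $\delta_i(t_0)=a_i$ at a point $t_0$ that is not a branch point of any $\delta_i$). Compatible: let $I(X)=\langle g_1,\dots,g_s\rangle$, $g=(g_1,\dots,g_s)$ and $\widetilde{\mathrm{Jac}}(g)=\mathrm{Jac}(g)\cdot\mathrm{diag}((\partial f_u/\partial x_1)_D,\dots,(\partial f_u/\partial x_n)_D)$. Let $M=(m_{ij})$ be a $c\times n$ matrix with entries in $\mathbb{C}[x]$, each row of which is a general linear combination of the rows of $\widetilde{\mathrm{Jac}}(g)$. Consider, with new variables $s=(s_1,\dots,s_c)$, the system $$\left(\frac{\partial f_u}{\partial x_j}(x,u)\right)_N=\sum_{i=1}^c s_i\,m_{ij}(x),\qquad j=1,\dots,n. \quad ( * )$$ Solving by radicals in $u_j$, each branch of $( * )$ gives $u_j=h_j(x,s)$ with $h_j\in\overline{\mathbb{C}(x,s)}\setminus\{0\}$. Consider a radical tower over $\mathbb{C}(x,s)$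 with generators $\delta_1,\dots,\delta_m$, $\delta_i^{d_i}=\alpha_{iN}/\alpha_{iD}$, whose last field is the smallest field containing all $h_j$, and the radical parametrization $\phi\colon\mathbb{C}^{n+c}\to\mathbb{C}^{2n}$, $\phi(x,s)=(x_1,\dots,x_n,h_1(x,s),\dots,h_n(x,s))$, with components $\phi_1,\dots,\phi_{2n}$ having denominators $\phi_{1D},\dots,\phi_{2nD}$. The pair $(f_u,X)$ is compatible if for every branch of $( * )$ there exists such a $\phi$ for which the Zariski closure of the zero set of $\operatorname{lcm}(\alpha_{1N},\dots,\alpha_{mN},\alpha_{1D},\dots,\alpha_{mD},\phi_{1D},\dots,\phi_{2nD})$ does not contain $X\times\mathbb{C}^c$. *)

theory Defs
  imports
    "HOL-Analysis.Analysis"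
    "HOL-Library.Poly_Mapping"
    "HOL-Computational_Algebra.Fraction_Field"
    "HOL-Algebra.Algebraic_Closure_Type"
begin

no_notation Polynomials.var (\<open>X\<index>\<close>)

section \<open>Polynomials and rational functions\<close>

text \<open>
  A single polynomial ring over the complex numbers is used, with variables
  \<open>Xv i\<close> for \<open>x\<^sub>i\<close>, \<open>Uv i\<close> for \<open>u\<^sub>i\<close>, \<open>Sv k\<close> for the auxiliary variables \<open>s\<^sub>k\<close> (multipliers),
  and \<open>Dv k\<close> for placeholders of the generators \<open>\<delta>\<^sub>k\<close> of a radical tower.
  The rings \<open>\<complex>[x]\<close>, \<open>\<complex>[u\<^sub>i,x]\<close>, \<open>\<complex>[x,s]\<close>, ... are its subrings \<open>polys V\<close>.
  The indices \<open>k\<close> of \<open>s\<close>, \<open>\<delta>\<close> and of the generators of an ideal start at 0.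
\<close>

datatype 'n var = Xv 'n | Uv 'n | Sv nat | Dv nat

text \<open>
  The arbitrary linear order chosen here has no mathematical meaning. It is only needed since the
  library derives that polynomial rings are integral domains from an order on the variables.
\<close>

definition var_order :: "('n var \<times> 'n var) set"
  where "var_order = (SOME r. well_order_on UNIV r)"

lemma well_order_var_order: "well_order_on UNIV (var_order :: ('n var \<times> 'n var) set)"
  unfolding var_order_def by (rule someI_ex) (rule well_order_on)

instantiation var :: (type) linorder
begin

definition less_eq_var :: "'a var \<Rightarrow> 'a var \<Rightarrow> bool"
  where "less_eq_var a b \<longleftrightarrow> (a, b) \<in> var_order"

definition less_var :: "'a var \<Rightarrow> 'a var \<Rightarrow> bool"
  where "less_var a b \<longleftrightarrow> a \<le> b \<and> \<not> b \<le> a"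

instance
proof -
  have o: "refl (var_order :: ('a var \<times> 'a var) set)" "trans (var_order :: ('a var \<times> 'a var) set)"
    "antisym (var_order :: ('a var \<times> 'a var) set)" "total (var_order :: ('a var \<times> 'a var) set)"
    using well_order_var_order[where 'n = 'a]
    by (simp_all add: well_order_on_def linear_order_on_def partial_order_on_def preorder_on_def)
  show "OFCLASS('a var, linorder_class)"
  proof
    fix a b c :: "'a var"
    show "a < b \<longleftrightarrow> a \<le> b \<and> \<not> b \<le> a" by (simp add: less_var_def)
    show "a \<le> a" using o(1) by (simp add: less_eq_var_def refl_on_def)
    show "a \<le> b \<Longrightarrow> b \<le> c \<Longrightarrow> a \<le> c" using o(2) by (auto simp: less_eq_var_def dest: transD)
    show "a \<le> b \<Longrightarrow> b \<le> a \<Longrightarrow> a = b" using o(3) by (auto simp: less_eq_var_def dest: antisymD)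
    show "a \<le> b \<or> b \<le> a"
    proof (cases "a = b")
      case True
      then show ?thesis using o(1) by (simp add: less_eq_var_def refl_on_def)
    next
      case False
      then show ?thesis using o(4) by (simp add: less_eq_var_def total_on_def)
    qed
  qed
qed

end

type_synonym ('v, 'a) poly_over = "('v \<Rightarrow>\<^sub>0 nat) \<Rightarrow>\<^sub>0 'a"
type_synonym 'n mpoly = "('n var, complex) poly_over"

text \<open>The algebraic closure of the field of rational functions in all the variables.\<close>

type_synonym 'n afun = "'n mpoly fract alg_closure"

definition peval :: "('a::zero \<Rightarrow> 'b::comm_semiring_1) \<Rightarrow> ('v \<Rightarrow> 'b) \<Rightarrow> ('v, 'a) poly_over \<Rightarrow> 'b"
  where "peval emb \<sigma> p =
    (\<Sum>m\<in>Poly_Mapping.keys p. emb (Poly_Mapping.lookup p m) *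
       (\<Prod>v\<in>Poly_Mapping.keys m. \<sigma> v ^ Poly_Mapping.lookup m v))"

abbreviation ceval :: "('v \<Rightarrow> complex) \<Rightarrow> ('v, complex) poly_over \<Rightarrow> complex"
  where "ceval \<equiv> peval (\<lambda>z. z)"

definition pconst :: "complex \<Rightarrow> 'n mpoly"
  where "pconst z = Poly_Mapping.single 0 z"

definition pvar :: "'n var \<Rightarrow> 'n mpoly"
  where "pvar v = Poly_Mapping.single (Poly_Mapping.single v 1) 1"

definition polys :: "'n var set \<Rightarrow> 'n mpoly set"
  where "polys V = {p. \<forall>m\<in>Poly_Mapping.keys p. Poly_Mapping.keys m \<subseteq> V}"

definition pdiff :: "'n var \<Rightarrow> 'n mpoly \<Rightarrow> 'n mpoly"
  where "pdiff v p =
    (\<Sum>m\<in>Poly_Mapping.keys p. Poly_Mapping.single (m - Poly_Mapping.single v 1)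
       (of_nat (Poly_Mapping.lookup m v) * Poly_Mapping.lookup p m))"

definition no_common_factor :: "'n mpoly \<Rightarrow> 'n mpoly \<Rightarrow> bool"
  where "no_common_factor p q \<longleftrightarrow> (\<forall>d. d dvd p \<longrightarrow> d dvd q \<longrightarrow> d dvd 1)"

definition embed :: "'n mpoly \<Rightarrow> 'n afun"
  where "embed p = to_ac (Fract p 1)"

definition ratfuns :: "'n var set \<Rightarrow> 'n afun set"
  where "ratfuns V = {embed p / embed q | p q. p \<in> polys V \<and> q \<in> polys V \<and> q \<noteq> 0}"

definition algebraic_over :: "'a::field set \<Rightarrow> 'a \<Rightarrow> bool"
  where "algebraic_over F y \<longleftrightarrow> (\<exists>p::'a poly. p \<noteq> 0 \<and> (\<forall>i. Polynomial.coeff p i \<in> F) \<and> poly p y = 0)"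

definition aeval :: "('n var \<Rightarrow> 'n afun) \<Rightarrow> 'n mpoly \<Rightarrow> 'n afun"
  where "aeval = peval (\<lambda>z. embed (pconst z))"

definition gen :: "'n var \<Rightarrow> 'n afun"
  where "gen v = embed (pvar v)"

abbreviation xvars :: "'n var set"
  where "xvars \<equiv> range Xv"

definition xsvars :: "nat \<Rightarrow> 'n var set"
  where "xsvars c = range Xv \<union> Sv ` {..<c}"


section \<open>Zariski topology\<close>

text \<open>The map \<open>crd\<close> assigns to a point its family of coordinates.\<close>

definition zclosed :: "('p \<Rightarrow> 'v \<Rightarrow> complex) \<Rightarrow> 'p set \<Rightarrow> bool"
  where "zclosed crd S \<longleftrightarrow>
    (\<exists>P :: ('v, complex) poly_over set. S = {a. \<forall>p\<in>P. ceval (crd a) p = 0})"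

definition zclosure :: "('p \<Rightarrow> 'v \<Rightarrow> complex) \<Rightarrow> 'p set \<Rightarrow> 'p set"
  where "zclosure crd S = zclosed crd hull S"

text \<open>The property \<open>Q\<close> holds for general points of the affine space \<open>A\<close>.\<close>

definition for_general :: "('p \<Rightarrow> 'v \<Rightarrow> complex) \<Rightarrow> 'p set \<Rightarrow> ('p \<Rightarrow> bool) \<Rightarrow> bool"
  where "for_general crd A Q \<longleftrightarrow>
    (\<exists>U. zclosed crd (- U) \<and> U \<inter> A \<noteq> {} \<and> (\<forall>a\<in>U \<inter> A. Q a))"

abbreviation pair_coords :: "(complex^'n) \<times> (complex^'n) \<Rightarrow> 'n + 'n \<Rightarrow> complex"
  where "pair_coords \<equiv> (\<lambda>(x, u). case_sum (vec_nth x) (vec_nth u))"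

text \<open>
  Since \<open>c = 0\<close> has to be allowed, \<open>\<complex>\<^sup>c\<close> is modelled by the sequences vanishing from index \<open>c\<close> on,
  and likewise for matrices.
\<close>

abbreviation seq_coords :: "(complex^'n) \<times> (nat \<Rightarrow> complex) \<Rightarrow> 'n + nat \<Rightarrow> complex"
  where "seq_coords \<equiv> (\<lambda>(x, s). case_sum (vec_nth x) s)"

definition cseqs :: "nat \<Rightarrow> (nat \<Rightarrow> complex) set"
  where "cseqs c = {s. \<forall>i\<ge>c. s i = 0}"

abbreviation matrix_coords :: "(nat \<Rightarrow> nat \<Rightarrow> complex) \<Rightarrow> nat \<times> nat \<Rightarrow> complex"
  where "matrix_coords \<equiv> (\<lambda>l (i, k). l i k)"

definition cmatrices :: "nat \<Rightarrow> nat \<Rightarrow> (nat \<Rightarrow> nat \<Rightarrow> complex) set"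
  where "cmatrices c r = {l. \<forall>i k. i \<ge> c \<or> k \<ge> r \<longrightarrow> l i k = 0}"

definition irreducible_variety :: "(complex^'n) set \<Rightarrow> bool"
  where "irreducible_variety X \<longleftrightarrow> zclosed vec_nth X \<and> X \<noteq> {} \<and>
    (\<forall>A B. zclosed vec_nth A \<longrightarrow> zclosed vec_nth B \<longrightarrow> X \<subseteq> A \<union> B \<longrightarrow> X \<subseteq> A \<or> X \<subseteq> B)"

definition zdim :: "(complex^'n) set \<Rightarrow> nat"
  where "zdim X = (GREATEST d. \<exists>Z. (\<forall>i\<le>d. irreducible_variety (Z i) \<and> Z i \<subseteq> X) \<and>
    (\<forall>i<d. Z i \<subset> Z (Suc i)))"

definition zcodim :: "(complex^'n) set \<Rightarrow> nat"
  where "zcodim X = CARD('n) - zdim X"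

definition at_x :: "complex^'n \<Rightarrow> 'n var \<Rightarrow> complex"
  where "at_x x v = (case v of Xv i \<Rightarrow> x $ i | _ \<Rightarrow> 0)"

definition at_xu :: "complex^'n \<Rightarrow> complex^'n \<Rightarrow> 'n var \<Rightarrow> complex"
  where "at_xu x u v = (case v of Xv i \<Rightarrow> x $ i | Uv i \<Rightarrow> u $ i | _ \<Rightarrow> 0)"

definition at_xsd :: "complex^'n \<Rightarrow> (nat \<Rightarrow> complex) \<Rightarrow> (nat \<Rightarrow> complex) \<Rightarrow> 'n var \<Rightarrow> complex"
  where "at_xsd x s a v = (case v of Xv i \<Rightarrow> x $ i | Sv k \<Rightarrow> s k | Dv k \<Rightarrow> a k | _ \<Rightarrow> 0)"

definition vanishing_ideal :: "(complex^'n) set \<Rightarrow> 'n mpoly set"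
  where "vanishing_ideal X = {p \<in> polys xvars. \<forall>x\<in>X. ceval (at_x x) p = 0}"

definition ideal_of :: "'n mpoly list \<Rightarrow> 'n mpoly set"
  where "ideal_of gs = {\<Sum>k<length gs. q k * gs ! k | q. \<forall>k. q k \<in> polys xvars}"

definition tangent_space :: "(complex^'n) set \<Rightarrow> complex^'n \<Rightarrow> (complex^'n) set"
  where "tangent_space X x =
    {v. \<forall>p\<in>vanishing_ideal X. (\<Sum>i\<in>UNIV. ceval (at_x x) (pdiff (Xv i) p) * v $ i) = 0}"

definition smooth_locus :: "(complex^'n) set \<Rightarrow> (complex^'n) set"
  where "smooth_locus X = {x \<in> X. vec.dim (tangent_space X x) = zdim X}"


section \<open>The objective function and its gradient\<close>

definition holomorphic_in ::
    "((complex^'n) \<times> (complex^'n)) set \<Rightarrow> ((complex^'n) \<times> (complex^'n) \<Rightarrow> complex) \<Rightarrow> bool"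
  where "holomorphic_in W f \<longleftrightarrow> (\<forall>z\<in>W. \<exists>f'. (f has_derivative f') (at z) \<and>
    (\<forall>b h k. f' (b *s h, b *s k) = b * f' (h, k)))"

definition partial_x ::
    "((complex^'n) \<times> (complex^'n) \<Rightarrow> complex) \<Rightarrow> 'n \<Rightarrow> complex^'n \<Rightarrow> complex^'n \<Rightarrow> complex"
  where "partial_x f i x u = deriv (\<lambda>z. f (x + z *s axis i 1, u)) 0"

text \<open>
  The rational function \<open>p / q\<close>, in lowest terms, belongs to \<open>\<complex>(u\<^sub>i,x)\<close> and represents
  \<open>\<partial>f\<^sub>u/\<partial>x\<^sub>i\<close>. The domain \<open>W\<close> is where \<open>f\<close> is given as a holomorphic function (\<open>UNIV\<close> if it is
  entire; a smaller domain if, e.g., a branch of a logarithm occurs). The rational function is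
  determined by its values there, and is used on its whole natural domain.
\<close>

definition partial_repr ::
    "((complex^'n) \<times> (complex^'n)) set \<Rightarrow> ((complex^'n) \<times> (complex^'n) \<Rightarrow> complex) \<Rightarrow> 'n \<Rightarrow>
      'n mpoly \<times> 'n mpoly \<Rightarrow> bool"
  where "partial_repr W f i = (\<lambda>(p, q).
    p \<in> polys (insert (Uv i) xvars) \<and> q \<in> polys (insert (Uv i) xvars) \<and> q \<noteq> 0 \<and>
    no_common_factor p q \<and>
    (\<forall>(x, u)\<in>W. partial_x f i x u * ceval (at_xu x u) q = ceval (at_xu x u) p))"

text \<open>Numerator and denominator are unique up to a common nonzero constant factor.\<close>

definition partial_N where "partial_N W f i = fst (SOME r. partial_repr W f i r)"
definition partial_D where "partial_D W f i = snd (SOME r. partial_repr W f i r)"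

definition is_subfield :: "'a::field set \<Rightarrow> bool"
  where "is_subfield F \<longleftrightarrow> 0 \<in> F \<and> 1 \<in> F \<and>
    (\<forall>a\<in>F. \<forall>b\<in>F. a + b \<in> F \<and> a * b \<in> F) \<and> (\<forall>a\<in>F. - a \<in> F \<and> inverse a \<in> F)"

primrec tower_field :: "'a::field set \<Rightarrow> (nat \<Rightarrow> 'a) \<Rightarrow> nat \<Rightarrow> 'a set"
  where
    "tower_field k0 \<delta> 0 = k0"
  | "tower_field k0 \<delta> (Suc i) = is_subfield hull (insert (\<delta> i) (tower_field k0 \<delta> i))"

definition radical_tower :: "'a::field set \<Rightarrow> nat \<Rightarrow> (nat \<Rightarrow> nat) \<Rightarrow> (nat \<Rightarrow> 'a) \<Rightarrow> bool"
  where "radical_tower k0 m d \<delta> \<longleftrightarrow>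
    (\<forall>i<m. d i > 0 \<and> \<delta> i \<noteq> 0 \<and> \<delta> i ^ d i \<in> tower_field k0 \<delta> i)"

text \<open>The polynomial equation \<open>p = 0\<close> over \<open>\<complex>(x)\<close> in the unknown \<open>u\<^sub>i\<close> is solvable by radicals.\<close>

definition solvable_by_radicals :: "'n \<Rightarrow> 'n mpoly \<Rightarrow> bool"
  where "solvable_by_radicals i p \<longleftrightarrow> (\<exists>m d \<delta>. radical_tower (ratfuns xvars) m d \<delta> \<and>
    (\<forall>y. aeval (gen(Uv i := y)) p = 0 \<longrightarrow> y \<in> tower_field (ratfuns xvars) \<delta> m))"

definition gradient_solvable ::
    "((complex^'n) \<times> (complex^'n)) set \<Rightarrow> ((complex^'n) \<times> (complex^'n) \<Rightarrow> complex) \<Rightarrow> bool"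
  where "gradient_solvable W f \<longleftrightarrow>
    (\<forall>i. (\<exists>r. partial_repr W f i r) \<and>
         embed (partial_N W f i) / embed (partial_D W f i) \<notin> ratfuns xvars) \<and>
    (\<forall>i. \<forall>g\<in>polys xvars. solvable_by_radicals i (partial_N W f i - g * partial_D W f i))"

definition critical_point ::
    "((complex^'n) \<times> (complex^'n)) set \<Rightarrow> ((complex^'n) \<times> (complex^'n) \<Rightarrow> complex) \<Rightarrow>
      (complex^'n) set \<Rightarrow> complex^'n \<Rightarrow> complex^'n \<Rightarrow> bool"
  where "critical_point W f X u x \<longleftrightarrow> x \<in> smooth_locus X \<and>
    (\<forall>v\<in>tangent_space X x. (\<Sum>i\<in>UNIV.
       ceval (at_xu x u) (partial_N W f i) / ceval (at_xu x u) (partial_D W f i) * v $ i) = 0)"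

definition opt_correspondence ::
    "((complex^'n) \<times> (complex^'n)) set \<Rightarrow> ((complex^'n) \<times> (complex^'n) \<Rightarrow> complex) \<Rightarrow>
      (complex^'n) set \<Rightarrow> ((complex^'n) \<times> (complex^'n)) set"
  where "opt_correspondence W f X = zclosure pair_coords
    {(x, u). (\<Prod>i\<in>UNIV. ceval (at_xu x u) (partial_D W f i)) \<noteq> 0 \<and> critical_point W f X u x}"


section \<open>Radical parametrizations and compatibility\<close>

text \<open>The unique extension of \<open>\<partial>/\<partial>v\<close> to algebraic functions.\<close>

definition adiff :: "'n var \<Rightarrow> 'n afun \<Rightarrow> 'n afun"
  where "adiff v = (THE D. (\<forall>a b. D (a + b) = D a + D b) \<and> (\<forall>a b. D (a * b) = a * D b + b * D a) \<and>
    (\<forall>z. D (embed (pconst z)) = 0) \<and> (\<forall>w. D (gen w) = (if w = v then 1 else 0)))"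

text \<open>
  An element \<open>y\<close> of the \<open>i\<close>-th field of the tower over \<open>\<complex>(T)\<close> is written as \<open>p / q\<close>, where \<open>p\<close>
  and \<open>q\<close> are polynomials in the variables \<open>T\<close> and \<open>\<delta>\<^sub>0, \<dots>, \<delta>\<^sub>i\<^sub>-\<^sub>1\<close>.
\<close>

definition with_gens :: "(nat \<Rightarrow> 'n afun) \<Rightarrow> 'n var \<Rightarrow> 'n afun"
  where "with_gens \<delta> v = (case v of Dv k \<Rightarrow> \<delta> k | _ \<Rightarrow> gen v)"

definition num_den ::
    "'n var set \<Rightarrow> (nat \<Rightarrow> 'n afun) \<Rightarrow> nat \<Rightarrow> 'n afun \<Rightarrow> 'n mpoly \<Rightarrow> 'n mpoly \<Rightarrow> bool"
  where "num_den T \<delta> i y p q \<longleftrightarrow>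
    p \<in> polys (T \<union> Dv ` {..<i}) \<and> q \<in> polys (T \<union> Dv ` {..<i}) \<and> no_common_factor p q \<and>
    aeval (with_gens \<delta>) q \<noteq> 0 \<and> y = aeval (with_gens \<delta>) p / aeval (with_gens \<delta>) q"

text \<open>
  The point \<open>b\<close>, with coordinates for the variables in \<open>T\<close> and values for \<open>\<delta>\<^sub>0, \<dots>, \<delta>\<^sub>i\<^sub>-\<^sub>1\<close>, lies
  on (the closure of) the graph of the multivalued function obtained from the \<open>\<delta>\<^sub>k\<close>, \<open>k < i\<close>, by
  analytic continuation: all polynomial relations between \<open>T\<close> and the \<open>\<delta>\<^sub>k\<close> hold at \<open>b\<close>. So the
  choice of the elements \<open>\<delta>\<^sub>k\<close> in the algebraic closure also selects one irreducible component
  of the solution set of the equations \<open>\<delta>\<^sub>k^d\<^sub>k = \<alpha>\<^sub>k\<close>.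
\<close>

definition on_graph ::
    "'n var set \<Rightarrow> (nat \<Rightarrow> 'n afun) \<Rightarrow> nat \<Rightarrow> ('n var \<Rightarrow> complex) \<Rightarrow> bool"
  where "on_graph T \<delta> i b \<longleftrightarrow>
    (\<forall>p\<in>polys (T \<union> Dv ` {..<i}). aeval (with_gens \<delta>) p = 0 \<longrightarrow> ceval b p = 0)"

text \<open>
  The arguments \<open>\<alpha>N\<close>, \<open>\<alpha>D\<close>, \<open>\<phi>N\<close>, \<open>\<phi>D\<close> are the numerators and denominators of the \<open>\<alpha>\<^sub>i = \<delta>\<^sub>i^d\<^sub>i\<close> and
  of the components of \<open>\<phi>\<close>. The argument \<open>b\<close> comprises the base point \<open>t\<^sub>0\<close> and the values
  \<open>\<delta>\<^sub>i(t\<^sub>0) = a\<^sub>i\<close>; as no \<open>\<alpha>\<^sub>iN\<close>, \<open>\<alpha>\<^sub>iD\<close> vanishes there, the \<open>\<delta>\<^sub>i\<close> have unramified holomorphic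
  branches with these values near \<open>t\<^sub>0\<close>.
\<close>

definition radical_parametrization ::
    "'n var set \<Rightarrow> nat \<Rightarrow> (nat \<Rightarrow> nat) \<Rightarrow> (nat \<Rightarrow> 'n afun) \<Rightarrow>
      (nat \<Rightarrow> 'n mpoly) \<Rightarrow> (nat \<Rightarrow> 'n mpoly) \<Rightarrow> ('b::finite \<Rightarrow> 'n afun) \<Rightarrow>
      ('b \<Rightarrow> 'n mpoly) \<Rightarrow> ('b \<Rightarrow> 'n mpoly) \<Rightarrow> ('n var \<Rightarrow> complex) \<Rightarrow> bool"
  where "radical_parametrization T m d \<delta> \<alpha>N \<alpha>D \<phi> \<phi>N \<phi>D b \<longleftrightarrow>
    radical_tower (ratfuns T) m d \<delta> \<and>
    (\<forall>i<m. num_den T \<delta> i (\<delta> i ^ d i) (\<alpha>N i) (\<alpha>D i)) \<and>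
    (\<forall>j. \<phi> j \<in> tower_field (ratfuns T) \<delta> m) \<and>
    (\<forall>j. num_den T \<delta> m (\<phi> j) (\<phi>N j) (\<phi>D j)) \<and>
    vec.dim ((\<lambda>t. \<chi> j. adiff t (\<phi> j)) ` T) = card T \<and>
    on_graph T \<delta> m b \<and> (\<forall>i<m. ceval b (\<alpha>N i) \<noteq> 0 \<and> ceval b (\<alpha>D i) \<noteq> 0)"

text \<open>
  The zero set in \<open>\<complex>\<^sup>n \<times> \<complex>\<^sup>c\<close> of the least common multiple of all \<open>\<alpha>\<^sub>iN\<close>, \<open>\<alpha>\<^sub>iD\<close>, \<open>\<phi>\<^sub>jD\<close>, i.e. the
  union of their zero sets. These are algebraic functions of \<open>(x, s)\<close>, and a point is a zero of
  such a function if it is a zero of one of the values obtained by analytic continuation of the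
  chosen branch. The polynomials \<open>\<alpha>\<^sub>iN\<close>, \<open>\<alpha>\<^sub>iD\<close> involve only the \<open>\<delta>\<^sub>k\<close> with \<open>k < i\<close>, so only these
  have to have (finite) values at the point: e.g. the zero set for \<open>\<delta>\<^sub>0\<^sup>2 = 1 / x\<^sub>1\<close>
  contains the points with \<open>x\<^sub>1 = 0\<close>.
\<close>

definition bad_locus ::
    "nat \<Rightarrow> nat \<Rightarrow> (nat \<Rightarrow> 'n afun) \<Rightarrow> (nat \<Rightarrow> 'n mpoly) \<Rightarrow> (nat \<Rightarrow> 'n mpoly) \<Rightarrow> ('b \<Rightarrow> 'n mpoly) \<Rightarrow>
      ((complex^'n) \<times> (nat \<Rightarrow> complex)) set"
  where "bad_locus c m \<delta> \<alpha>N \<alpha>D \<phi>D = {(x, s). s \<in> cseqs c \<and> (\<exists>a.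
    (\<exists>i<m. on_graph (xsvars c) \<delta> i (at_xsd x s a) \<and>
       (ceval (at_xsd x s a) (\<alpha>N i) = 0 \<or> ceval (at_xsd x s a) (\<alpha>D i) = 0)) \<or>
    (on_graph (xsvars c) \<delta> m (at_xsd x s a) \<and> (\<exists>j. ceval (at_xsd x s a) (\<phi>D j) = 0)))}"

text \<open>The matrix obtained from the combinations, with coefficients \<open>l\<close>, of the rows of
  \<open>Jac(g) \<cdot> diag((\<partial>f\<^sub>u/\<partial>x\<^sub>1)\<^sub>D, \<dots>, (\<partial>f\<^sub>u/\<partial>x\<^sub>n)\<^sub>D)\<close>.\<close>

definition comb_matrix ::
    "((complex^'n) \<times> (complex^'n)) set \<Rightarrow> ((complex^'n) \<times> (complex^'n) \<Rightarrow> complex) \<Rightarrow>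
      'n mpoly list \<Rightarrow> (nat \<Rightarrow> nat \<Rightarrow> complex) \<Rightarrow> nat \<Rightarrow> 'n \<Rightarrow> 'n mpoly"
  where "comb_matrix W f gs l i j =
    (\<Sum>k<length gs. pconst (l i k) * (pdiff (Xv j) (gs ! k) * partial_D W f j))"

text \<open>
  A branch of the system \<open>(\<partial>f\<^sub>u/\<partial>x\<^sub>j)\<^sub>N(x,u) = \<Sum>\<^sub>i s\<^sub>i m\<^sub>i\<^sub>j(x)\<close>, \<open>j = 1, \<dots>, n\<close>: a solution
  \<open>u\<^sub>j = h\<^sub>j\<close> in nonzero elements of the algebraic closure of \<open>\<complex>(x,s)\<close>.
\<close>

definition system_branch ::
    "((complex^'n) \<times> (complex^'n)) set \<Rightarrow> ((complex^'n) \<times> (complex^'n) \<Rightarrow> complex) \<Rightarrow>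
      nat \<Rightarrow> (nat \<Rightarrow> 'n \<Rightarrow> 'n mpoly) \<Rightarrow> ('n \<Rightarrow> 'n afun) \<Rightarrow> bool"
  where "system_branch W f c M h \<longleftrightarrow> (\<forall>j. h j \<noteq> 0 \<and> algebraic_over (ratfuns (xsvars c)) (h j) \<and>
    aeval (gen(Uv j := h j)) (partial_N W f j) = (\<Sum>i<c. gen (Sv i) * embed (M i j)))"

text \<open>
  Here the last field of the tower is the smallest one containing the \<open>h j\<close> among
  the fields of the tower. (It need not be generated by the \<open>h j\<close>: a field generated by roots
  of a solvable equation is in general not itself the last field of a radical tower.)
\<close>

definition compatible ::
    "((complex^'n) \<times> (complex^'n)) set \<Rightarrow> ((complex^'n) \<times> (complex^'n) \<Rightarrow> complex) \<Rightarrow>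
      (complex^'n) set \<Rightarrow> nat \<Rightarrow> bool"
  where "compatible W f X c \<longleftrightarrow> (\<exists>gs. set gs \<subseteq> polys xvars \<and> ideal_of gs = vanishing_ideal X \<and>
    for_general matrix_coords (cmatrices c (length gs)) (\<lambda>l.
      (\<forall>i<c. \<forall>j. comb_matrix W f gs l i j \<in> polys xvars) \<and>
      (\<forall>h. system_branch W f c (comb_matrix W f gs l) h \<longrightarrow>
        (\<exists>m d \<delta> \<alpha>N \<alpha>D \<phi>N \<phi>D b.
          radical_parametrization (xsvars c) m d \<delta> \<alpha>N \<alpha>D
            (case_sum (\<lambda>i. gen (Xv i)) h) \<phi>N \<phi>D b \<and>
          (\<forall>i\<le>m. (\<forall>j. h j \<in> tower_field (ratfuns (xsvars c)) \<delta> i) \<longrightarrow>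
            tower_field (ratfuns (xsvars c)) \<delta> i = tower_field (ratfuns (xsvars c)) \<delta> m) \<and>
          \<not> X \<times> cseqs c \<subseteq> zclosure seq_coords (bad_locus c m \<delta> \<alpha>N \<alpha>D \<phi>D)))))"

end

(*
  The fibers of F_X over general u are finite of constant cardinality as soon as each coordinate x_i is
  algebraic over C(u) on F_X: general u then specialize the finitely many points of F_X over the algebraic
  closure of C(u) injectively, and no further points appear.

  For the algebraicity, suppose x_i, u_1, ..., u_n were algebraically independent on the critical locus.
  Then they are so modulo a prime ideal P, and the derivations d/dx_i and d/du_i of C[x_i, u] extend, up to
  a factor outside P, to derivations Delta, Delta' of the coordinate ring modulo P. On the critical locus
  the 1-form theta = sum_j A_j dx_j with A_j = (df_u/dx_j)(u_j, x) vanishes on all derivations, since dx is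
  tangent to X. Hence so does d(theta). The mixed derivatives of f_u are symmetric, so d(theta) equals
  sum_j (dA_j/du_j) du_j dx_j, and evaluating it at (Delta, Delta') gives dA_i/du_i = 0 modulo P. By the
  same symmetry dA_i/du_i depends on x_i and u_i only, so it is zero identically. This contradicts the
  dependence of df_u/dx_i on u_i.
*)
theory Submission
  imports Defs
begin

section \<open>Evaluation of polynomials\<close>

text \<open>The critical locus need not be irreducible, and the rank of the Jacobian of the
  generators may jump on it, so multipliers that are rational in the point exist only piecewise.
  Both difficulties are met by cutting the locus down to a part on which the pivots of a Gaussian
  elimination do not vanish and x_i, u are still independent. The prime P is found by Zorn among the
  ideals that contain everything vanishing on that part and avoid the nonzero polynomials in x_i, u
  as well as the pivots and denominators. Fields of fractions are avoided: divisions become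
  multiplications by elements outside P, and derivations modulo P are derivations of the polynomial
  ring that map the relevant part of P into P. The function dA_i/du_i does not involve x_j for j
  different from i, because its derivative along x_j is that of dA_j/dx_i along u_i, and A_j does
  not contain u_i. The contradiction needs this, as P is only known to contain no nonzero polynomial
  in x_i and u.\<close>

definition mconst :: "'a::zero \<Rightarrow> ('v, 'a) poly_over"
  where "mconst z = Poly_Mapping.single 0 z"

definition mvar :: "'v \<Rightarrow> ('v, 'a::zero_neq_one) poly_over"
  where "mvar v = Poly_Mapping.single (Poly_Mapping.single v 1) 1"

definition monom_val :: "('v \<Rightarrow> 'b::comm_semiring_1) \<Rightarrow> ('v \<Rightarrow>\<^sub>0 nat) \<Rightarrow> 'b"
  where "monom_val \<sigma> m = (\<Prod>v\<in>Poly_Mapping.keys m. \<sigma> v ^ Poly_Mapping.lookup m v)"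

lemma monom_val_superset:
  assumes "finite A" "Poly_Mapping.keys m \<subseteq> A"
  shows "monom_val \<sigma> m = (\<Prod>v\<in>A. \<sigma> v ^ Poly_Mapping.lookup m v)"
  unfolding monom_val_def
  by (rule prod.mono_neutral_left) (use assms in \<open>auto simp: in_keys_iff\<close>)

lemma monom_val_add: "monom_val \<sigma> (m + m') = monom_val \<sigma> m * monom_val \<sigma> m'"
proof -
  let ?A = "Poly_Mapping.keys m \<union> Poly_Mapping.keys m'"
  have "monom_val \<sigma> (m + m') = (\<Prod>v\<in>?A. \<sigma> v ^ Poly_Mapping.lookup (m + m') v)"
    by (rule monom_val_superset) (use keys_add[of m m'] in auto)
  also have "\<dots> = (\<Prod>v\<in>?A. \<sigma> v ^ Poly_Mapping.lookup m v) * (\<Prod>v\<in>?A. \<sigma> v ^ Poly_Mapping.lookup m' v)"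
    by (simp add: lookup_add power_add prod.distrib)
  also have "\<dots> = monom_val \<sigma> m * monom_val \<sigma> m'"
    by (simp add: monom_val_superset[of ?A])
  finally show ?thesis .
qed

lemma monom_val_0 [simp]: "monom_val \<sigma> 0 = 1"
  by (simp add: monom_val_def)

lemma monom_val_single [simp]: "monom_val \<sigma> (Poly_Mapping.single v k) = \<sigma> v ^ k"
  by (cases "k = 0") (simp_all add: monom_val_def)

lemma poly_mapping_sum_monomials:
  "(p :: 'b \<Rightarrow>\<^sub>0 'a::comm_monoid_add) = (\<Sum>m\<in>Poly_Mapping.keys p. Poly_Mapping.single m (Poly_Mapping.lookup p m))"
  (is "_ = ?r")
proof (rule poly_mapping_eqI)
  fix k
  have "Poly_Mapping.lookup ?r k = (\<Sum>m\<in>Poly_Mapping.keys p. if k = m then Poly_Mapping.lookup p m else 0)"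
    by (simp add: lookup_sum lookup_single when_def eq_commute)
  also have "\<dots> = Poly_Mapping.lookup p k"
    by (auto simp: in_keys_iff)
  finally show "Poly_Mapping.lookup p k = Poly_Mapping.lookup ?r k" by simp
qed

text \<open>One locale for all the substitutions in use: evaluations at complex points, in
  \<open>afun\<close>, in another polynomial ring and in univariate polynomials differ only in what
  \<open>emb\<close> does to the coefficients. Evaluations such as \<open>ceval \<rho>\<close> and
  \<open>aeval \<sigma>\<close> are instances of \<open>emb\<close> again, which later transports
  identities between univariate polynomials.\<close>

locale coeff_hom =
  fixes emb :: "'a::comm_ring_1 \<Rightarrow> 'b::comm_ring_1"
  assumes emb_1: "emb 1 = 1"
    and emb_add: "emb (a + b) = emb a + emb b"
    and emb_mult: "emb (a * b) = emb a * emb b"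
begin

lemma emb_0: "emb 0 = 0"
  using emb_add[of 0 0] by simp

lemma peval_superset:
  assumes "finite A" "Poly_Mapping.keys p \<subseteq> A"
  shows "peval emb \<sigma> p = (\<Sum>m\<in>A. emb (Poly_Mapping.lookup p m) * monom_val \<sigma> m)"
  unfolding peval_def monom_val_def[symmetric]
  by (rule sum.mono_neutral_left) (use assms in \<open>auto simp: in_keys_iff emb_0\<close>)

lemma peval_single [simp]: "peval emb \<sigma> (Poly_Mapping.single m a) = emb a * monom_val \<sigma> m"
  by (subst peval_superset[of "{m}"]) auto

lemma peval_0 [simp]: "peval emb \<sigma> 0 = 0"
  by (simp add: peval_def)

lemma peval_add [simp]: "peval emb \<sigma> (p + q) = peval emb \<sigma> p + peval emb \<sigma> q"
proof -
  let ?A = "Poly_Mapping.keys p \<union> Poly_Mapping.keys q"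
  have "peval emb \<sigma> (p + q) = (\<Sum>m\<in>?A. emb (Poly_Mapping.lookup (p + q) m) * monom_val \<sigma> m)"
    by (rule peval_superset) (use keys_add[of p q] in auto)
  then show ?thesis
    by (simp add: lookup_add emb_add distrib_right sum.distrib peval_superset[of ?A])
qed

lemma peval_sum [simp]: "peval emb \<sigma> (sum g A) = (\<Sum>a\<in>A. peval emb \<sigma> (g a))"
  by (induction A rule: infinite_finite_induct) auto

lemma peval_mult [simp]: "peval emb \<sigma> (p * q) = peval emb \<sigma> p * peval emb \<sigma> q"
proof -
  have "p * q = (\<Sum>m\<in>Poly_Mapping.keys p. \<Sum>m'\<in>Poly_Mapping.keys q.
      Poly_Mapping.single (m + m') (Poly_Mapping.lookup p m * Poly_Mapping.lookup q m'))"
    by (subst poly_mapping_sum_monomials[of p], subst poly_mapping_sum_monomials[of q])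
      (simp only: sum_product mult_single)
  also have "peval emb \<sigma> \<dots> = (\<Sum>m\<in>Poly_Mapping.keys p. \<Sum>m'\<in>Poly_Mapping.keys q.
      (emb (Poly_Mapping.lookup p m) * monom_val \<sigma> m) * (emb (Poly_Mapping.lookup q m') * monom_val \<sigma> m'))"
    by (simp add: monom_val_add emb_mult algebra_simps)
  also have "\<dots> = peval emb \<sigma> p * peval emb \<sigma> q"
    unfolding peval_def monom_val_def[symmetric] by (simp add: sum_product)
  finally show ?thesis .
qed

lemma peval_1 [simp]: "peval emb \<sigma> 1 = 1"
  unfolding single_one[symmetric] by (simp del: single_one add: emb_1)

lemma peval_uminus [simp]: "peval emb \<sigma> (- p) = - peval emb \<sigma> p"
  using peval_add[of \<sigma> p "- p"] by (simp del: peval_add add: eq_neg_iff_add_eq_0 add.commute)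

lemma peval_diff [simp]: "peval emb \<sigma> (p - q) = peval emb \<sigma> p - peval emb \<sigma> q"
  using peval_add[of \<sigma> p "- q"] by simp

lemma peval_power [simp]: "peval emb \<sigma> (p ^ k) = peval emb \<sigma> p ^ k"
  by (induction k) auto

lemma peval_prod [simp]: "peval emb \<sigma> (prod g A) = (\<Prod>a\<in>A. peval emb \<sigma> (g a))"
  by (induction A rule: infinite_finite_induct) auto

lemma peval_mvar [simp]: "peval emb \<sigma> (mvar v) = \<sigma> v"
  by (simp add: mvar_def emb_1)

lemma peval_mconst [simp]: "peval emb \<sigma> (mconst z) = emb z"
  by (simp add: mconst_def)

end

lemma pvar_eq_mvar: "pvar = mvar"
  by (simp add: fun_eq_iff pvar_def mvar_def)

lemma pconst_eq_mconst: "pconst = mconst"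
  by (simp add: fun_eq_iff pconst_def mconst_def)

lemma mconst_0 [simp]: "mconst 0 = 0"
  and mconst_1 [simp]: "mconst (1::'a::zero_neq_one) = 1"
  by (simp_all add: mconst_def)

lemma mconst_add: "mconst (a + b) = mconst a + mconst (b::'a::monoid_add)"
  by (simp add: mconst_def single_add)

lemma mconst_mult: "mconst (a * b) = mconst a * mconst (b::'a::semiring_0)"
  by (simp add: mconst_def mult_single)

lemma monom_eq_prod:
  "Poly_Mapping.single m (1::'a::comm_ring_1) = (\<Prod>v\<in>Poly_Mapping.keys m. mvar v ^ Poly_Mapping.lookup m v)"
proof -
  have pow: "mvar v ^ k = Poly_Mapping.single (Poly_Mapping.single v k) (1::'a)" for v :: 'b and k
    by (induction k) (simp_all add: mvar_def mult_single single_add[symmetric])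
  have "(\<Prod>v\<in>A. Poly_Mapping.single (g v) (1::'a)) = Poly_Mapping.single (\<Sum>v\<in>A. g v) 1"
    if "finite A" for A :: "'b set" and g :: "'b \<Rightarrow> 'b \<Rightarrow>\<^sub>0 nat"
    using that by (induction A) (simp_all add: mult_single)
  then show ?thesis
    by (simp add: pow poly_mapping_sum_monomials[symmetric])
qed

lemma poly_over_induct_vars [consumes 1, case_names const var add mult]:
  fixes p :: "('v, 'a::comm_ring_1) poly_over"
  assumes vars: "\<And>m. m \<in> Poly_Mapping.keys p \<Longrightarrow> Poly_Mapping.keys m \<subseteq> V"
    and const: "\<And>z. P (mconst z)" and var: "\<And>v. v \<in> V \<Longrightarrow> P (mvar v)"
    and add: "\<And>p q. P p \<Longrightarrow> P q \<Longrightarrow> P (p + q)" and mult: "\<And>p q. P p \<Longrightarrow> P q \<Longrightarrow> P (p * q)"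
  shows "P p"
proof -
  have P0: "P 0" and P1: "P 1"
    using const[of 0] const[of 1] by auto
  have P_power: "P q \<Longrightarrow> P (q ^ k)" for q k
    by (induction k) (auto intro: P1 mult)
  have P_prod: "P (prod g A)" if "\<And>v. v \<in> A \<Longrightarrow> P (g v)" for g :: "'v \<Rightarrow> _" and A
    using that by (induction A rule: infinite_finite_induct) (auto intro: P1 mult)
  have P_sum: "P (sum g A)" if "\<And>v. v \<in> A \<Longrightarrow> P (g v)" for g :: "('v \<Rightarrow>\<^sub>0 nat) \<Rightarrow> _" and A
    using that by (induction A rule: infinite_finite_induct) (auto intro: P0 add)
  have "P (Poly_Mapping.single m a)" if "m \<in> Poly_Mapping.keys p" for m a
  proof -
    have "P (mconst a * Poly_Mapping.single m 1)"
      unfolding monom_eq_prod using vars[OF that] by (intro mult const P_prod P_power var) auto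
    then show ?thesis by (simp add: mconst_def mult_single)
  qed
  then show ?thesis
    by (subst poly_mapping_sum_monomials) (rule P_sum)
qed

lemma poly_over_induct [case_names const var add mult]:
  fixes p :: "('v, 'a::comm_ring_1) poly_over"
  assumes "\<And>z. P (mconst z)" "\<And>v. P (mvar v)"
    "\<And>p q. P p \<Longrightarrow> P q \<Longrightarrow> P (p + q)" "\<And>p q. P p \<Longrightarrow> P q \<Longrightarrow> P (p * q)"
  shows "P p"
  by (rule poly_over_induct_vars[where V = UNIV]) (use assms in auto)

section \<open>The subrings of polynomials in prescribed variables\<close>

lemma polys_add [intro]: "p \<in> polys V \<Longrightarrow> q \<in> polys V \<Longrightarrow> p + q \<in> polys V"
  using keys_add[of p q] by (auto simp: polys_def)

lemma polys_mult [intro]: "p \<in> polys V \<Longrightarrow> q \<in> polys V \<Longrightarrow> p * q \<in> polys V"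
  unfolding polys_def
proof (intro CollectI ballI)
  fix m assume pq: "p \<in> {p. \<forall>m\<in>Poly_Mapping.keys p. Poly_Mapping.keys m \<subseteq> V}"
    "q \<in> {p. \<forall>m\<in>Poly_Mapping.keys p. Poly_Mapping.keys m \<subseteq> V}"
    and "m \<in> Poly_Mapping.keys (p * q)"
  then obtain a b where "m = a + b" "a \<in> Poly_Mapping.keys p" "b \<in> Poly_Mapping.keys q"
    using keys_mult[of p q] by auto
  then show "Poly_Mapping.keys m \<subseteq> V"
    using keys_add[of a b] pq by auto
qed

lemma polys_pconst [intro, simp]: "pconst z \<in> polys V"
  by (simp add: polys_def pconst_def)

lemma polys_0 [intro, simp]: "0 \<in> polys V" and polys_1 [intro, simp]: "1 \<in> polys V"
  by (simp_all add: polys_def)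

lemma polys_pvar [intro, simp]: "v \<in> V \<Longrightarrow> pvar v \<in> polys V"
  by (simp add: polys_def pvar_def)

lemma polys_uminus [intro]: "p \<in> polys V \<Longrightarrow> - p \<in> polys V"
  by (simp add: polys_def in_keys_iff)

lemma polys_diff [intro]: "p \<in> polys V \<Longrightarrow> q \<in> polys V \<Longrightarrow> p - q \<in> polys V"
  using polys_add[of p V "- q"] by auto

lemma polys_power [intro]: "p \<in> polys V \<Longrightarrow> p ^ k \<in> polys V"
  by (induction k) auto

lemma polys_induct [consumes 1, case_names const var add mult]:
  assumes p: "p \<in> polys V"
    and "\<And>z. P (pconst z)" "\<And>v. v \<in> V \<Longrightarrow> P (pvar v)"
    "\<And>p q. p \<in> polys V \<Longrightarrow> q \<in> polys V \<Longrightarrow> P p \<Longrightarrow> P q \<Longrightarrow> P (p + q)"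
    "\<And>p q. p \<in> polys V \<Longrightarrow> q \<in> polys V \<Longrightarrow> P p \<Longrightarrow> P q \<Longrightarrow> P (p * q)"
  shows "P p"
proof -
  have "p \<in> polys V \<and> P p"
    by (rule poly_over_induct_vars[where V = V])
      (use assms in \<open>auto simp flip: pvar_eq_mvar pconst_eq_mconst, auto simp: polys_def\<close>)
  then show ?thesis ..
qed

lemma polys_sum [intro]: "(\<And>a. a \<in> A \<Longrightarrow> g a \<in> polys V) \<Longrightarrow> sum g A \<in> polys V"
  by (induction A rule: infinite_finite_induct) auto

lemma polys_prod [intro]: "(\<And>a. a \<in> A \<Longrightarrow> g a \<in> polys V) \<Longrightarrow> prod g A \<in> polys V"
  by (induction A rule: infinite_finite_induct) auto

lemma polys_of_nat [intro, simp]: "of_nat k \<in> polys V"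
  by (induction k) auto

lemma polys_mono: "V \<subseteq> V' \<Longrightarrow> polys V \<subseteq> polys V'"
  by (auto simp: polys_def)

lemma peval_cong_vars:
  assumes "p \<in> polys V" "\<And>v. v \<in> V \<Longrightarrow> \<sigma> v = \<tau> v"
  shows "peval emb \<sigma> p = peval emb \<tau> p"
proof -
  have "(\<Prod>v\<in>Poly_Mapping.keys m. \<sigma> v ^ Poly_Mapping.lookup m v) =
      (\<Prod>v\<in>Poly_Mapping.keys m. \<tau> v ^ Poly_Mapping.lookup m v)" if "m \<in> Poly_Mapping.keys p" for m
  proof (rule prod.cong)
    fix v assume "v \<in> Poly_Mapping.keys m"
    then have "v \<in> V" using assms(1) that by (auto simp: polys_def)
    then show "\<sigma> v ^ Poly_Mapping.lookup m v = \<tau> v ^ Poly_Mapping.lookup m v"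
      by (simp add: assms(2))
  qed simp
  then show ?thesis by (simp add: peval_def)
qed

interpretation ceval: coeff_hom "\<lambda>z :: complex. z"
  by unfold_locales auto

interpretation mconst_hom: coeff_hom "mconst :: 'a::comm_ring_1 \<Rightarrow> ('v, 'a) poly_over"
  by unfold_locales (auto simp: mconst_add mconst_mult)

section \<open>Polynomials as elements of the field of algebraic functions\<close>

lemma embed_eq_iff [simp]: "embed p = embed q \<longleftrightarrow> p = q"
proof -
  have "to_ac a = 0 \<longleftrightarrow> a = 0" for a :: "'b::field"
  proof
    assume "to_ac a = 0"
    then have "to_ac (a * inverse a) = 0" by (simp only: to_ac_mult) simp
    then show "a = 0" by (cases "a = 0") auto
  qed simp
  from this[of "Fract p 1 - Fract q 1"] show ?thesis
    by (simp add: embed_def eq_fract)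
qed

lemma embed_0 [simp]: "embed 0 = 0" and embed_1 [simp]: "embed 1 = 1"
  by (simp_all add: embed_def Zero_fract_def[symmetric] One_fract_def[symmetric])

lemma embed_eq_0_iff [simp]: "embed p = 0 \<longleftrightarrow> p = 0"
  using embed_eq_iff[of p 0] by (simp del: embed_eq_iff)

lemma embed_add: "embed (p + q) = embed p + embed q"
  by (simp add: embed_def to_ac_add[symmetric] del: to_ac_add)

lemma embed_mult: "embed (p * q) = embed p * embed q"
  by (simp add: embed_def to_ac_mult[symmetric] del: to_ac_mult)

interpretation aeval: coeff_hom "\<lambda>z :: complex. embed (pconst z)"
  by unfold_locales (auto simp: pconst_eq_mconst mconst_add mconst_mult embed_add embed_mult)

lemma ceval_pvar [simp]: "ceval \<sigma> (pvar v) = \<sigma> v"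
  by (simp add: pvar_eq_mvar)

lemma ceval_pconst [simp]: "ceval \<sigma> (pconst z) = z"
  by (simp add: pconst_eq_mconst)

lemma aeval_pvar [simp]: "aeval \<sigma> (pvar v) = \<sigma> v"
  by (simp add: aeval_def pvar_eq_mvar)

lemma aeval_pconst [simp]: "aeval \<sigma> (pconst z) = embed (pconst z)"
  using aeval.peval_mconst[of \<sigma> z] by (simp add: aeval_def pconst_eq_mconst)

lemma aeval_gen: "aeval gen p = embed p"
proof (induction p rule: poly_over_induct)
  case (const z)
  show ?case using aeval_pconst[of gen z] by (simp only: pconst_eq_mconst)
next
  case (var v)
  show ?case by (metis aeval_pvar gen_def pvar_eq_mvar)
next
  case (add p q)
  then show ?case by (simp only: aeval_def aeval.peval_add embed_add)
next
  case (mult p q)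
  then show ?case by (simp only: aeval_def aeval.peval_mult embed_mult)
qed

text \<open>Converts values between two sets of variables: Zariski closed sets are given by
  polynomials in the coordinates of a point, everything else by polynomials in
  \<open>'n var\<close>.\<close>

lemma peval_peval:
  fixes p :: "('v, 'a::comm_ring_1) poly_over" and \<sigma> :: "'v \<Rightarrow> ('w, 'a) poly_over"
  assumes "coeff_hom emb"
  shows "peval emb \<tau> (peval mconst \<sigma> p) = peval emb (\<lambda>v. peval emb \<tau> (\<sigma> v)) p"
proof -
  interpret coeff_hom emb by fact
  show ?thesis by (induction p rule: poly_over_induct) simp_all
qed

section \<open>Derivations of the polynomial ring\<close>

text \<open>Only derivations of the full polynomial ring over the complex numbers are considered.
  Those that map an ideal into itself represent derivations of the quotient.\<close>

definition derivation :: "('n mpoly \<Rightarrow> 'n mpoly) \<Rightarrow> bool"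
  where "derivation D \<longleftrightarrow> (\<forall>p q. D (p + q) = D p + D q) \<and> (\<forall>p q. D (p * q) = p * D q + D p * q) \<and>
    (\<forall>z. D (pconst z) = 0)"

lemma derivation_add: "derivation D \<Longrightarrow> D (p + q) = D p + D q"
  and derivation_mult: "derivation D \<Longrightarrow> D (p * q) = p * D q + D p * q"
  and derivation_pconst: "derivation D \<Longrightarrow> D (pconst z) = 0"
  by (simp_all add: derivation_def)

lemma derivation_0: "derivation D \<Longrightarrow> D 0 = 0"
  using derivation_pconst[of D 0] by (simp add: pconst_def)

lemma derivation_1: "derivation D \<Longrightarrow> D 1 = 0"
  using derivation_pconst[of D 1] by (simp add: pconst_def)

lemma derivation_uminus: "derivation D \<Longrightarrow> D (- p) = - D p"
  using derivation_add[of D p "- p"] by (simp add: derivation_0 eq_neg_iff_add_eq_0 add.commute)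

lemma derivation_diff: "derivation D \<Longrightarrow> D (p - q) = D p - D q"
  using derivation_add[of D p "- q"] by (simp add: derivation_uminus)

lemma derivation_sum: "derivation D \<Longrightarrow> D (sum g A) = (\<Sum>a\<in>A. D (g a))"
  by (induction A rule: infinite_finite_induct) (simp_all add: derivation_0 derivation_add)

lemma pdiff_superset:
  assumes "finite A" "Poly_Mapping.keys p \<subseteq> A"
  shows "pdiff v p = (\<Sum>m\<in>A. Poly_Mapping.single (m - Poly_Mapping.single v 1)
       (of_nat (Poly_Mapping.lookup m v) * Poly_Mapping.lookup p m))"
  unfolding pdiff_def
  by (rule sum.mono_neutral_left) (use assms in \<open>auto simp: in_keys_iff\<close>)

lemma pdiff_single:
  "pdiff v (Poly_Mapping.single m a) =
    Poly_Mapping.single (m - Poly_Mapping.single v 1) (of_nat (Poly_Mapping.lookup m v) * a)"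
  by (subst pdiff_superset[of "{m}"]) auto

lemma pdiff_add: "pdiff v (p + q) = pdiff v p + pdiff v q"
proof -
  let ?A = "Poly_Mapping.keys p \<union> Poly_Mapping.keys q"
  have "pdiff v (p + q) = (\<Sum>m\<in>?A. Poly_Mapping.single (m - Poly_Mapping.single v 1)
       (of_nat (Poly_Mapping.lookup m v) * Poly_Mapping.lookup (p + q) m))"
    by (rule pdiff_superset) (use keys_add[of p q] in auto)
  then show ?thesis
    by (simp add: pdiff_superset[of ?A] lookup_add distrib_left single_add sum.distrib)
qed

lemma pdiff_sum: "pdiff v (sum g A) = (\<Sum>a\<in>A. pdiff v (g a))"
proof (induction A rule: infinite_finite_induct)
  case (infinite A)
  then show ?case by (simp add: pdiff_def)
qed (simp_all add: pdiff_add, simp add: pdiff_def)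

lemma pdiff_mult_single:
  "pdiff v (Poly_Mapping.single m a * Poly_Mapping.single m' b) =
    Poly_Mapping.single m a * pdiff v (Poly_Mapping.single m' b) +
    pdiff v (Poly_Mapping.single m a) * Poly_Mapping.single m' b"
proof -
  let ?e = "Poly_Mapping.single v (1::nat)" and ?l = Poly_Mapping.lookup
  have shift: "Poly_Mapping.single (m + (m' - ?e)) (of_nat (?l m' v) * z) =
      Poly_Mapping.single (m + m' - ?e) (of_nat (?l m' v) * z)" for m m' :: "'a var \<Rightarrow>\<^sub>0 nat" and z :: complex
  proof (cases "?l m' v = 0")
    case False
    have "m + (m' - ?e) = m + m' - ?e"
      by (rule poly_mapping_eqI) (use False in \<open>auto simp: lookup_add lookup_minus lookup_single when_def\<close>)
    then show ?thesis by simp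
  qed simp
  have "Poly_Mapping.single m a * pdiff v (Poly_Mapping.single m' b) +
      pdiff v (Poly_Mapping.single m a) * Poly_Mapping.single m' b =
      Poly_Mapping.single (m + (m' - ?e)) (of_nat (?l m' v) * (a * b)) +
      Poly_Mapping.single (m' + (m - ?e)) (of_nat (?l m v) * (a * b))"
    by (simp add: pdiff_single mult_single algebra_simps)
  also have "\<dots> = Poly_Mapping.single (m + m' - ?e) ((of_nat (?l m' v) + of_nat (?l m v)) * (a * b))"
    by (simp only: shift distrib_right single_add add.commute[of m' m])
  finally show ?thesis
    by (simp add: pdiff_single mult_single lookup_add add.commute)
qed

lemma derivation_pdiff: "derivation (pdiff v)"
  unfolding derivation_def
proof (intro conjI allI)
  fix p q :: "'a mpoly"
  let ?s = Poly_Mapping.single and ?l = Poly_Mapping.lookup and ?k = Poly_Mapping.keys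
  have p: "p = (\<Sum>m\<in>?k p. ?s m (?l p m))" and q: "q = (\<Sum>m\<in>?k q. ?s m (?l q m))"
    by (rule poly_mapping_sum_monomials)+
  have "pdiff v (p * q) = (\<Sum>m\<in>?k p. \<Sum>m'\<in>?k q. pdiff v (?s m (?l p m) * ?s m' (?l q m')))"
    by (subst p, subst q) (simp only: sum_product pdiff_sum)
  also have "\<dots> = (\<Sum>m\<in>?k p. ?s m (?l p m)) * (\<Sum>m'\<in>?k q. pdiff v (?s m' (?l q m'))) +
      (\<Sum>m\<in>?k p. pdiff v (?s m (?l p m))) * (\<Sum>m'\<in>?k q. ?s m' (?l q m'))"
    by (simp only: pdiff_mult_single sum_product sum.distrib)
  also have "\<dots> = p * pdiff v q + pdiff v p * q"
    by (simp only: pdiff_sum[symmetric] p[symmetric] q[symmetric])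
  finally show "pdiff v (p * q) = p * pdiff v q + pdiff v p * q" .
qed (simp_all add: pdiff_add pconst_def pdiff_single)

lemmas pdiff_mult = derivation_mult[OF derivation_pdiff]
lemmas pdiff_diff = derivation_diff[OF derivation_pdiff]

lemma pdiff_pvar [simp]: "pdiff v (pvar w) = (if v = w then 1 else 0)"
  by (simp add: pvar_def pdiff_single lookup_single)

lemma pdiff_pconst [simp]: "pdiff v (pconst z) = 0"
  by (rule derivation_pconst[OF derivation_pdiff])

lemma pdiff_0 [simp]: "pdiff v 0 = 0"
  by (rule derivation_0[OF derivation_pdiff])

lemma pdiff_1 [simp]: "pdiff v 1 = 0"
  by (rule derivation_1[OF derivation_pdiff])

lemma derivation_chain:
  assumes "finite V" "p \<in> polys V" "derivation D"
  shows "D p = (\<Sum>v\<in>V. pdiff v p * D (pvar v))"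
  using assms(2)
proof (induction rule: polys_induct)
  case (const z)
  then show ?case by (simp add: derivation_pconst assms)
next
  case (var w)
  then show ?case using assms(1)
    by (simp add: if_distrib[of "\<lambda>a. a * _"] sum.delta cong: if_cong)
next
  case (add p q)
  then show ?case
    by (simp add: derivation_add[OF assms(3)] pdiff_add distrib_right sum.distrib)
next
  case (mult p q)
  then show ?case
    by (simp add: derivation_mult[OF assms(3)] pdiff_mult distrib_right distrib_left sum.distrib sum_distrib_left
        sum_distrib_right mult_ac)
qed

lemma pdiff_commute: "pdiff v (pdiff w p) = pdiff w (pdiff v p)"
proof -
  have "p \<in> polys UNIV" by (simp add: polys_def)
  then show ?thesis
    by (induction rule: polys_induct) (simp_all add: pdiff_add pdiff_mult algebra_simps)
qed

lemma pdiff_in_polys: "p \<in> polys V \<Longrightarrow> pdiff v p \<in> polys V"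
  by (induction rule: polys_induct) (auto simp: pdiff_add pdiff_mult)

lemma pdiff_eq_0: "p \<in> polys V \<Longrightarrow> v \<notin> V \<Longrightarrow> pdiff v p = 0"
  by (induction rule: polys_induct) (auto simp: pdiff_add pdiff_mult)

lemma ceval_has_derivative:
  "((\<lambda>z. ceval (\<sigma>(v := z)) p) has_field_derivative ceval (\<sigma>(v := z0)) (pdiff v p)) (at z0)"
proof -
  have "p \<in> polys UNIV" by (simp add: polys_def)
  then show ?thesis
  proof (induction rule: polys_induct)
    case (var w)
    then show ?case by (cases "v = w") auto
  next
    case (mult p q)
    then show ?case
      by (auto simp: pdiff_mult intro!: derivative_eq_intros)
  qed (auto simp: pdiff_add intro!: derivative_eq_intros)
qed


section \<open>Polynomials as univariate polynomials\<close>

text \<open>The coefficients stay in the ring \<open>mpoly\<close> and merely do not contain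
  \<open>v\<close>. So evaluation at \<open>pvar v\<close> gives \<open>p\<close> back, and
  coefficients can be tested for membership in an ideal of that ring.\<close>

definition uni :: "'n var \<Rightarrow> 'n mpoly \<Rightarrow> 'n mpoly poly"
  where "uni v = peval (\<lambda>z. [:pconst z:]) (\<lambda>w. if w = v then [:0, 1:] else [:pvar w:])"

interpretation uni: coeff_hom "\<lambda>z :: complex. [:pconst z:]"
  by unfold_locales (auto simp: pconst_eq_mconst mconst_add mconst_mult one_pCons)

lemma uni_pconst [simp]: "uni v (pconst z) = [:pconst z:]"
  using uni.peval_mconst by (simp add: uni_def pconst_eq_mconst)

lemma uni_pvar: "uni v (pvar w) = (if w = v then [:0, 1:] else [:pvar w:])"
  by (simp add: uni_def pvar_eq_mvar)

lemma uni_add: "uni v (p + q) = uni v p + uni v q"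
  by (simp add: uni_def)

lemma uni_mult: "uni v (p * q) = uni v p * uni v q"
  by (simp add: uni_def)

lemma uni_0 [simp]: "uni v 0 = 0"
  by (simp add: uni_def)

definition coeffs_in :: "'a::zero set \<Rightarrow> 'a poly \<Rightarrow> bool"
  where "coeffs_in A Q \<longleftrightarrow> (\<forall>k. Polynomial.coeff Q k \<in> A)"

definition subring_set :: "'a::comm_ring_1 set \<Rightarrow> bool"
  where "subring_set A \<longleftrightarrow> 1 \<in> A \<and> (\<forall>a\<in>A. \<forall>b\<in>A. a - b \<in> A \<and> a * b \<in> A)"

lemma subring_set_polys: "subring_set (polys V)"
  by (auto simp: subring_set_def)

lemma subring_setD:
  assumes "subring_set A"
  shows "1 \<in> A" "0 \<in> A" "a \<in> A \<Longrightarrow> - a \<in> A" "a \<in> A \<Longrightarrow> b \<in> A \<Longrightarrow> a - b \<in> A"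
    "a \<in> A \<Longrightarrow> b \<in> A \<Longrightarrow> a + b \<in> A" "a \<in> A \<Longrightarrow> b \<in> A \<Longrightarrow> a * b \<in> A" "a \<in> A \<Longrightarrow> a ^ k \<in> A"
    "(\<And>i. i \<in> I \<Longrightarrow> g i \<in> A) \<Longrightarrow> sum g I \<in> A"
proof -
  show 1: "1 \<in> A" and diff: "\<And>a b. a \<in> A \<Longrightarrow> b \<in> A \<Longrightarrow> a - b \<in> A"
    and mult: "\<And>a b. a \<in> A \<Longrightarrow> b \<in> A \<Longrightarrow> a * b \<in> A"
    using assms by (auto simp: subring_set_def)
  show 0: "0 \<in> A" using diff[OF 1 1] by simp
  show neg: "\<And>a. a \<in> A \<Longrightarrow> - a \<in> A" using diff[OF 0] by simp
  show add: "\<And>a b. a \<in> A \<Longrightarrow> b \<in> A \<Longrightarrow> a + b \<in> A" using diff[OF _ neg] by simp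
  show "a \<in> A \<Longrightarrow> a ^ k \<in> A" by (induction k) (auto intro: 1 mult)
  show "(\<And>i. i \<in> I \<Longrightarrow> g i \<in> A) \<Longrightarrow> sum g I \<in> A"
    by (induction I rule: infinite_finite_induct) (auto intro: 0 add)
qed

lemma coeffs_in_ops:
  assumes "subring_set A"
  shows "coeffs_in A P \<Longrightarrow> coeffs_in A Q \<Longrightarrow> coeffs_in A (P + Q)"
    "coeffs_in A P \<Longrightarrow> coeffs_in A Q \<Longrightarrow> coeffs_in A (P - Q)"
    "coeffs_in A P \<Longrightarrow> coeffs_in A Q \<Longrightarrow> coeffs_in A (P * Q)"
    "a \<in> A \<Longrightarrow> coeffs_in A P \<Longrightarrow> coeffs_in A (Polynomial.smult a P)"
    "a \<in> A \<Longrightarrow> coeffs_in A (Polynomial.monom a k)"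
    "a \<in> A \<Longrightarrow> coeffs_in A [:a:]" "coeffs_in A 0"
  using subring_setD[OF assms]
  by (auto simp: coeffs_in_def coeff_mult coeff_pCons split: nat.splits intro!: subring_setD(8)[OF assms])

lemma coeffs_in_uni:
  assumes "p \<in> polys V"
  shows "coeffs_in (polys (V - {v})) (uni v p)"
proof -
  note ops = coeffs_in_ops[OF subring_set_polys]
  show ?thesis
    using assms
  proof (induction rule: polys_induct)
    case (var w)
    then show ?case by (auto simp: uni_pvar coeffs_in_def coeff_pCons split: nat.splits)
  qed (auto simp: uni_add uni_mult intro: ops)
qed

lemma poly_uni [simp]: "poly (uni v p) (pvar v) = p"
proof -
  have "p \<in> polys UNIV" by (simp add: polys_def)
  then show ?thesis
    by (induction rule: polys_induct) (auto simp: uni_add uni_mult uni_pvar)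
qed

lemma uni_eq_0_iff [simp]: "uni v p = 0 \<longleftrightarrow> p = 0"
  using poly_uni[of v p] by (auto simp del: poly_uni)

lemma uni_const: "p \<in> polys V \<Longrightarrow> v \<notin> V \<Longrightarrow> uni v p = [:p:]"
  by (induction rule: polys_induct) (auto simp: uni_add uni_mult uni_pvar)

lemma uni_poly:
  assumes "coeffs_in (polys V) Q" "v \<notin> V"
  shows "uni v (poly Q (pvar v)) = Q"
proof -
  have "uni v (poly Q (pvar v)) = (\<Sum>i\<le>Polynomial.degree Q. uni v (Polynomial.coeff Q i) * uni v (pvar v) ^ i)"
    by (simp add: poly_altdef uni_def)
  also have "\<dots> = (\<Sum>i\<le>Polynomial.degree Q. Polynomial.monom (Polynomial.coeff Q i) i)"
    using assms by (intro sum.cong refl)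
      (simp add: coeffs_in_def uni_const[where V = V] uni_pvar monom_altdef)
  also have "\<dots> = Q" by (rule poly_as_sum_of_monoms)
  finally show ?thesis .
qed

lemma poly_in_subring: "subring_set A \<Longrightarrow> coeffs_in A Q \<Longrightarrow> t \<in> A \<Longrightarrow> poly Q t \<in> A"
  unfolding poly_altdef coeffs_in_def by (intro subring_setD(8) subring_setD(6,7)) auto

lemma polys_insertE:
  assumes "p \<in> polys (insert v V)" "v \<notin> V"
  obtains "coeffs_in (polys V) (uni v p)"
  using coeffs_in_uni[OF assms(1), of v] assms(2) by simp

section \<open>Ring homomorphisms on the coefficients of univariate polynomials\<close>

context coeff_hom
begin

lemma map_poly_mult: "map_poly emb (P * Q) = map_poly emb P * map_poly emb Q"
proof -
  have sum: "emb (sum g A) = (\<Sum>a\<in>A. emb (g a))" for g :: "nat \<Rightarrow> 'a" and A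
    by (induction A rule: infinite_finite_induct) (simp_all add: emb_0 emb_add)
  show ?thesis
    by (rule poly_eqI) (simp add: coeff_map_poly emb_0 coeff_mult sum emb_mult)
qed

lemma emb_uminus: "emb (- a) = - emb a"
  using emb_add[of a "- a"] by (simp add: emb_0 eq_neg_iff_add_eq_0 add.commute)

lemma emb_diff: "emb (a - b) = emb a - emb b"
  using emb_add[of a "- b"] by (simp add: emb_uminus)

lemma map_poly_diff: "map_poly emb (P - Q) = map_poly emb P - map_poly emb Q"
  by (rule poly_eqI) (simp add: coeff_map_poly emb_0 emb_diff)

lemma map_poly_smult: "map_poly emb (Polynomial.smult a P) = Polynomial.smult (emb a) (map_poly emb P)"
  by (rule poly_eqI) (simp add: coeff_map_poly emb_0 emb_mult)

lemma map_poly_add: "map_poly emb (P + Q) = map_poly emb P + map_poly emb Q"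
  by (rule poly_eqI) (simp add: coeff_map_poly emb_0 emb_add)

lemma emb_poly: "emb (poly Q t) = poly (map_poly emb Q) (emb t)"
  by (induction Q) (simp_all add: emb_0 emb_add emb_mult map_poly_pCons)

lemma map_poly_prod_linear:
  "map_poly emb (\<Prod>k\<in>#K. [:- g k, 1:]) = (\<Prod>k\<in>#K. [:- emb (g k), 1:])"
proof (induction K)
  case empty
  then show ?case by (simp add: map_poly_1' emb_1)
next
  case (add k K)
  have "map_poly emb [:- g k, 1:] = [:- emb (g k), 1:]"
    by (simp add: map_poly_pCons emb_0 emb_1 emb_uminus)
  then show ?case using add by (simp add: map_poly_mult del: mult_pCons_left mult_pCons_right)
qed

end

lemma coeff_hom_ceval: "coeff_hom (ceval \<rho>)"
  by unfold_locales auto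

lemma ceval_uni: "ceval \<rho> p = poly (map_poly (ceval \<rho>) (uni v p)) (\<rho> v)"
  using coeff_hom.emb_poly[OF coeff_hom_ceval, of \<rho> "uni v p" "pvar v"] by simp

lemmas map_poly_ceval_mult = coeff_hom.map_poly_mult[OF coeff_hom_ceval]
  and map_poly_ceval_add = coeff_hom.map_poly_add[OF coeff_hom_ceval]
  and map_poly_ceval_smult = coeff_hom.map_poly_smult[OF coeff_hom_ceval]

lemma pdiff_poly_pderiv:
  assumes "coeffs_in (polys V) Q" "v \<notin> V"
  shows "pdiff v (poly Q (pvar v)) = poly (pderiv Q) (pvar v)"
  using assms(1)
proof (induction Q)
  case (pCons a Q)
  have c: "Polynomial.coeff (pCons a Q) k \<in> polys V" for k
    using pCons.prems by (auto simp: coeffs_in_def)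
  have "coeffs_in (polys V) Q" "a \<in> polys V"
    using c[of "Suc _"] c[of 0] by (auto simp: coeffs_in_def)
  with pCons.IH show ?case
    by (simp add: pderiv_pCons pdiff_add pdiff_mult pdiff_eq_0[OF _ assms(2)] algebra_simps)
qed simp

section \<open>Relations modulo a prime ideal\<close>

locale ring_ideal =
  fixes P :: "'a::comm_ring_1 set"
  assumes zero: "0 \<in> P"
    and add: "p \<in> P \<Longrightarrow> q \<in> P \<Longrightarrow> p + q \<in> P"
    and mult_left: "p \<in> P \<Longrightarrow> r * p \<in> P"
begin

lemma mult_right: "p \<in> P \<Longrightarrow> p * r \<in> P"
  using mult_left[of p r] by (simp add: mult.commute)

lemma uminus: "p \<in> P \<Longrightarrow> - p \<in> P"
  using mult_left[of p "- 1"] by simp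

lemma diff: "p \<in> P \<Longrightarrow> q \<in> P \<Longrightarrow> p - q \<in> P"
  using add[of p "- q"] uminus by simp

lemma sum: "(\<And>i. i \<in> I \<Longrightarrow> g i \<in> P) \<Longrightarrow> sum g I \<in> P"
  by (induction I rule: infinite_finite_induct) (auto intro: zero add)

lemma diff_cancel: "q \<in> P \<Longrightarrow> p - q \<in> P \<longleftrightarrow> p \<in> P"
  using diff[of p q] add[of "p - q" q] by auto

lemma poly_coeffs_in: "coeffs_in P Q \<Longrightarrow> poly Q t \<in> P"
  unfolding poly_altdef coeffs_in_def by (intro sum mult_right) auto

end

locale prime_ring_ideal = ring_ideal P for P :: "'a::idom set" +
  assumes one: "1 \<notin> P"
    and prime: "p * q \<in> P \<Longrightarrow> p \<in> P \<or> q \<in> P"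
begin

lemma mult_iff: "p * q \<in> P \<longleftrightarrow> p \<in> P \<or> q \<in> P"
  using prime mult_left mult_right by blast

lemma power_notin: "p \<notin> P \<Longrightarrow> p ^ k \<notin> P"
  by (induction k) (auto simp: one mult_iff)

lemma prod_notin: "(\<And>i. i \<in> I \<Longrightarrow> g i \<notin> P) \<Longrightarrow> prod g I \<notin> P"
  by (induction I rule: infinite_finite_induct) (auto simp: one mult_iff)

end

text \<open>In each reduction F is multiplied by the leading coefficient of M instead of being
  divided by it. So no fractions arise and all coefficients stay in the subring A.\<close>

lemma pseudo_division:
  fixes M F :: "'a::idom poly"
  assumes A: "subring_set A" and M: "coeffs_in A M" "M \<noteq> 0" and F: "coeffs_in A F"
  obtains N S R where "Polynomial.smult (Polynomial.lead_coeff M ^ N) F = M * S + R" "coeffs_in A S" "coeffs_in A R"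
    "R = 0 \<or> Polynomial.degree R < Polynomial.degree M"
proof -
  note ops = coeffs_in_ops[OF A]
  \<comment> \<open>One more than the degree, and 0 for the zero polynomial, so that the step from a
    nonzero constant to 0 also decreases the measure.\<close>
  define n where "n = (if F = 0 then 0 else Suc (Polynomial.degree F))"
  have "F = 0 \<or> Polynomial.degree F < n" by (auto simp: n_def)
  then have "\<exists>N S R. Polynomial.smult (Polynomial.lead_coeff M ^ N) F = M * S + R \<and> coeffs_in A S \<and> coeffs_in A R \<and>
    (R = 0 \<or> Polynomial.degree R < Polynomial.degree M)"
    using F
  proof (induction n arbitrary: F)
    case 0
    then show ?case by (intro exI[of _ 0] exI[of _ "0 :: 'a poly"]) (auto intro: ops)
  next
    case (Suc n)
    show ?case
    proof (cases "F = 0 \<or> Polynomial.degree F < Polynomial.degree M")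
      case True
      then show ?thesis
        using Suc.prems by (intro exI[of _ 0] exI[of _ "0 :: 'a poly"] exI[of _ F]) (auto intro: ops)
    next
      case False
      let ?d = "Polynomial.degree F - Polynomial.degree M"
      let ?m = "Polynomial.monom (Polynomial.lead_coeff F) ?d"
      define F' where "F' = Polynomial.smult (Polynomial.lead_coeff M) F - ?m * M"
      have lcs: "Polynomial.lead_coeff M \<in> A" "Polynomial.lead_coeff F \<in> A"
        using M Suc.prems by (auto simp: coeffs_in_def)
      have m: "coeffs_in A ?m" by (intro ops lcs)
      have c: "coeffs_in A F'" unfolding F'_def using lcs M Suc.prems by (intro ops) auto
      have "Polynomial.degree (?m * M) \<le> Polynomial.degree F"
        using False by (intro order.trans[OF degree_mult_le] order.trans[OF add_right_mono[OF degree_monom_le]]) auto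
      then have le: "Polynomial.degree F' \<le> Polynomial.degree F"
        unfolding F'_def by (intro degree_diff_le) auto
      have "Polynomial.coeff (?m * M) (Polynomial.degree F) = Polynomial.lead_coeff F * Polynomial.lead_coeff M"
        using coeff_monom_mult[of "Polynomial.lead_coeff F" ?d M "Polynomial.degree F"] False by simp
      then have "Polynomial.coeff F' (Polynomial.degree F) = 0"
        by (simp add: F'_def mult.commute)
      then have "F' = 0 \<or> Polynomial.degree F' < Polynomial.degree F"
        using eq_zero_or_degree_less[OF le] by blast
      then have "F' = 0 \<or> Polynomial.degree F' < n"
        using Suc.prems(1) False by auto
      from Suc.IH[OF this c] obtain N S R where
        *: "Polynomial.smult (Polynomial.lead_coeff M ^ N) F' = M * S + R" "coeffs_in A S" "coeffs_in A R"
          "R = 0 \<or> Polynomial.degree R < Polynomial.degree M"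
        by blast
      let ?S = "S + Polynomial.smult (Polynomial.lead_coeff M ^ N) ?m"
      have "Polynomial.smult (Polynomial.lead_coeff M ^ Suc N) F = M * ?S + R"
        using *(1) by (simp add: F'_def smult_diff_right algebra_simps)
      moreover have "coeffs_in A ?S"
        using * lcs m subring_setD(7)[OF A] by (intro ops) auto
      ultimately show ?thesis using * by blast
    qed
  qed
  then show thesis using that by blast
qed

context prime_ring_ideal
begin

text \<open>The image of \<open>M\<close> is, up to a factor, the minimal polynomial of the image of \<open>t\<close> over the field of
  fractions of \<open>A / (A \<inter> P)\<close>.\<close>

definition min_rel :: "'a set \<Rightarrow> 'a \<Rightarrow> 'a poly \<Rightarrow> bool"
  where "min_rel A t M \<longleftrightarrow> coeffs_in A M \<and> poly M t \<in> P \<and> Polynomial.lead_coeff M \<notin> P \<and> Polynomial.degree M > 0 \<and>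
    (\<forall>Q. coeffs_in A Q \<longrightarrow> poly Q t \<in> P \<longrightarrow> Polynomial.degree Q < Polynomial.degree M \<longrightarrow> coeffs_in P Q)"

text \<open>Among the relations for t that are nontrivial modulo P, one of least degree is taken. If
  its leading coefficient were in P, dropping the leading term would leave a nontrivial relation of
  smaller degree.\<close>

lemma ex_min_rel:
  assumes A: "subring_set A" and Q0: "coeffs_in A Q0" "poly Q0 t \<in> P" "\<not> coeffs_in P Q0"
  obtains M where "min_rel A t M"
proof -
  let ?B = "\<lambda>Q. coeffs_in A Q \<and> poly Q t \<in> P \<and> \<not> coeffs_in P Q"
 obtain M where M: "?B M" and min: "\<And>Q. ?B Q \<Longrightarrow> Polynomial.degree M \<le> Polynomial.degree Q"
    using ex_has_least_nat[of ?B Q0 Polynomial.degree] Q0 by blast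
  have lc: "Polynomial.lead_coeff M \<notin> P"
  proof
    assume lc: "Polynomial.lead_coeff M \<in> P"
    let ?m = "Polynomial.monom (Polynomial.lead_coeff M) (Polynomial.degree M)"
    obtain k where k: "Polynomial.coeff M k \<notin> P" using M by (auto simp: coeffs_in_def)
    then have "k \<noteq> Polynomial.degree M" using lc by auto
    then have k': "Polynomial.coeff (M - ?m) k \<notin> P" using k by simp
    then have nz: "M - ?m \<noteq> 0" using zero by (metis coeff_0)
    have "Polynomial.degree (M - ?m) \<le> Polynomial.degree M"
      by (intro degree_diff_le degree_monom_le order.refl)
    moreover have "Polynomial.coeff (M - ?m) (Polynomial.degree M) = 0" by simp
    ultimately have "Polynomial.degree (M - ?m) < Polynomial.degree M"
      using eq_zero_or_degree_less nz by blast
    moreover have "?B (M - ?m)"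
    proof (intro conjI)
      show "coeffs_in A (M - ?m)" using M A by (intro coeffs_in_ops) (auto simp: coeffs_in_def)
      show "poly (M - ?m) t \<in> P" using M lc by (auto simp: Polynomial.poly_monom intro!: diff mult_right)
      show "\<not> coeffs_in P (M - ?m)" using k' unfolding coeffs_in_def by blast
    qed
    ultimately show False using min[of "M - ?m"] by simp
  qed
  have "Polynomial.degree M > 0"
  proof (rule ccontr)
    assume "\<not> Polynomial.degree M > 0"
    then obtain a where "M = [:a:]" by (auto elim: degree_eq_zeroE)
    then show False using M lc by simp
  qed
  moreover have "coeffs_in P Q" if "coeffs_in A Q" "poly Q t \<in> P" "Polynomial.degree Q < Polynomial.degree M" for Q
    using min[of Q] that by auto
  ultimately show thesis using that[of M] M lc by (auto simp: min_rel_def)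
qed

text \<open>The pseudo-remainder has its value at t in P and is zero or of smaller degree than M, so
  minimality puts all its coefficients into P. Modulo P, every relation for t is thus a multiple of
  M, up to a power of the leading coefficient.\<close>

lemma min_rel_division:
  assumes A: "subring_set A" and M: "min_rel A t M" and Q: "coeffs_in A Q" "poly Q t \<in> P"
  obtains N S R where "Polynomial.smult (Polynomial.lead_coeff M ^ N) Q = M * S + R" "coeffs_in A S" "coeffs_in A R" "coeffs_in P R"
proof -
  have M': "coeffs_in A M" "M \<noteq> 0" using M zero by (auto simp: min_rel_def)
  obtain N S R where *: "Polynomial.smult (Polynomial.lead_coeff M ^ N) Q = M * S + R" "coeffs_in A S" "coeffs_in A R"
      "R = 0 \<or> Polynomial.degree R < Polynomial.degree M"
    using pseudo_division[OF A M' Q(1)] by blast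
  have "poly R t = Polynomial.lead_coeff M ^ N * poly Q t - poly M t * poly S t"
    using arg_cong[OF *(1), of "\<lambda>p. poly p t"] by (simp add: algebra_simps)
  moreover have "poly M t \<in> P" using M by (simp add: min_rel_def)
  ultimately have "poly R t \<in> P"
    using diff[OF mult_left[OF Q(2)] mult_right] by simp
  then have "coeffs_in P R"
    using * M by (auto simp: min_rel_def coeffs_in_def zero)
  then show thesis using that * by blast
qed

text \<open>The Euclidean algorithm for \<open>B\<close> and \<open>M\<close> over the field of fractions of \<open>A / (A \<inter> P)\<close>, without denominators.\<close>

lemma min_rel_multiple_in_subring:
  assumes A: "subring_set A" and M: "min_rel A t M" and B: "coeffs_in A B" "poly B t \<notin> P"
  obtains e Q where "e \<in> A" "e \<notin> P" "coeffs_in A Q" "e - poly B t * poly Q t \<in> P"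
proof -
  note ops = coeffs_in_ops[OF A]
  \<comment> \<open>Polynomials whose value at t is, modulo P, a nonzero multiple of the value of B.
    A member C of least degree plays the role of the gcd of B and M.\<close>
  let ?J = "\<lambda>C. coeffs_in A C \<and> poly C t \<notin> P \<and> (\<exists>Q. coeffs_in A Q \<and> poly C t - poly B t * poly Q t \<in> P)"
  have "?J B"
    using B subring_setD[OF A] by (auto simp: zero coeffs_in_def coeff_pCons split: nat.splits intro!: exI[of _ "[:1:]"])
  then obtain C where C: "?J C" and min: "\<And>D. ?J D \<Longrightarrow> Polynomial.degree C \<le> Polynomial.degree D"
    using ex_has_least_nat[of ?J _ Polynomial.degree] by blast
  obtain Q where Q: "coeffs_in A Q" "poly C t - poly B t * poly Q t \<in> P" using C by blast
  define c where "c = Polynomial.lead_coeff C"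
  define a where "a = Polynomial.lead_coeff M"
  have M': "coeffs_in A M" "poly M t \<in> P" "a \<notin> P" "Polynomial.degree M > 0" "M \<noteq> 0"
    using M by (auto simp: min_rel_def a_def)
  have cA: "c \<in> A" "a \<in> A" using C M' by (auto simp: c_def a_def coeffs_in_def)
  \<comment> \<open>If C is not constant, the remainder of M by C cannot be a member of
    \<open>?J\<close>, by minimality, so its value at t is in P. Then the cofactor S' has its value
    in P as well; its degree is below that of M, so all its coefficients are in P, which the leading
    coefficient of M contradicts.\<close>
  have "Polynomial.degree C = 0"
  proof (rule ccontr)
    assume deg: "Polynomial.degree C \<noteq> 0"
    then have C0: "C \<noteq> 0" by auto
    have c: "c \<notin> P"
    proof
      assume c: "c \<in> P"
      let ?C = "C - Polynomial.monom c (Polynomial.degree C)"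
      have ct: "c * t ^ Polynomial.degree C \<in> P" using c by (rule mult_right)
      have val: "poly ?C t = poly C t - c * t ^ Polynomial.degree C" by (simp add: Polynomial.poly_monom)
      have "poly ?C t \<notin> P" unfolding val diff_cancel[OF ct] using C by blast
      moreover have h: "poly ?C t - poly B t * poly Q t = (poly C t - poly B t * poly Q t) - c * t ^ Polynomial.degree C"
        by (simp add: Polynomial.poly_monom)
      have "poly ?C t - poly B t * poly Q t \<in> P" unfolding h by (rule diff[OF Q(2) ct])
      moreover have "coeffs_in A ?C" using C cA by (intro ops) auto
      ultimately have J: "?J ?C" using Q by blast
      then have "?C \<noteq> 0" using zero by auto
      moreover have "Polynomial.degree ?C \<le> Polynomial.degree C"
        by (intro degree_diff_le degree_monom_le order.refl)
      moreover have "Polynomial.coeff ?C (Polynomial.degree C) = 0" by (simp add: c_def)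
      ultimately have "Polynomial.degree ?C < Polynomial.degree C"
        using eq_zero_or_degree_less by blast
      then show False using min[OF J] by simp
    qed
    have "coeffs_in A C" using C by blast
    \<comment> \<open>The remainder of C by M is again in \<open>?J\<close>, hence the degree of C
      is below that of M.\<close>
    obtain N S R where S: "Polynomial.smult (a ^ N) C = M * S + R" "coeffs_in A S" "coeffs_in A R"
      "R = 0 \<or> Polynomial.degree R < Polynomial.degree M"
      using pseudo_division[OF A M'(1,5) \<open>coeffs_in A C\<close>] unfolding a_def by blast
    have R: "poly R t = a ^ N * poly C t - poly M t * poly S t"
      using arg_cong[OF S(1), of "\<lambda>p. poly p t"] by (simp add: algebra_simps)
    have Rn: "poly R t \<notin> P"
      unfolding R using M' C power_notin[of a N] by (subst diff_cancel) (auto intro: mult_right simp: mult_iff)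
    have "poly R t - poly B t * poly (Polynomial.smult (a ^ N) Q) t =
        a ^ N * (poly C t - poly B t * poly Q t) - poly M t * poly S t"
      by (simp add: R algebra_simps)
    also have "\<dots> \<in> P" by (rule diff[OF mult_left[OF Q(2)] mult_right[OF M'(2)]])
    finally have "?J R"
      using S Rn Q cA subring_setD(7)[OF A] ops(4) by blast
    then have "Polynomial.degree C \<le> Polynomial.degree R" by (rule min)
    moreover have "R \<noteq> 0" using Rn zero by auto
    ultimately have degCM: "Polynomial.degree C < Polynomial.degree M" using S(4) by auto
    obtain N' S' R' where S': "Polynomial.smult (c ^ N') M = C * S' + R'" "coeffs_in A S'" "coeffs_in A R'"
      "R' = 0 \<or> Polynomial.degree R' < Polynomial.degree C"
      using pseudo_division[OF A \<open>coeffs_in A C\<close> C0 M'(1)] unfolding c_def by blast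
    have R': "poly R' t = c ^ N' * poly M t - poly C t * poly S' t"
      using arg_cong[OF S'(1), of "\<lambda>p. poly p t"] by (simp add: algebra_simps)
    have R'P: "poly R' t \<in> P"
    proof (rule ccontr)
      assume R'n: "poly R' t \<notin> P"
      have "poly R' t - poly B t * poly (- (Q * S')) t =
          c ^ N' * poly M t - (poly C t - poly B t * poly Q t) * poly S' t"
        by (simp add: R' algebra_simps)
      also have "\<dots> \<in> P" by (rule diff[OF mult_left[OF M'(2)] mult_right[OF Q(2)]])
      finally have "poly R' t - poly B t * poly (- (Q * S')) t \<in> P" .
      moreover have "coeffs_in A (- (Q * S'))"
        using ops(2)[OF ops(7) ops(3)[OF Q(1) S'(2)]] by simp
      ultimately have "?J R'" using S' R'n by blast
      then have "Polynomial.degree C \<le> Polynomial.degree R'" by (rule min)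
      then show False using S'(4) R'n zero by auto
    qed
    have degR': "R' = 0 \<or> Polynomial.degree R' < Polynomial.degree M" using S'(4) degCM by auto
    then have R'c: "coeffs_in P R'"
      using M S'(3) R'P by (auto simp: min_rel_def coeffs_in_def zero)
    have "poly C t * poly S' t = c ^ N' * poly M t - poly R' t" by (simp add: R')
    then have "poly C t * poly S' t \<in> P" using diff[OF mult_left[OF M'(2)] R'P] by simp
    then have S'P: "poly S' t \<in> P" using C prime by blast
    have cn: "c ^ N' \<noteq> 0" using C0 by (simp add: c_def)
    have eq: "C * S' = Polynomial.smult (c ^ N') M - R'" using S'(1) by simp
    \<comment> \<open>The remainder R' does not reach the degree of M, so this coefficient is a
      product of elements outside P.\<close>
    have coeffM: "Polynomial.coeff (C * S') (Polynomial.degree M) = c ^ N' * a"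
      unfolding eq using degR' by (auto simp: a_def coeff_eq_0)
    then have "C * S' \<noteq> 0" using cn M' zero by auto
    then have "Polynomial.degree (C * S') = Polynomial.degree C + Polynomial.degree S'"
      by (intro degree_mult_eq) auto
    moreover have "Polynomial.degree (C * S') \<le> Polynomial.degree M"
      unfolding eq using degR' by (intro degree_diff_le) auto
    ultimately have "Polynomial.degree S' < Polynomial.degree M" using deg by linarith
    then have "coeffs_in P S'" using M S'(2) S'P by (auto simp: min_rel_def)
    then have "Polynomial.coeff (C * S') (Polynomial.degree M) \<in> P"
      by (auto simp: coeff_mult coeffs_in_def intro!: sum mult_left)
    then show False using coeffM power_notin[OF c] M' by (simp add: mult_iff)
  qed
  then obtain e where "C = [:e:]" by (rule degree_eq_zeroE)
  then show thesis
    using that[of e Q] C Q by (auto simp: coeffs_in_def dest: spec[of _ 0])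
qed

end

section \<open>Extending specializations\<close>

locale prime_poly_ideal = prime_ring_ideal P for P :: "'n mpoly set"
begin

lemma coeff_map_ceval_in_P:
  assumes "\<forall>p\<in>P \<inter> polys V. ceval \<rho> p = 0" "coeffs_in (polys V) Q" "coeffs_in P Q"
  shows "map_poly (ceval \<rho>) Q = 0"
  using assms by (intro poly_eqI) (auto simp: coeff_map_poly coeffs_in_def)

lemma ceval_upd:
  assumes "coeffs_in (polys V) Q" "v \<notin> V"
  shows "map_poly (ceval (\<rho>(v := z))) Q = map_poly (ceval \<rho>) Q"
  using assms by (intro poly_eqI) (auto simp: coeff_map_poly coeffs_in_def intro!: peval_cong_vars[where V = V])

text \<open>If t is transcendental modulo P, every p in P has its coefficients in P, so any z off
  the roots of the specialized b will do, and \<open>g\<close> is a coefficient of b outside P. If t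
  is algebraic, z has to be a root of the specialized minimal relation; \<open>g\<close> is then the
  product of its leading coefficient \<open>a\<close> and an element \<open>e\<close> free of v that
  is a multiple of b modulo P.\<close>

lemma specialization_extends_step:
  assumes v: "v \<notin> V" and b: "b \<in> polys (insert v V)" "b \<notin> P"
  obtains g where "g \<in> polys V" "g \<notin> P"
    "\<forall>\<rho>. (\<forall>p\<in>P \<inter> polys V. ceval \<rho> p = 0) \<longrightarrow> ceval \<rho> g \<noteq> 0 \<longrightarrow>
      (\<exists>z. (\<forall>p\<in>P \<inter> polys (insert v V). ceval (\<rho>(v := z)) p = 0) \<and> ceval (\<rho>(v := z)) b \<noteq> 0)"
proof -
  let ?A = "polys V" and ?t = "pvar v"
  note A = subring_set_polys[of V]
  have uni_in: "coeffs_in ?A (uni v p)" if "p \<in> polys (insert v V)" for p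
    using polys_insertE[OF that v] .
  have ev: "ceval (\<rho>(v := z)) p = poly (map_poly (ceval \<rho>) (uni v p)) z" if "p \<in> polys (insert v V)" for p \<rho> z
    using ceval_uni[of "\<rho>(v := z)" p v] by (simp add: ceval_upd[OF uni_in[OF that] v])
  show thesis
  proof (cases "\<forall>Q. coeffs_in ?A Q \<longrightarrow> poly Q ?t \<in> P \<longrightarrow> coeffs_in P Q")
    case True
    have "\<not> coeffs_in P (uni v b)" using poly_coeffs_in[of "uni v b" ?t] b by auto
    then obtain k where k: "Polynomial.coeff (uni v b) k \<notin> P" by (auto simp: coeffs_in_def)
    show thesis
    proof (rule that)
      show "Polynomial.coeff (uni v b) k \<in> ?A" using uni_in[OF b(1)] by (simp add: coeffs_in_def)
      show "Polynomial.coeff (uni v b) k \<notin> P" by (rule k)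
      show "\<forall>\<rho>. (\<forall>p\<in>P \<inter> ?A. ceval \<rho> p = 0) \<longrightarrow> ceval \<rho> (Polynomial.coeff (uni v b) k) \<noteq> 0 \<longrightarrow>
        (\<exists>z. (\<forall>p\<in>P \<inter> polys (insert v V). ceval (\<rho>(v := z)) p = 0) \<and> ceval (\<rho>(v := z)) b \<noteq> 0)"
      proof (intro allI impI)
      fix \<rho> assume \<rho>: "\<forall>p\<in>P \<inter> ?A. ceval \<rho> p = 0" and nz: "ceval \<rho> (Polynomial.coeff (uni v b) k) \<noteq> 0"
      have "map_poly (ceval \<rho>) (uni v b) \<noteq> 0"
      proof
        assume "map_poly (ceval \<rho>) (uni v b) = 0"
        then have "Polynomial.coeff (map_poly (ceval \<rho>) (uni v b)) k = 0" by simp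
        then show False using nz by (simp add: coeff_map_poly)
      qed
      then have "finite {z. poly (map_poly (ceval \<rho>) (uni v b)) z = 0}" by (rule poly_roots_finite)
      then obtain z where z: "poly (map_poly (ceval \<rho>) (uni v b)) z \<noteq> 0"
        using ex_new_if_finite[OF infinite_UNIV_char_0] by blast
      have "ceval (\<rho>(v := z)) p = 0" if "p \<in> P \<inter> polys (insert v V)" for p
      proof -
        have "coeffs_in P (uni v p)" using True uni_in[of p] that by simp
        then have "map_poly (ceval \<rho>) (uni v p) = 0"
          using coeff_map_ceval_in_P[OF \<rho> uni_in[of p]] that by blast
        then show ?thesis using ev[of p] that by simp
      qed
      then show "\<exists>z. (\<forall>p\<in>P \<inter> polys (insert v V). ceval (\<rho>(v := z)) p = 0) \<and> ceval (\<rho>(v := z)) b \<noteq> 0"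
        using z ev[OF b(1)] by (intro exI[of _ z]) auto
      qed
    qed
  next
    case False
    then obtain M where algebraic: "min_rel ?A ?t M" using ex_min_rel[OF A] by blast
    define a where "a = Polynomial.lead_coeff M"
    have M: "coeffs_in ?A M" "poly M ?t \<in> P" "a \<notin> P" "Polynomial.degree M > 0"
      using algebraic by (auto simp: min_rel_def a_def)
    have aA: "a \<in> ?A" using M by (auto simp: a_def coeffs_in_def)
    obtain e Q where e: "e \<in> ?A" "e \<notin> P" "coeffs_in ?A Q" "e - b * poly Q ?t \<in> P"
      using min_rel_multiple_in_subring[OF A algebraic uni_in[OF b(1)]] b(2) by (metis poly_uni)
    have sub: "polys V \<subseteq> polys (insert v V)" by (rule polys_mono) auto
    have Qin: "poly Q ?t \<in> polys (insert v V)"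
      using e sub by (intro poly_in_subring[OF subring_set_polys]) (auto simp: coeffs_in_def)
    show thesis
    proof (rule that)
      show "e * a \<in> ?A" using e aA by auto
      show "e * a \<notin> P" using e M by (simp add: mult_iff)
      show "\<forall>\<rho>. (\<forall>p\<in>P \<inter> ?A. ceval \<rho> p = 0) \<longrightarrow> ceval \<rho> (e * a) \<noteq> 0 \<longrightarrow>
        (\<exists>z. (\<forall>p\<in>P \<inter> polys (insert v V). ceval (\<rho>(v := z)) p = 0) \<and> ceval (\<rho>(v := z)) b \<noteq> 0)"
      proof (intro allI impI)
      fix \<rho> assume \<rho>: "\<forall>p\<in>P \<inter> ?A. ceval \<rho> p = 0" and nz: "ceval \<rho> (e * a) \<noteq> 0"
      have nz': "ceval \<rho> e \<noteq> 0" "ceval \<rho> a \<noteq> 0" using nz by auto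
      \<comment> \<open>As \<open>a\<close> does not vanish at \<rho>, the specialized relation
        keeps its positive degree and has a root.\<close>
      let ?M = "map_poly (ceval \<rho>) M"
      have "Polynomial.coeff ?M (Polynomial.degree M) \<noteq> 0"
        using nz' by (simp add: coeff_map_poly a_def)
      then have "Polynomial.degree ?M > 0"
        using M(4) le_degree[of ?M "Polynomial.degree M"] by linarith
      then obtain z where z: "poly ?M z = 0" using alg_closed_imp_poly_has_root by blast
      \<comment> \<open>Up to a power of \<open>a\<close>, which is nonzero at \<rho>, p is a
        multiple of M plus a polynomial whose coefficients lie in P and so vanish at \<rho>.\<close>
      have kill: "ceval (\<rho>(v := z)) p = 0" if p: "p \<in> P \<inter> polys (insert v V)" for p
      proof -
        obtain N S R where NSR: "Polynomial.smult (a ^ N) (uni v p) = M * S + R" "coeffs_in ?A S" "coeffs_in ?A R" "coeffs_in P R"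
          using min_rel_division[OF A algebraic uni_in[of p]] p unfolding a_def by (metis IntD1 IntD2 poly_uni)
        have "ceval \<rho> (a ^ N) * poly (map_poly (ceval \<rho>) (uni v p)) z =
            poly ?M z * poly (map_poly (ceval \<rho>) S) z + poly (map_poly (ceval \<rho>) R) z"
          using arg_cong[OF NSR(1), of "\<lambda>F. poly (map_poly (ceval \<rho>) F) z"]
          by (simp add: map_poly_ceval_smult map_poly_ceval_add map_poly_ceval_mult del: smult_power)
        also have "\<dots> = 0" using z coeff_map_ceval_in_P[OF \<rho> NSR(3,4)] by simp
        finally show ?thesis using nz' ev[of p] p by simp
      qed
      have "e - b * poly Q ?t \<in> polys (insert v V)" using e Qin b sub by blast
      then have "ceval (\<rho>(v := z)) (e - b * poly Q ?t) = 0" using e kill by blast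
      moreover have "ceval (\<rho>(v := z)) e = ceval \<rho> e"
        by (rule peval_cong_vars[OF e(1)]) (use v in auto)
      ultimately have "ceval (\<rho>(v := z)) b \<noteq> 0" using nz' by auto
      then show "\<exists>z. (\<forall>p\<in>P \<inter> polys (insert v V). ceval (\<rho>(v := z)) p = 0) \<and> ceval (\<rho>(v := z)) b \<noteq> 0"
        using kill by blast
      qed
    qed
  qed
qed

text \<open>Geometrically, the projection of the zero set of P, minus the zeros of b, contains an
  open part of the closure of the image. The variables in T are projected away one at a time, the
  \<open>g\<close> of one step serving as the \<open>b\<close> of the next.\<close>

theorem specialization_extends:
  assumes "finite T" "T \<inter> V = {}" "b \<in> polys (V \<union> T)" "b \<notin> P"
  obtains g where "g \<in> polys V" "g \<notin> P"
    "\<forall>\<rho>. (\<forall>p\<in>P \<inter> polys V. ceval \<rho> p = 0) \<longrightarrow> ceval \<rho> g \<noteq> 0 \<longrightarrow>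
      (\<exists>\<rho>'. (\<forall>v. v \<notin> T \<longrightarrow> \<rho>' v = \<rho> v) \<and> (\<forall>p\<in>P \<inter> polys (V \<union> T). ceval \<rho>' p = 0) \<and> ceval \<rho>' b \<noteq> 0)"
proof -
  have "\<exists>g. g \<in> polys V \<and> g \<notin> P \<and>
    (\<forall>\<rho>. (\<forall>p\<in>P \<inter> polys V. ceval \<rho> p = 0) \<longrightarrow> ceval \<rho> g \<noteq> 0 \<longrightarrow>
      (\<exists>\<rho>'. (\<forall>v. v \<notin> T \<longrightarrow> \<rho>' v = \<rho> v) \<and> (\<forall>p\<in>P \<inter> polys (V \<union> T). ceval \<rho>' p = 0) \<and> ceval \<rho>' b \<noteq> 0))"
    using assms
  proof (induction T arbitrary: b)
    case empty
    then show ?case by (intro exI[of _ b]) auto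
  next
    case (insert v T)
    have v: "v \<notin> V \<union> T" using insert.hyps insert.prems by auto
    have b: "b \<in> polys (insert v (V \<union> T))" using insert.prems by simp
    obtain b' where b': "b' \<in> polys (V \<union> T)" "b' \<notin> P"
      "\<forall>\<rho>. (\<forall>p\<in>P \<inter> polys (V \<union> T). ceval \<rho> p = 0) \<longrightarrow> ceval \<rho> b' \<noteq> 0 \<longrightarrow>
      (\<exists>z. (\<forall>p\<in>P \<inter> polys (insert v (V \<union> T)). ceval (\<rho>(v := z)) p = 0) \<and> ceval (\<rho>(v := z)) b \<noteq> 0)"
      by (rule specialization_extends_step[OF v b insert.prems(3)])
    obtain g where g: "g \<in> polys V" "g \<notin> P"
      "\<forall>\<rho>. (\<forall>p\<in>P \<inter> polys V. ceval \<rho> p = 0) \<longrightarrow> ceval \<rho> g \<noteq> 0 \<longrightarrow>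
      (\<exists>\<rho>'. (\<forall>v. v \<notin> T \<longrightarrow> \<rho>' v = \<rho> v) \<and> (\<forall>p\<in>P \<inter> polys (V \<union> T). ceval \<rho>' p = 0) \<and> ceval \<rho>' b' \<noteq> 0)"
      using insert.IH[OF _ b'(1,2)] insert.prems by auto
    have "\<exists>\<rho>'. (\<forall>w. w \<notin> insert v T \<longrightarrow> \<rho>' w = \<rho> w) \<and> (\<forall>p\<in>P \<inter> polys (V \<union> insert v T). ceval \<rho>' p = 0) \<and>
        ceval \<rho>' b \<noteq> 0"
      if \<rho>: "\<forall>p\<in>P \<inter> polys V. ceval \<rho> p = 0" "ceval \<rho> g \<noteq> 0" for \<rho>
    proof -
      obtain \<rho>' where \<rho>': "\<forall>v. v \<notin> T \<longrightarrow> \<rho>' v = \<rho> v" "\<forall>p\<in>P \<inter> polys (V \<union> T). ceval \<rho>' p = 0" "ceval \<rho>' b' \<noteq> 0"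
        using g(3) \<rho> by blast
      obtain z where "\<forall>p\<in>P \<inter> polys (insert v (V \<union> T)). ceval (\<rho>'(v := z)) p = 0" "ceval (\<rho>'(v := z)) b \<noteq> 0"
        using b'(3) \<rho>' by meson
      then show ?thesis using \<rho>'(1) by (intro exI[of _ "\<rho>'(v := z)"]) auto
    qed
    then show ?case using g(1,2) by blast
  qed
  then show thesis using that by blast
qed

end

section \<open>Extending derivations\<close>

lemma derivation_poly:
  assumes "derivation D"
  shows "D (poly Q t) = poly (map_poly D Q) t + poly (pderiv Q) t * D t"
proof (induction Q)
  case 0
  then show ?case by (simp add: derivation_0[OF assms])
next
  case (pCons a Q)
  then show ?case
    by (simp add: derivation_0[OF assms] derivation_add[OF assms] derivation_mult[OF assms]
        map_poly_pCons pderiv_pCons algebra_simps)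
qed

lemma derivation_combination:
  assumes "derivation D" "derivation E"
  shows "derivation (\<lambda>p. a * D p - b * E p)"
  using assms by (simp add: derivation_def algebra_simps)

lemma derivation_commutator:
  assumes "derivation D" "derivation E"
  shows "derivation (\<lambda>p. D (E p) - E (D p))"
  using assms unfolding derivation_def
  by (auto simp: derivation_0[OF assms(1)] derivation_0[OF assms(2)] algebra_simps)

context prime_poly_ideal
begin

lemma of_nat_mult_notin: "p \<notin> P \<Longrightarrow> k > 0 \<Longrightarrow> of_nat k * p \<notin> P"
proof
  assume p: "p \<notin> P" "k > 0" "of_nat k * p \<in> P"
  have "pconst (1 / of_nat k) * of_nat k = (1 :: 'n mpoly)"
    using p(2) by (simp add: pconst_def mult_single flip: single_of_nat)
  then have "p = (pconst (1 / of_nat k) * of_nat k) * p" by simp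
  also have "\<dots> = pconst (1 / of_nat k) * (of_nat k * p)" by (rule mult.assoc)
  also have "\<dots> \<in> P" using p(3) by (rule mult_left)
  finally show False using p by simp
qed

text \<open>If t is transcendental modulo P, \<open>D\<close> itself works. If t is algebraic with
  minimal relation m, the derivation m' D - D(m) d/dv with m' = dm/dv annihilates m and equals m' D
  on polynomials free of v. That m' is outside P follows from the minimality of the relation and
  characteristic 0. The set \<open>W\<close> keeps track of the variables that may appear, so that
  the results can be composed.\<close>

lemma derivation_extends_step:
  assumes D: "derivation D" and DP: "\<forall>p\<in>P \<inter> polys V. D p \<in> P" and DW: "\<forall>p\<in>polys W. D p \<in> polys W"
    and v: "v \<notin> V" and W: "insert v V \<subseteq> W"
  obtains s D' where "s \<notin> P" "derivation D'" "\<forall>p\<in>polys V. D' p = s * D p"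
    "\<forall>p\<in>P \<inter> polys (insert v V). D' p \<in> P" "\<forall>p\<in>polys W. D' p \<in> polys W"
proof -
  let ?A = "polys V" and ?t = "pvar v"
  note A = subring_set_polys[of V]
  have uni_in: "coeffs_in ?A (uni v p)" if "p \<in> polys (insert v V)" for p
    using polys_insertE[OF that v] .
  \<comment> \<open>Only the coefficients, which are free of v, have to be differentiated inside P;
    what \<open>E\<close> does to t does not matter, as it is multiplied by an element of P.\<close>
  have on_P: "E (poly R ?t) \<in> P" if E: "derivation E" "\<forall>p\<in>P \<inter> ?A. E p \<in> P"
    and R: "coeffs_in ?A R" "coeffs_in P R" for E R
  proof -
    have "coeffs_in P (map_poly E R)"
      using E R by (auto simp: coeffs_in_def coeff_map_poly derivation_0)
    moreover have "coeffs_in P (pderiv R)"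
      using R by (auto simp: coeffs_in_def coeff_pderiv intro: mult_left)
    ultimately show ?thesis
      unfolding derivation_poly[OF E(1)] by (intro add mult_right poly_coeffs_in)
  qed
  show thesis
  proof (cases "\<forall>Q. coeffs_in ?A Q \<longrightarrow> poly Q ?t \<in> P \<longrightarrow> coeffs_in P Q")
    case True
    have "D p \<in> P" if "p \<in> P \<inter> polys (insert v V)" for p
      using on_P[OF D DP, of "uni v p"] uni_in[of p] True that by simp
    then show thesis
      using that[of 1 D] one D DW by auto
  next
    case False
    then obtain M where min: "min_rel ?A ?t M" using ex_min_rel[OF A] by blast
    define a where "a = Polynomial.lead_coeff M"
    have M: "coeffs_in ?A M" "poly M ?t \<in> P" "a \<notin> P" "Polynomial.degree M > 0"
      using min by (auto simp: min_rel_def a_def)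
    define m where "m = poly M ?t"
    define m' where "m' = pdiff v m"
    have m': "m' = poly (pderiv M) ?t"
      unfolding m'_def m_def by (rule pdiff_poly_pderiv[OF M(1) v])
    have mW: "m \<in> polys W"
      unfolding m_def using M(1) W polys_mono[of V W]
      by (intro poly_in_subring[OF subring_set_polys]) (auto simp: coeffs_in_def)
    have "m' \<notin> P"
    proof
      assume "m' \<in> P"
      moreover have "coeffs_in ?A (pderiv M)"
        using M(1) by (auto simp: coeffs_in_def coeff_pderiv)
      moreover have "Polynomial.degree (pderiv M) < Polynomial.degree M"
        using M(4) by (simp add: degree_pderiv)
      ultimately have "coeffs_in P (pderiv M)"
        using min by (auto simp: min_rel_def m')
      then have "Polynomial.coeff (pderiv M) (Polynomial.degree M - 1) \<in> P" by (simp add: coeffs_in_def)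
      then have "of_nat (Polynomial.degree M) * a \<in> P"
        using M(4) by (simp add: coeff_pderiv a_def)
      then show False using of_nat_mult_notin[OF M(3,4)] by simp
    qed
    define D' where "D' = (\<lambda>p. m' * D p - D m * pdiff v p)"
    have D': "derivation D'"
      unfolding D'_def by (rule derivation_combination[OF D derivation_pdiff])
    have V: "D' p = m' * D p" if "p \<in> ?A" for p
      by (simp add: D'_def pdiff_eq_0[OF that v])
    have D'm: "D' m = 0" by (simp add: D'_def m'_def)
    have D'P: "\<forall>p\<in>P \<inter> ?A. D' p \<in> P" using V DP by (auto intro: mult_left)
    have "D' q \<in> P" if q: "q \<in> P \<inter> polys (insert v V)" for q
    proof -
      have "poly (uni v q) ?t \<in> P" using q by simp
      then obtain N S R where NSR: "Polynomial.smult (a ^ N) (uni v q) = M * S + R" "coeffs_in ?A S" "coeffs_in ?A R" "coeffs_in P R"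
        using min_rel_division[OF A min uni_in[of q]] q unfolding a_def by blast
      have "a ^ N * q = m * poly S ?t + poly R ?t"
        using arg_cong[OF NSR(1), of "\<lambda>F. poly F ?t"] by (simp add: m_def)
      then have "a ^ N * D' q = m * D' (poly S ?t) + D' (poly R ?t) - D' (a ^ N) * q"
        using derivation_mult[OF D', of "a ^ N" q] derivation_mult[OF D', of m "poly S ?t"]
          derivation_add[OF D', of "m * poly S ?t" "poly R ?t"] D'm by simp
      also have "\<dots> \<in> P"
        using q M(2) on_P[OF D' D'P NSR(3,4)] unfolding m_def by (intro diff add mult_right mult_left) auto
      finally show ?thesis using power_notin[OF M(3)] by (auto simp: mult_iff)
    qed
    moreover have "\<forall>p\<in>polys W. D' p \<in> polys W"
      using DW mW by (auto simp: D'_def m'_def intro!: polys_diff polys_mult pdiff_in_polys)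
    ultimately show thesis using that[of m' D'] \<open>m' \<notin> P\<close> D' V by blast
  qed
qed

lemma derivation_extends:
  assumes "finite T" "T \<inter> V = {}" "V \<union> T \<subseteq> W" "derivation D" "\<forall>p\<in>P \<inter> polys V. D p \<in> P"
    "\<forall>p\<in>polys W. D p \<in> polys W"
  shows "\<exists>s D'. s \<notin> P \<and> derivation D' \<and> (\<forall>p\<in>polys V. D' p = s * D p) \<and>
    (\<forall>p\<in>P \<inter> polys (V \<union> T). D' p \<in> P) \<and> (\<forall>p\<in>polys W. D' p \<in> polys W)"
  using assms
proof (induction T)
  case empty
  then show ?case using one by (intro exI[of _ 1] exI[of _ D]) auto
next
  case (insert v T)
  then obtain s D' where D': "s \<notin> P" "derivation D'" "\<forall>p\<in>polys V. D' p = s * D p"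
    "\<forall>p\<in>P \<inter> polys (V \<union> T). D' p \<in> P" "\<forall>p\<in>polys W. D' p \<in> polys W"
    by auto
  have v: "v \<notin> V \<union> T" "insert v (V \<union> T) \<subseteq> W" using insert.hyps insert.prems by auto
  obtain s' D'' where D'': "s' \<notin> P" "derivation D''" "\<forall>p\<in>polys (V \<union> T). D'' p = s' * D' p"
    "\<forall>p\<in>P \<inter> polys (insert v (V \<union> T)). D'' p \<in> P" "\<forall>p\<in>polys W. D'' p \<in> polys W"
    using derivation_extends_step[OF D'(2,4,5) v] by blast
  have "D'' p = (s' * s) * D p" if "p \<in> polys V" for p
    using D''(3) D'(3) that polys_mono[of V "V \<union> T"] by (auto simp: mult.assoc)
  moreover have "s' * s \<notin> P" using D'(1) D''(1) by (simp add: mult_iff)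
  ultimately show ?case using D'' by (intro exI[of _ "s' * s"] exI[of _ D'']) auto
qed

end

section \<open>Existence of prime ideals\<close>

lemma ring_ideal_Union_chain:
  assumes "C \<noteq> {}" "\<And>J. J \<in> C \<Longrightarrow> ring_ideal J" "\<And>J K. J \<in> C \<Longrightarrow> K \<in> C \<Longrightarrow> J \<subseteq> K \<or> K \<subseteq> J"
  shows "ring_ideal (\<Union>C)"
proof
  show "0 \<in> \<Union>C" using assms(1) ring_ideal.zero[OF assms(2)] by blast
  show "r * p \<in> \<Union>C" if "p \<in> \<Union>C" for p r
  proof -
    from that obtain J where J: "J \<in> C" "p \<in> J" by blast
    then show ?thesis using ring_ideal.mult_left[OF assms(2)[OF J(1)] J(2)] by blast
  qed
  show "p + q \<in> \<Union>C" if "p \<in> \<Union>C" "q \<in> \<Union>C" for p q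
  proof -
    from that obtain J K where "J \<in> C" "p \<in> J" "K \<in> C" "q \<in> K" by blast
    then obtain L where L: "L \<in> C" "p \<in> L" "q \<in> L" using assms(3) by blast
    then show ?thesis using ring_ideal.add[OF assms(2)[OF L(1)] L(2,3)] by blast
  qed
qed

text \<open>An ideal maximal among those containing I and missing S is prime: adding an element
  outside it yields an ideal that meets S, and for p, q outside it with product inside, multiplying
  the two elements met would give an element of S in the ideal.\<close>

lemma ex_prime_ideal_avoiding:
  fixes I S :: "'a::idom set"
  assumes I: "ring_ideal I" and S: "1 \<in> S" "\<And>s t. s \<in> S \<Longrightarrow> t \<in> S \<Longrightarrow> s * t \<in> S" and IS: "I \<inter> S = {}"
  obtains P where "prime_ring_ideal P" "I \<subseteq> P" "P \<inter> S = {}"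
proof -
  let ?Z = "{J. ring_ideal J \<and> I \<subseteq> J \<and> J \<inter> S = {}}"
  have "\<exists>P\<in>?Z. \<forall>J\<in>?Z. P \<subseteq> J \<longrightarrow> J = P"
  proof (rule subset_Zorn_nonempty)
    show "?Z \<noteq> {}" using I IS by auto
    show "\<Union>C \<in> ?Z" if C: "C \<noteq> {}" "subset.chain ?Z C" for C
    proof -
      have "ring_ideal (\<Union>C)"
        using C by (intro ring_ideal_Union_chain) (auto simp: subset_chain_def)
      then show ?thesis using C by (fastforce simp: subset_chain_def)
    qed
  qed
  then obtain P where "P \<in> ?Z" and max: "\<forall>J\<in>?Z. P \<subseteq> J \<longrightarrow> J = P" by (elim bexE)
  then have P: "ring_ideal P" "I \<subseteq> P" "P \<inter> S = {}" by simp_all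
  interpret ring_ideal P by (rule P)
  have meets: "\<exists>r\<in>P. \<exists>x. r + x * p \<in> S" if p: "p \<notin> P" for p
  proof (rule ccontr)
    assume none: "\<not> ?thesis"
    define J where "J = {r + x * p | r x. r \<in> P}"
    have "ring_ideal J"
    proof
      show "0 \<in> J" unfolding J_def using zero by (auto intro!: exI[of _ 0])
      show "a + b \<in> J" if ab: "a \<in> J" "b \<in> J" for a b
      proof -
        obtain r x s y where "a = r + x * p" "b = s + y * p" "r \<in> P" "s \<in> P"
          using ab by (auto simp: J_def)
        then have "a + b = (r + s) + (x + y) * p" "r + s \<in> P"
          by (auto simp: algebra_simps intro: add)
        then show ?thesis unfolding J_def by blast
      qed
      show "c * a \<in> J" if a: "a \<in> J" for a c
      proof -
        obtain r x where "a = r + x * p" "r \<in> P" using a by (auto simp: J_def)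
        then have "c * a = c * r + (c * x) * p" "c * r \<in> P"
          by (auto simp: algebra_simps intro: mult_left)
        then show ?thesis unfolding J_def by blast
      qed
    qed
    moreover have "P \<subseteq> J"
    proof
      fix r assume "r \<in> P"
      moreover have "r = r + 0 * p" by simp
      ultimately show "r \<in> J" unfolding J_def by blast
    qed
    moreover have "J \<inter> S = {}" using none by (auto simp: J_def)
    ultimately have "J \<in> ?Z" "P \<subseteq> J" using P(2) by auto
    then have "J = P" using max by blast
    have "p = 0 + 1 * p" by simp
    then have "p \<in> J" unfolding J_def using zero by blast
    then show False using p \<open>J = P\<close> by simp
  qed
  have "p \<in> P \<or> q \<in> P" if pq: "p * q \<in> P" for p q
  proof (rule ccontr)
    assume "\<not> ?thesis"
    then obtain r x s y where rs: "r \<in> P" "s \<in> P" "r + x * p \<in> S" "s + y * q \<in> S"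
      using meets by (metis (no_types, lifting))
    have "(r + x * p) * (s + y * q) = r * (s + y * q) + (x * p * s + (x * y) * (p * q))"
      by (simp add: algebra_simps)
    also have "\<dots> \<in> P" 
      by (rule add[OF mult_right[OF rs(1)] add[OF mult_left[OF rs(2)] mult_left[OF pq]]])
    finally show False using S(2)[OF rs(3,4)] P(3) by blast
  qed
  moreover have "1 \<notin> P" using S(1) P(3) by blast
  ultimately have "prime_ring_ideal P" by unfold_locales auto
  then show thesis using that P by blast
qed

section \<open>Wronskians\<close>

text \<open>The numerator of the quotient rule: \<open>q ^ 2\<close> times the derivative of p/q
  along v. It makes statements about derivatives of rational functions polynomial.\<close>

definition wronskian :: "'n var \<Rightarrow> 'n mpoly \<Rightarrow> 'n mpoly \<Rightarrow> 'n mpoly"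
  where "wronskian v p q = q * pdiff v p - p * pdiff v q"

text \<open>The fraction p/q does not change, while the square of its denominator gains the square
  of e. This permits passing to a common denominator.\<close>

lemma wronskian_scale: "wronskian v (p * e) (q * e) = e ^ 2 * wronskian v p q"
  by (simp add: wronskian_def pdiff_mult power2_eq_square algebra_simps)

lemma wronskian_in_polys: "p \<in> polys V \<Longrightarrow> q \<in> polys V \<Longrightarrow> wronskian v p q \<in> polys V"
  unfolding wronskian_def by (intro polys_diff polys_mult pdiff_in_polys)

text \<open>The equation says that H/F has derivative 0. The leading coefficients of its sides are
  the degrees of H and F times the same product, so the degrees agree in characteristic 0. Constants
  are treated apart, their derivative having no leading term.\<close>

lemma degree_eq_if_pderiv_proportional:
  fixes F H :: "'a::{idom, ring_char_0} poly"
  assumes eq: "F * pderiv H = pderiv F * H" and nz: "F \<noteq> 0" "H \<noteq> 0"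
  shows "Polynomial.degree F = Polynomial.degree H"
proof (cases "Polynomial.degree F = 0 \<or> Polynomial.degree H = 0")
  case True
  then have "pderiv F = 0 \<or> pderiv H = 0" by (simp add: pderiv_eq_0_iff)
  then have "pderiv F = 0 \<and> pderiv H = 0" using eq nz by auto
  then show ?thesis by (simp add: pderiv_eq_0_iff)
next
  case False
  have lc: "Polynomial.lead_coeff (pderiv G) = of_nat (Polynomial.degree G) * Polynomial.lead_coeff G"
    if "Polynomial.degree G \<noteq> 0" for G :: "'a poly"
    using that by (simp add: degree_pderiv coeff_pderiv)
  have "Polynomial.lead_coeff F * (of_nat (Polynomial.degree H) * Polynomial.lead_coeff H) =
      of_nat (Polynomial.degree F) * Polynomial.lead_coeff F * Polynomial.lead_coeff H"
    using arg_cong[OF eq, of Polynomial.lead_coeff] False by (simp add: Polynomial.lead_coeff_mult lc del: of_nat_Suc)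
  then have "(of_nat (Polynomial.degree H) :: 'a) = of_nat (Polynomial.degree F)"
    using nz by (simp add: mult_ac)
  then show ?thesis by simp
qed

text \<open>If the claim failed, the difference \<open>H\<close> of its sides would satisfy the same
  equation with F and therefore have the degree of F, but in that degree its coefficient
  cancels.\<close>

lemma proportional_if_pderiv_proportional:
  fixes F G :: "'a::{idom, ring_char_0} poly"
  assumes eq: "G * pderiv F = F * pderiv G" and nz: "F \<noteq> 0" "G \<noteq> 0"
  shows "Polynomial.smult (Polynomial.lead_coeff F) G = Polynomial.smult (Polynomial.lead_coeff G) F"
proof (rule ccontr)
  assume neq: "\<not> ?thesis"
  define H where "H = Polynomial.smult (Polynomial.lead_coeff F) G - Polynomial.smult (Polynomial.lead_coeff G) F"
  have H0: "H \<noteq> 0" using neq by (simp add: H_def)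
  have FH: "F * pderiv H = pderiv F * H"
    using arg_cong[OF eq, of "Polynomial.smult (Polynomial.lead_coeff F)"]
    by (simp add: H_def pderiv_diff pderiv_smult algebra_simps)
  have degs: "Polynomial.degree F = Polynomial.degree H" "Polynomial.degree F = Polynomial.degree G"
    using degree_eq_if_pderiv_proportional[OF FH nz(1) H0]
      degree_eq_if_pderiv_proportional[of F G] eq nz by (auto simp: mult.commute)
  have "Polynomial.coeff H (Polynomial.degree F) = 0"
    unfolding H_def using degs(2) by (simp add: mult.commute)
  then show False using H0 degs(1) by simp
qed

text \<open>Variables are removed one at a time: as a/b = p/q has derivative 0 along v, it equals
  the ratio of the leading coefficients of a and b as polynomials in v, and these no longer contain
  v.\<close>

lemma wronskian_ratio:
  assumes "finite J" "p \<in> polys V" "q \<in> polys V" "p \<noteq> 0" "q \<noteq> 0" "\<forall>v\<in>J. wronskian v p q = 0"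
  shows "\<exists>a b. a \<in> polys (V - J) \<and> b \<in> polys (V - J) \<and> a \<noteq> 0 \<and> b \<noteq> 0 \<and> a * q = b * p"
  using assms
proof (induction J)
  case empty
  then show ?case by (intro exI[of _ p] exI[of _ q]) auto
next
  case (insert v J)
  then obtain a b where ab: "a \<in> polys (V - J)" "b \<in> polys (V - J)" "a \<noteq> 0" "b \<noteq> 0" "a * q = b * p"
    by auto
  have w: "q * pdiff v p = p * pdiff v q" using insert.prems by (simp add: wronskian_def)
  have d: "a * pdiff v q + pdiff v a * q = b * pdiff v p + pdiff v b * p"
    using arg_cong[OF ab(5), of "pdiff v"] by (simp add: pdiff_mult)
  \<comment> \<open>That a/b has derivative 0 along v is deduced by differentiating
    \<open>a * q = b * p\<close>.\<close>
  have "(p * q) * (b * pdiff v a - a * pdiff v b) = b * p * (pdiff v a * q) - (a * q) * (pdiff v b * p)"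
    by (simp add: algebra_simps)
  also have "\<dots> = b * (b * p) * pdiff v p - b * (a * p * pdiff v q)"
    using d ab(5) by (simp add: algebra_simps) (metis (no_types, lifting) add_diff_cancel_left' d diff_diff_eq2 distrib_left mult.left_commute)
  also have "\<dots> = a * b * (q * pdiff v p - p * pdiff v q)"
    unfolding ab(5)[symmetric] by (simp add: algebra_simps)
  also have "\<dots> = 0" by (simp add: w)
  finally have wab: "b * pdiff v a = a * pdiff v b" using insert.prems by simp
  let ?V = "V - insert v J"
  have V: "V - J - {v} = ?V" by auto
  have ca: "coeffs_in (polys ?V) (uni v a)" and cb: "coeffs_in (polys ?V) (uni v b)"
    using coeffs_in_uni[OF ab(1), of v] coeffs_in_uni[OF ab(2), of v] V by auto
  have pd: "uni v (pdiff v c) = pderiv (uni v c)" if c: "coeffs_in (polys ?V) (uni v c)" for c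
  proof -
    have "coeffs_in (polys ?V) (pderiv (uni v c))"
      using c by (auto simp: coeffs_in_def coeff_pderiv)
    then have "uni v (poly (pderiv (uni v c)) (pvar v)) = pderiv (uni v c)"
      by (rule uni_poly) auto
    moreover have "pdiff v (poly (uni v c) (pvar v)) = poly (pderiv (uni v c)) (pvar v)"
      by (rule pdiff_poly_pderiv[OF c]) auto
    ultimately show ?thesis by simp
  qed
  let ?a = "Polynomial.lead_coeff (uni v a)" and ?b = "Polynomial.lead_coeff (uni v b)"
  have "uni v b * pderiv (uni v a) = uni v a * pderiv (uni v b)"
    using arg_cong[OF wab, of "uni v"] by (simp add: uni_mult pd[OF ca] pd[OF cb])
  then have "Polynomial.smult ?a (uni v b) = Polynomial.smult ?b (uni v a)"
    by (rule proportional_if_pderiv_proportional) (use ab in auto)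
  from arg_cong[OF this, of "\<lambda>F. poly F (pvar v)"] have "?a * b = ?b * a" by simp
  then have "a * (?a * q) = a * (?b * p)"
    using ab(5) by (metis (no_types, opaque_lifting) mult.assoc mult.commute)
  then have "?a * q = ?b * p" using ab(3) by simp
  moreover have "?a \<in> polys ?V" "?b \<in> polys ?V" using ca cb by (auto simp: coeffs_in_def)
  ultimately show ?case using ab(3,4) by (intro exI[of _ ?a] exI[of _ ?b]) auto
qed

section \<open>Relations satisfied by critical points\<close>

text \<open>Equivalently, the values of the coordinates in V at the points of G are Zariski dense. G
  itself may be neither closed nor irreducible.\<close>

definition independent_on :: "('z \<Rightarrow> 'n var \<Rightarrow> complex) \<Rightarrow> 'n var set \<Rightarrow> 'z set \<Rightarrow> bool"
  where "independent_on a V G \<longleftrightarrow> (\<forall>p\<in>polys V. (\<forall>z\<in>G. ceval (a z) p = 0) \<longrightarrow> p = 0)"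

text \<open>Otherwise the product of nonzero relations, one for each piece, would be a nonzero
  relation on the union. This takes the place of choosing an irreducible component.\<close>

lemma independent_on_UN:
  assumes "independent_on a V (\<Union>i\<in>I. G i)" "finite I"
  obtains i where "i \<in> I" "independent_on a V (G i)"
proof (rule ccontr)
  assume "\<not> thesis"
  then have "\<forall>i\<in>I. \<exists>p. p \<in> polys V \<and> (\<forall>z\<in>G i. ceval (a z) p = 0) \<and> p \<noteq> 0"
    using that by (fastforce simp: independent_on_def)
  then obtain p where p: "\<And>i. i \<in> I \<Longrightarrow> p i \<in> polys V \<and> (\<forall>z\<in>G i. ceval (a z) (p i) = 0) \<and> p i \<noteq> 0"
    by metis
  have "prod p I \<in> polys V" using p by (intro polys_prod) auto
  moreover have "ceval (a z) (prod p I) = 0" if "z \<in> (\<Union>i\<in>I. G i)" for z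
    using that p assms(2) by auto
  ultimately have "prod p I = 0" using assms(1) unfolding independent_on_def by blast
  then show False using p assms(2) by auto
qed

text \<open>Gaussian elimination on \<open>\<Theta>\<close> and the matrix with rows \<open>Ms\<close>, where \<open>b\<close> is the product of the pivots and
  \<open>G'\<close> a part of \<open>G\<close> where they do not vanish. That \<open>b \<Theta>\<close> is a combination of the rows on \<open>G'\<close> is stated modulo
  an ideal \<open>J\<close>, which avoids naming the coefficients.\<close>

lemma linear_elimination:
  fixes \<Theta> :: "'k::finite \<Rightarrow> 'n mpoly"
  assumes "independent_on a V G"
    and "\<forall>z\<in>G. \<forall>w. (\<forall>r\<in>set Ms. (\<Sum>j\<in>UNIV. ceval (a z) (r j) * w j) = 0) \<longrightarrow>
      (\<Sum>j\<in>UNIV. ceval (a z) (\<Theta> j) * w j) = 0"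
  shows "\<exists>G' b. G' \<subseteq> G \<and> independent_on a V G' \<and> (\<forall>z\<in>G'. ceval (a z) b \<noteq> 0) \<and>
    (\<forall>J d. ring_ideal J \<longrightarrow> (\<forall>p. (\<forall>z\<in>G'. ceval (a z) p = 0) \<longrightarrow> p \<in> J) \<longrightarrow>
      (\<forall>r\<in>set Ms. (\<Sum>j\<in>UNIV. r j * d j) \<in> J) \<longrightarrow> b * (\<Sum>j\<in>UNIV. \<Theta> j * d j) \<in> J)"
  using assms
proof (induction "length Ms" arbitrary: Ms G \<Theta>)
  case 0
  have "ceval (a z) (\<Theta> i) = 0" if "z \<in> G" for z i
    using 0(3)[rule_format, OF that, of "\<lambda>j. if j = i then 1 else 0"] 0(1) by (simp add: if_distrib cong: if_cong)
  then show ?case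
    using 0(2) by (intro exI[of _ G] exI[of _ 1]) (auto intro!: ring_ideal.sum ring_ideal.mult_right)
next
  case (Suc n)
  then obtain \<rho> rs where Ms: "Ms = \<rho> # rs" and len: "length rs = n" by (cases Ms) auto
  \<comment> \<open>Pieces of G: either the first row vanishes, or its entry in some column l does
    not. The recursion goes on with a piece on which V is still independent.\<close>
  define H where "H = (\<lambda>i. case i of None \<Rightarrow> {z \<in> G. \<forall>j. ceval (a z) (\<rho> j) = 0}
      | Some j \<Rightarrow> {z \<in> G. ceval (a z) (\<rho> j) \<noteq> 0})"
  have "G = (\<Union>i\<in>UNIV. H i)"
    by (auto simp: H_def UNIV_option_conv)
  then obtain i where i: "independent_on a V (H i)"
    using Suc.prems(1) independent_on_UN[of a V H UNIV] by auto
  have HG: "H i \<subseteq> G" by (auto simp: H_def split: option.splits)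
  show ?case
  proof (cases i)
    case None
    have "(\<Sum>j\<in>UNIV. ceval (a z) (\<Theta> j) * w j) = 0"
      if "z \<in> H i" "\<forall>r\<in>set rs. (\<Sum>j\<in>UNIV. ceval (a z) (r j) * w j) = 0" for z w
      using that HG None by (intro Suc.prems(2)[rule_format]) (auto simp: Ms H_def)
    then have "\<forall>z\<in>H i. \<forall>w. (\<forall>r\<in>set rs. (\<Sum>j\<in>UNIV. ceval (a z) (r j) * w j) = 0) \<longrightarrow>
      (\<Sum>j\<in>UNIV. ceval (a z) (\<Theta> j) * w j) = 0" by blast
    from Suc.hyps(1)[OF len[symmetric] i this] obtain G' b where
      "G' \<subseteq> H i" "independent_on a V G'" "\<forall>z\<in>G'. ceval (a z) b \<noteq> 0"
      "\<forall>J d. ring_ideal J \<longrightarrow> (\<forall>p. (\<forall>z\<in>G'. ceval (a z) p = 0) \<longrightarrow> p \<in> J) \<longrightarrow>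
      (\<forall>r\<in>set rs. (\<Sum>j\<in>UNIV. r j * d j) \<in> J) \<longrightarrow> b * (\<Sum>j\<in>UNIV. \<Theta> j * d j) \<in> J"
      by blast
    then show ?thesis using HG by (intro exI[of _ G'] exI[of _ b]) (auto simp: Ms)
  next
    case (Some l)
    \<comment> \<open>Eliminates column l, multiplying by the pivot instead of dividing by
      it.\<close>
    define el where "el = (\<lambda>r j. \<rho> l * r j - r l * \<rho> j)"
    have nz: "ceval (a z) (\<rho> l) \<noteq> 0" if "z \<in> H i" for z
      using that Some by (simp add: H_def)
    have ev_el: "(\<Sum>j\<in>UNIV. ceval (a z) (el r j) * w j) =
        ceval (a z) (\<rho> l) * (\<Sum>j\<in>UNIV. ceval (a z) (r j) * w j) -
        ceval (a z) (r l) * (\<Sum>j\<in>UNIV. ceval (a z) (\<rho> j) * w j)" for z w r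
      by (simp add: el_def sum_subtractf sum_distrib_left algebra_simps)
    have sum_el: "(\<Sum>j\<in>UNIV. el r j * d j) = \<rho> l * (\<Sum>j\<in>UNIV. r j * d j) - r l * (\<Sum>j\<in>UNIV. \<rho> j * d j)" for r d
      by (simp add: el_def sum_subtractf sum_distrib_left algebra_simps)
    have "(\<Sum>j\<in>UNIV. ceval (a z) (el \<Theta> j) * w j) = 0"
      if z: "z \<in> H i" and w: "\<forall>r\<in>set (map el rs). (\<Sum>j\<in>UNIV. ceval (a z) (r j) * w j) = 0" for z w
    proof -
      define s where "s = (\<Sum>j\<in>UNIV. ceval (a z) (\<rho> j) * w j)"
      \<comment> \<open>The vector w scaled by the pivot and corrected in position l so that the row
        \<rho> annihilates it. The original rows take on w' the values of the eliminated rows on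
        w.\<close>
      define w' where "w' = (\<lambda>j. ceval (a z) (\<rho> l) * w j - (if j = l then s else 0))"
      have w': "(\<Sum>j\<in>UNIV. ceval (a z) (r j) * w' j) = (\<Sum>j\<in>UNIV. ceval (a z) (el r j) * w j)" for r
      proof -
        have "(\<Sum>j\<in>UNIV. ceval (a z) (r j) * w' j) =
            (\<Sum>j\<in>UNIV. ceval (a z) (\<rho> l) * (ceval (a z) (r j) * w j)) -
            (\<Sum>j\<in>UNIV. if j = l then ceval (a z) (r j) * s else 0)"
          unfolding w'_def sum_subtractf[symmetric]
          by (intro sum.cong refl) (auto simp: algebra_simps)
        then show ?thesis unfolding ev_el by (simp add: s_def sum_distrib_left)
      qed
      have "(\<Sum>j\<in>UNIV. ceval (a z) (\<Theta> j) * w' j) = 0"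
      proof (rule Suc.prems(2)[rule_format])
        show "z \<in> G" using z HG by auto
        show "(\<Sum>j\<in>UNIV. ceval (a z) (r j) * w' j) = 0" if "r \<in> set Ms" for r
          unfolding w' using w that by (auto simp: Ms ev_el[of z \<rho>])
      qed
      then show ?thesis by (simp add: w')
    qed
    then have elG: "\<forall>z\<in>H i. \<forall>w. (\<forall>r\<in>set (map el rs). (\<Sum>j\<in>UNIV. ceval (a z) (r j) * w j) = 0) \<longrightarrow>
      (\<Sum>j\<in>UNIV. ceval (a z) (el \<Theta> j) * w j) = 0" by blast
    have "n = length (map el rs)" using len by simp
    then obtain G' b where G':
      "G' \<subseteq> H i" "independent_on a V G'" "\<forall>z\<in>G'. ceval (a z) b \<noteq> 0"
      "\<forall>J d. ring_ideal J \<longrightarrow> (\<forall>p. (\<forall>z\<in>G'. ceval (a z) p = 0) \<longrightarrow> p \<in> J) \<longrightarrow>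
      (\<forall>r\<in>set (map el rs). (\<Sum>j\<in>UNIV. r j * d j) \<in> J) \<longrightarrow> b * (\<Sum>j\<in>UNIV. el \<Theta> j * d j) \<in> J"
      using Suc.hyps(1)[OF _ i elG] by blast
    have "b * \<rho> l * (\<Sum>j\<in>UNIV. \<Theta> j * d j) \<in> J"
      if J: "ring_ideal J" "\<forall>p. (\<forall>z\<in>G'. ceval (a z) p = 0) \<longrightarrow> p \<in> J"
        "\<forall>r\<in>set Ms. (\<Sum>j\<in>UNIV. r j * d j) \<in> J" for J d
    proof -
      interpret ring_ideal J by (rule J)
      have \<rho>J: "(\<Sum>j\<in>UNIV. \<rho> j * d j) \<in> J" using J(3) by (simp add: Ms)
      have "(\<Sum>j\<in>UNIV. el r j * d j) \<in> J" if "r \<in> set rs" for r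
        using J(3) that \<rho>J unfolding sum_el Ms by (intro diff mult_left) auto
      then have "b * (\<Sum>j\<in>UNIV. el \<Theta> j * d j) \<in> J" using G'(4) J(1,2) by auto
      then have "b * (\<Sum>j\<in>UNIV. el \<Theta> j * d j) + b * (\<Theta> l * (\<Sum>j\<in>UNIV. \<rho> j * d j)) \<in> J"
        using \<rho>J by (blast intro: add mult_left)
      also have "b * (\<Sum>j\<in>UNIV. el \<Theta> j * d j) + b * (\<Theta> l * (\<Sum>j\<in>UNIV. \<rho> j * d j)) =
          b * \<rho> l * (\<Sum>j\<in>UNIV. \<Theta> j * d j)"
        unfolding sum_el by (simp add: right_diff_distrib mult.assoc)
      finally show ?thesis .
    qed
    then show ?thesis
      using G'(1-3) HG nz by (intro exI[of _ G'] exI[of _ "b * \<rho> l"]) auto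
  qed
qed

text \<open>For A_k = N_k / D_k the assumption \<open>closed\<close> reads dA_i/dx_j = dA_j/dx_i.
  The right-hand side is free of u_i, so differentiating along u_i and exchanging the derivatives
  shows that dA_i/du_i does not depend on x_j. The claim is this with denominators cleared.\<close>

lemma wronskian_closed:
  fixes N D :: "'n \<Rightarrow> 'n mpoly"
  assumes ND: "\<And>i. N i \<in> polys (insert (Uv i) xvars)" "\<And>i. D i \<in> polys (insert (Uv i) xvars)"
    and nz: "D j \<noteq> 0" and ij: "i \<noteq> j"
    and closed: "D j ^ 2 * wronskian (Xv j) (N i) (D i) = D i ^ 2 * wronskian (Xv i) (N j) (D j)"
  shows "wronskian (Xv j) (wronskian (Uv i) (N i) (D i)) (D i ^ 2) = 0"
proof -
  let ?W = "wronskian (Xv j) (N i) (D i)" and ?W' = "wronskian (Xv i) (N j) (D j)"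
    and ?u = "pdiff (Uv i)" and ?x = "pdiff (Xv j)" and ?V = "wronskian (Uv i) (N i) (D i)"
  have u: "?u (D j) = 0" "?u ?W' = 0"
    using pdiff_eq_0[OF ND(2)[of j], of "Uv i"] pdiff_eq_0[OF wronskian_in_polys[OF ND(1)[of j] ND(2)[of j]], of "Uv i"] ij
    by auto
  have sq: "pdiff v (p ^ 2) = 2 * p * pdiff v p" for v and p :: "'n mpoly"
    by (simp add: power2_eq_square pdiff_mult algebra_simps)
  have "D j ^ 2 * ?u ?W = 2 * D i * ?u (D i) * ?W'"
    using arg_cong[OF closed, of ?u] by (simp add: pdiff_mult sq u)
  then have "D i * (D j ^ 2 * ?u ?W) = 2 * ?u (D i) * (D i ^ 2 * ?W')"
    by (simp add: power2_eq_square algebra_simps)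
  also have "\<dots> = 2 * ?u (D i) * (D j ^ 2 * ?W)" by (simp only: closed)
  finally have "D j ^ 2 * (D i * ?u ?W) = D j ^ 2 * (2 * ?u (D i) * ?W)"
    by (simp add: mult_ac)
  then have "D i * ?u ?W = 2 * ?u (D i) * ?W" using nz by simp
  \<comment> \<open>Both sides are the cube of \<open>D i\<close> times the mixed derivative of
    \<open>N i / D i\<close> along x_j and u_i, computed in the two orders.\<close>
  moreover have "D i * ?u ?W - 2 * ?u (D i) * ?W = D i * ?x ?V - 2 * ?V * ?x (D i)"
    by (simp add: wronskian_def pdiff_diff pdiff_mult pdiff_commute[of "Xv j" "Uv i"] algebra_simps)
  ultimately have "D i * ?x ?V = 2 * ?V * ?x (D i)" by simp
  then have "D i ^ 2 * ?x ?V = D i * (2 * ?V * ?x (D i))" by (simp add: power2_eq_square mult.assoc)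
  also have "\<dots> = ?V * ?x (D i ^ 2)" by (simp add: sq mult_ac)
  finally show ?thesis by (simp add: wronskian_def[of "Xv j" ?V])
qed

abbreviation at_pair :: "(complex^'n) \<times> (complex^'n) \<Rightarrow> 'n var \<Rightarrow> complex"
  where "at_pair z \<equiv> at_xu (fst z) (snd z)"

definition xuvars :: "'n var set"
  where "xuvars = range Xv \<union> range Uv"

lemma sum_xuvars: "(\<Sum>v\<in>xuvars. h v) = (\<Sum>k\<in>UNIV. h (Xv k)) + (\<Sum>k\<in>UNIV. h (Uv k))"
  for h :: "'n::finite var \<Rightarrow> 'a::comm_monoid_add"
proof -
  have "(\<Sum>v\<in>range Xv. h v) = (\<Sum>k\<in>UNIV. h (Xv k))" "(\<Sum>v\<in>range Uv. h v) = (\<Sum>k\<in>UNIV. h (Uv k))"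
    by (simp_all add: sum.reindex inj_on_def)
  then show ?thesis
    unfolding xuvars_def by (subst sum.union_disjoint) auto
qed

text \<open>An abstract form of the critical locus: \<open>crit\<close> says that on G the gradient
  with components N/D annihilates the kernel of the Jacobian of \<open>gs\<close>, and
  \<open>closed\<close> that its x-derivatives are symmetric. Nothing is assumed about the dimension
  or the irreducibility of G.\<close>

lemma critical_relation:
  fixes N D :: "'n::finite \<Rightarrow> 'n mpoly" and G :: "((complex^'n) \<times> (complex^'n)) set"
  assumes ND: "\<And>i. N i \<in> polys (insert (Uv i) xvars)" "\<And>i. D i \<in> polys (insert (Uv i) xvars)"
    and Dnz: "\<And>i. D i \<noteq> 0" and wnz: "wronskian (Uv i) (N i) (D i) \<noteq> 0"
    and closed: "\<And>i j. D j ^ 2 * wronskian (Xv j) (N i) (D i) = D i ^ 2 * wronskian (Xv i) (N j) (D j)"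
    and gs: "set gs \<subseteq> polys xvars" "\<And>g z. g \<in> set gs \<Longrightarrow> z \<in> G \<Longrightarrow> ceval (at_pair z) g = 0"
    and DG: "\<And>j z. z \<in> G \<Longrightarrow> ceval (at_pair z) (D j) \<noteq> 0"
    and crit: "\<And>z w. z \<in> G \<Longrightarrow> \<forall>g\<in>set gs. (\<Sum>j\<in>UNIV. ceval (at_pair z) (pdiff (Xv j) g) * w j) = 0 \<Longrightarrow>
      (\<Sum>j\<in>UNIV. ceval (at_pair z) (N j) / ceval (at_pair z) (D j) * w j) = 0"
  shows "\<exists>R\<in>polys (insert (Xv i) (range Uv)). R \<noteq> 0 \<and> (\<forall>z\<in>G. ceval (at_pair z) R = 0)"
proof (rule ccontr)
  let ?V = "insert (Xv i) (range Uv) :: 'n var set"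
  assume "\<not> ?thesis"
  then have indep: "independent_on at_pair ?V G" by (auto simp: independent_on_def)
  \<comment> \<open>The common denominator. The \<Theta> j below are the gradient components
    multiplied by \<open>DD\<close>.\<close>
  define DD where "DD = (\<Prod>l\<in>UNIV. D l)"
  define E where "E = (\<lambda>j. \<Prod>l\<in>-{j}. D l)"
  define \<Theta> where "\<Theta> = (\<lambda>j. N j * E j)"
  have DD: "DD = D j * E j" for j
    unfolding DD_def E_def by (subst prod.remove[of UNIV j]) (auto simp: Compl_eq_Diff_UNIV)
  have DDG: "ceval (at_pair z) DD \<noteq> 0" if "z \<in> G" for z
    using DG[OF that] by (simp add: DD_def)
  have crit': "(\<Sum>j\<in>UNIV. ceval (at_pair z) (\<Theta> j) * w j) = 0"
    if z: "z \<in> G" and w: "\<forall>r\<in>set (map (\<lambda>g j. pdiff (Xv j) g) gs). (\<Sum>j\<in>UNIV. ceval (at_pair z) (r j) * w j) = 0" for z w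
  proof -
    have "ceval (at_pair z) (\<Theta> j) = ceval (at_pair z) DD * (ceval (at_pair z) (N j) / ceval (at_pair z) (D j))" for j
      using DG[OF z, of j] by (simp add: \<Theta>_def DD[of j])
    then have "(\<Sum>j\<in>UNIV. ceval (at_pair z) (\<Theta> j) * w j) =
        ceval (at_pair z) DD * (\<Sum>j\<in>UNIV. ceval (at_pair z) (N j) / ceval (at_pair z) (D j) * w j)"
      by (simp add: sum_distrib_left mult.assoc)
    then show ?thesis using crit[OF z, of w] w by simp
  qed
  then have crit'': "\<forall>z\<in>G. \<forall>w. (\<forall>r\<in>set (map (\<lambda>g j. pdiff (Xv j) g) gs).
      (\<Sum>j\<in>UNIV. ceval (at_pair z) (r j) * w j) = 0) \<longrightarrow> (\<Sum>j\<in>UNIV. ceval (at_pair z) (\<Theta> j) * w j) = 0"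
    by blast
  obtain G' b where G': "G' \<subseteq> G" "independent_on at_pair ?V G'" "\<forall>z\<in>G'. ceval (at_pair z) b \<noteq> 0"
    "\<forall>J d. ring_ideal J \<longrightarrow> (\<forall>p. (\<forall>z\<in>G'. ceval (at_pair z) p = 0) \<longrightarrow> p \<in> J) \<longrightarrow>
      (\<forall>r\<in>set (map (\<lambda>g j. pdiff (Xv j) g) gs). (\<Sum>j\<in>UNIV. r j * d j) \<in> J) \<longrightarrow> b * (\<Sum>j\<in>UNIV. \<Theta> j * d j) \<in> J"
    using linear_elimination[OF indep crit'']
    by (elim exE conjE) (rule that)
  define I where "I = {p :: 'n mpoly. \<forall>z\<in>G'. ceval (at_pair z) p = 0}"
  \<comment> \<open>An ideal that avoids this multiplicative set contains no nonzero polynomial in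
    x_i and u, and neither \<open>b\<close> nor \<open>DD\<close>.\<close>
  define S where "S = {p * (b * DD) ^ k | p k. p \<in> polys ?V \<and> p \<noteq> 0}"
  have I: "ring_ideal I" by unfold_locales (auto simp: I_def)
  have S1: "1 * (b * DD) ^ k \<in> S" for k unfolding S_def by (intro CollectI exI[of _ 1] exI[of _ k]) simp
  have Spoly: "p \<in> S" if "p \<in> polys ?V" "p \<noteq> 0" for p
    unfolding S_def using that by (intro CollectI exI[of _ p] exI[of _ 0]) simp
  have Smult: "s * t \<in> S" if st: "s \<in> S" "t \<in> S" for s t
  proof -
    obtain p q k l where "s = p * (b * DD) ^ k" "t = q * (b * DD) ^ l" "p \<in> polys ?V" "q \<in> polys ?V" "p \<noteq> 0" "q \<noteq> 0"
      using st by (auto simp: S_def)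
    then show ?thesis
      unfolding S_def by (intro CollectI exI[of _ "p * q"] exI[of _ "k + l"]) (auto simp: power_add mult_ac)
  qed
  have IS: "I \<inter> S = {}"
  proof (rule ccontr)
    assume "I \<inter> S \<noteq> {}"
    then obtain p k where p: "p \<in> polys ?V" "p \<noteq> 0" "p * (b * DD) ^ k \<in> I" by (auto simp: S_def)
    have "ceval (at_pair z) p = 0" if "z \<in> G'" for z
      using p(3) that G'(1,3) DDG[of z] unfolding I_def by auto
    then show False using G'(2) p by (auto simp: independent_on_def)
  qed
  obtain P where P: "prime_ring_ideal P" "I \<subseteq> P" "P \<inter> S = {}"
    using ex_prime_ideal_avoiding[OF I _ Smult IS] S1[of 0] by auto
  interpret prime_poly_ideal P by (rule prime_poly_ideal.intro) (rule P)
  have PV: "p = 0" if "p \<in> P" "p \<in> polys ?V" for p using P(3) Spoly that by blast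
  have "b * DD \<notin> P" using S1[of 1] P(3) by auto
  then have bD: "b \<notin> P" "DD \<notin> P" by (auto simp: mult_iff)
  then have DP: "D j \<notin> P" and EP: "E j \<notin> P" for j using DD[of j] by (auto simp: mult_iff)
  have fin: "finite (Xv ` (-{i}))" and disj: "Xv ` (-{i}) \<inter> ?V = {}"
    and VT: "?V \<union> Xv ` (-{i}) = xuvars"
    by (auto simp: xuvars_def)
  \<comment> \<open>P meets the polynomials in x_i and u only in 0, so d/dv trivially preserves that
    intersection and extends over the other variables x_j.\<close>
  have ext: "\<exists>s F. s \<notin> P \<and> derivation F \<and> (\<forall>p\<in>polys ?V. F p = s * pdiff v p) \<and>
      (\<forall>p\<in>P \<inter> polys xuvars. F p \<in> P) \<and> (\<forall>p\<in>polys xuvars. F p \<in> polys xuvars)" for v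
  proof -
    have "\<forall>p\<in>P \<inter> polys ?V. pdiff v p \<in> P" using PV zero by fastforce
    moreover have "\<forall>p\<in>polys xuvars. pdiff v p \<in> polys xuvars" by (simp add: pdiff_in_polys)
    ultimately show ?thesis
      using derivation_extends[OF fin disj equalityD1[OF VT] derivation_pdiff[of v]] unfolding VT by simp
  qed
  obtain s1 F1 where F1: "s1 \<notin> P" "derivation F1" "\<forall>p\<in>polys ?V. F1 p = s1 * pdiff (Xv i) p"
    "\<forall>p\<in>P \<inter> polys xuvars. F1 p \<in> P" "\<forall>p\<in>polys xuvars. F1 p \<in> polys xuvars"
    using ext[of "Xv i"] by blast
  obtain s2 F2 where F2: "s2 \<notin> P" "derivation F2" "\<forall>p\<in>polys ?V. F2 p = s2 * pdiff (Uv i) p"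
    "\<forall>p\<in>P \<inter> polys xuvars. F2 p \<in> P" "\<forall>p\<in>polys xuvars. F2 p \<in> polys xuvars"
    using ext[of "Uv i"] by blast
  let ?X = "\<lambda>j. pvar (Xv j) :: 'n mpoly" and ?U = "\<lambda>j. pvar (Uv j) :: 'n mpoly"
  have xsub: "polys xvars \<subseteq> polys xuvars" "polys (insert (Uv j) xvars) \<subseteq> polys xuvars" for j
    by (intro polys_mono; auto simp: xuvars_def)+
  \<comment> \<open>A derivation preserving P kills the generators modulo P, so its values on the
    x_j form a tangent vector modulo P. On tangent vectors the elimination gives the vanishing of
    the form up to the factor \<open>b\<close>, which is outside P.\<close>
  have crit_mod: "(\<Sum>j\<in>UNIV. \<Theta> j * F (?X j)) \<in> P"
    if F: "derivation F" "\<forall>p\<in>P \<inter> polys xuvars. F p \<in> P" for F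
  proof -
    have "(\<Sum>j\<in>UNIV. pdiff (Xv j) g * F (?X j)) \<in> P" if g: "g \<in> set gs" for g
    proof -
      have "F g = (\<Sum>v\<in>xvars. pdiff v g * F (pvar v))"
        using g gs(1) by (intro derivation_chain F) auto
      also have "\<dots> = (\<Sum>j\<in>UNIV. pdiff (Xv j) g * F (?X j))"
        by (simp add: sum.reindex inj_on_def)
      finally have "F g = (\<Sum>j\<in>UNIV. pdiff (Xv j) g * F (?X j))" .
      moreover have "g \<in> I" using gs(2)[OF g] G'(1) by (auto simp: I_def)
      then have "F g \<in> P" using F(2) P(2) g gs(1) xsub(1) by blast
      ultimately show ?thesis by simp
    qed
    then have tangent: "\<forall>r\<in>set (map (\<lambda>g j. pdiff (Xv j) g) gs). (\<Sum>j\<in>UNIV. r j * F (?X j)) \<in> P" by simp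
    have "\<forall>p. (\<forall>z\<in>G'. ceval (at_pair z) p = 0) \<longrightarrow> p \<in> P" using P(2) unfolding I_def by blast
    then have "b * (\<Sum>j\<in>UNIV. \<Theta> j * F (?X j)) \<in> P"
      by (rule G'(4)[THEN spec[of _ P], THEN spec[of _ "\<lambda>j. F (?X j)"], THEN mp, THEN mp, THEN mp,
            OF ring_ideal_axioms _ tangent])
    then show ?thesis using bD by (simp add: mult_iff)
  qed
  define a1 where "a1 = (\<lambda>j. F1 (?X j))"
  define a2 where "a2 = (\<lambda>j. F2 (?X j))"
  define T1 where "T1 = (\<Sum>j\<in>UNIV. \<Theta> j * a1 j)"
  define T2 where "T2 = (\<Sum>j\<in>UNIV. \<Theta> j * a2 j)"
  have T12: "T1 \<in> P" "T2 \<in> P"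
    unfolding T1_def T2_def a1_def a2_def using crit_mod F1 F2 by auto
  have N_in: "N j \<in> polys xuvars" and D_in: "D j \<in> polys xuvars" for j
    using ND[of j] xsub(2)[of j] by auto
  have E_in: "E j \<in> polys xuvars" for j unfolding E_def using D_in by (intro polys_prod)
  have \<Theta>_in: "\<Theta> j \<in> polys xuvars" for j unfolding \<Theta>_def using N_in E_in by (rule polys_mult)
  have X_in: "?X j \<in> polys xuvars" for j by (auto simp: xuvars_def)
  have T_in: "T1 \<in> polys xuvars" "T2 \<in> polys xuvars"
    unfolding T1_def T2_def a1_def a2_def using F1(5) F2(5) X_in
    by (blast intro: polys_sum polys_mult \<Theta>_in)+
  \<comment> \<open>The commutator preserves P too, so the form vanishes on it. For this both
    derivations had to map \<open>polys xuvars\<close> into itself.\<close>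
  define C where "C = (\<lambda>p. F1 (F2 p) - F2 (F1 p))"
  have "derivation C" unfolding C_def by (intro derivation_commutator F1 F2)
  moreover have "\<forall>p\<in>P \<inter> polys xuvars. C p \<in> P"
    using F1(4,5) F2(4,5) by (auto simp: C_def intro!: diff)
  ultimately have TC: "(\<Sum>j\<in>UNIV. \<Theta> j * C (?X j)) \<in> P" by (rule crit_mod)
  \<comment> \<open>The differential of the form with coefficients \<Theta>, evaluated on (F1, F2).
    By Cartan's formula it is F1 of T2, minus F2 of T1, minus the value of the form on the
    commutator.\<close>
  define L where "L = (\<Sum>j\<in>UNIV. F1 (\<Theta> j) * a2 j - F2 (\<Theta> j) * a1 j)"
  have "F1 T2 - F2 T1 - (\<Sum>j\<in>UNIV. \<Theta> j * C (?X j)) = L"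
    unfolding T1_def T2_def L_def derivation_sum[OF F1(2)] derivation_sum[OF F2(2)] sum_subtractf[symmetric]
    by (intro sum.cong refl)
      (simp add: derivation_mult[OF F1(2)] derivation_mult[OF F2(2)] C_def a1_def a2_def algebra_simps)
  moreover have "F1 T2 \<in> P" "F2 T1 \<in> P" using F1(4) F2(4) T12 T_in by auto
  ultimately have LP: "L \<in> P" using TC diff by metis
  \<comment> \<open>\<open>DD ^ 2\<close> times the derivative of the j-th gradient component along
    x_k; \<open>Hu\<close> is the same along u_i. The sums \<alpha> and \<beta> are the values of F1
    and F2 on \<open>DD\<close>; they will occur only multiplied by T2 and T1, which are in
    P.\<close>
  define H where "H = (\<lambda>j k. wronskian (Xv k) (\<Theta> j) DD)"
  define Hu where "Hu = (\<lambda>j. wronskian (Uv i) (\<Theta> j) DD)"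
  define \<alpha> where "\<alpha> = (\<Sum>k\<in>UNIV. pdiff (Xv k) DD * a1 k)"
  define \<beta> where "\<beta> = (\<Sum>k\<in>UNIV. pdiff (Xv k) DD * a2 k) + s2 * pdiff (Uv i) DD"
  have F1U: "F1 (?U k) = 0" for k using F1(3) by simp
  have F2U: "F2 (?U k) = (if k = i then s2 else 0)" for k using F2(3) by auto
  have fin_xu: "finite (xuvars :: 'n var set)" by (simp add: xuvars_def)
  have F1\<Theta>: "DD * F1 (\<Theta> j) = (\<Sum>k\<in>UNIV. H j k * a1 k) + \<Theta> j * \<alpha>" for j
  proof -
    have "F1 (\<Theta> j) = (\<Sum>k\<in>UNIV. pdiff (Xv k) (\<Theta> j) * a1 k)"
      using derivation_chain[OF fin_xu \<Theta>_in F1(2), of j] by (simp add: sum_xuvars F1U a1_def)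
    then have "DD * F1 (\<Theta> j) = (\<Sum>k\<in>UNIV. H j k * a1 k + \<Theta> j * (pdiff (Xv k) DD * a1 k))"
      by (simp add: sum_distrib_left H_def wronskian_def algebra_simps)
    then show ?thesis by (simp add: sum.distrib \<alpha>_def sum_distrib_left)
  qed
  have F2\<Theta>: "DD * F2 (\<Theta> j) = (\<Sum>k\<in>UNIV. H j k * a2 k) + \<Theta> j * \<beta> + s2 * Hu j" for j
  proof -
    have "F2 (\<Theta> j) = (\<Sum>k\<in>UNIV. pdiff (Xv k) (\<Theta> j) * a2 k) + pdiff (Uv i) (\<Theta> j) * s2"
      using derivation_chain[OF fin_xu \<Theta>_in F2(2), of j]
      by (simp add: sum_xuvars F2U a2_def if_distrib cong: if_cong)
    then have "DD * F2 (\<Theta> j) = (\<Sum>k\<in>UNIV. H j k * a2 k + \<Theta> j * (pdiff (Xv k) DD * a2 k)) +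
        s2 * (Hu j + \<Theta> j * pdiff (Uv i) DD)"
      by (simp add: sum_distrib_left H_def Hu_def wronskian_def algebra_simps)
    then show ?thesis by (simp add: sum.distrib \<beta>_def sum_distrib_left algebra_simps)
  qed
  have H_wr: "wronskian v (\<Theta> j) DD = E j ^ 2 * wronskian v (N j) (D j)" for v j
    unfolding \<Theta>_def DD[of j] by (rule wronskian_scale)
  have H_sym: "H j k = H k j" for j k
  proof -
    have "(D j ^ 2 * D k ^ 2) * H j k = (D j * E j) ^ 2 * (D k ^ 2 * wronskian (Xv k) (N j) (D j))"
      unfolding H_def H_wr by (simp only: power_mult_distrib mult_ac)
    also have "\<dots> = (D k * E k) ^ 2 * (D k ^ 2 * wronskian (Xv k) (N j) (D j))"
      by (simp only: DD[symmetric])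
    also have "\<dots> = (D k * E k) ^ 2 * (D j ^ 2 * wronskian (Xv j) (N k) (D k))"
      by (simp only: closed)
    also have "\<dots> = (D j ^ 2 * D k ^ 2) * H k j"
      unfolding H_def H_wr by (simp only: power_mult_distrib mult_ac)
    finally show ?thesis using Dnz by simp
  qed
  \<comment> \<open>By symmetry the x-derivatives cancel, so only the term in du_i and dx_i
    survives.\<close>
  have anti: "(\<Sum>j\<in>UNIV. (\<Sum>k\<in>UNIV. H j k * a1 k) * a2 j) = (\<Sum>j\<in>UNIV. (\<Sum>k\<in>UNIV. H j k * a2 k) * a1 j)"
  proof -
    have "(\<Sum>j\<in>UNIV. (\<Sum>k\<in>UNIV. H j k * a1 k) * a2 j) = (\<Sum>k\<in>UNIV. \<Sum>j\<in>UNIV. H j k * a1 k * a2 j)"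
      unfolding sum_distrib_right by (rule sum.swap)
    also have "\<dots> = (\<Sum>k\<in>UNIV. \<Sum>j\<in>UNIV. H k j * a2 j * a1 k)"
      by (intro sum.cong refl) (simp add: H_sym mult_ac)
    finally show ?thesis by (simp add: sum_distrib_right)
  qed
  have Hu: "Hu j = 0" if "j \<noteq> i" for j
  proof -
    have "pdiff (Uv i) (N j) = 0" "pdiff (Uv i) (D j) = 0"
      using that by (intro pdiff_eq_0[OF ND(1)] pdiff_eq_0[OF ND(2)]; auto)+
    then show ?thesis by (simp add: Hu_def H_wr) (simp add: wronskian_def)
  qed
  have a1i: "a1 i = s1" using F1(3) by (simp add: a1_def)
  have "(\<Sum>j\<in>UNIV. Hu j * a1 j) = (\<Sum>j\<in>{i}. Hu j * a1 j)"
    by (rule sum.mono_neutral_right) (auto simp: Hu)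
  then have Hu_sum: "(\<Sum>j\<in>UNIV. Hu j * a1 j) = Hu i * s1" by (simp add: a1i)
  have expand: "(h1 + t * p) * x - (h2 + t * q + s * u) * y = h1 * x - h2 * y + t * x * p - t * y * q - s * (u * y)"
    for h1 h2 t p q s u x y :: "'n mpoly"
    by (simp add: algebra_simps)
  have "DD * L = (\<Sum>j\<in>UNIV. DD * F1 (\<Theta> j) * a2 j - DD * F2 (\<Theta> j) * a1 j)"
    by (simp add: L_def sum_distrib_left algebra_simps)
  also have "\<dots> = (\<Sum>j\<in>UNIV. (\<Sum>k\<in>UNIV. H j k * a1 k) * a2 j) - (\<Sum>j\<in>UNIV. (\<Sum>k\<in>UNIV. H j k * a2 k) * a1 j)
      + (\<Sum>j\<in>UNIV. \<Theta> j * a2 j * \<alpha>) - (\<Sum>j\<in>UNIV. \<Theta> j * a1 j * \<beta>) - (\<Sum>j\<in>UNIV. s2 * (Hu j * a1 j))"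
    unfolding F1\<Theta> F2\<Theta> sum_subtractf[symmetric] sum.distrib[symmetric]
    by (intro sum.cong refl expand)
  also have "\<dots> = T2 * \<alpha> - T1 * \<beta> - s2 * (Hu i * s1)"
    unfolding anti T1_def T2_def sum_distrib_right[symmetric] sum_distrib_left[symmetric] Hu_sum by simp
  finally have "s2 * (Hu i * s1) = T2 * \<alpha> - T1 * \<beta> - DD * L" by simp
  also have "\<dots> \<in> P" by (rule diff[OF diff[OF mult_right[OF T12(2)] mult_right[OF T12(1)]] mult_left[OF LP]])
  finally have "Hu i \<in> P" using F1(1) F2(1) by (simp add: mult_iff)
  then have wP: "wronskian (Uv i) (N i) (D i) \<in> P"
    using EP power_notin by (auto simp: Hu_def H_wr mult_iff)
  let ?w = "wronskian (Uv i) (N i) (D i)"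
  \<comment> \<open>So dA_i/du_i is a ratio a/a' of polynomials in x_i and u_i alone. As its
    numerator lies in P, so does \<open>a\<close>, whereas P contains no nonzero polynomial in these
    variables.\<close>
  have wr0: "\<forall>v\<in>Xv ` (-{i}). wronskian v ?w (D i ^ 2) = 0"
    using wronskian_closed[OF ND Dnz _ closed] by auto
  have w_in: "?w \<in> polys (insert (Uv i) xvars)" "D i ^ 2 \<in> polys (insert (Uv i) xvars)"
    using ND by (auto intro!: wronskian_in_polys)
  have "D i ^ 2 \<noteq> 0" using Dnz by simp
  from wronskian_ratio[OF fin w_in wnz this wr0]
  obtain a a' where a: "a \<in> polys (insert (Uv i) xvars - Xv ` (-{i}))" "a \<noteq> 0" "a * D i ^ 2 = a' * ?w"
    by blast
  have "a * D i ^ 2 \<in> P" using a(3) wP mult_left by simp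
  then have "a \<in> P" using DP power_notin by (auto simp: mult_iff)
  moreover have "a \<in> polys ?V" using a(1) polys_mono[of "insert (Uv i) xvars - Xv ` (-{i})" ?V] by auto
  ultimately show False using PV a(2) by blast
qed

section \<open>The gradient as a closed form\<close>

text \<open>Some coefficient with respect to the last variable is nonzero at a suitable grid point,
  and then only finitely many values of that variable are excluded. The sets are arbitrary so that a
  grid fits into any nonempty open set.\<close>

lemma ceval_nonzero_on_grid:
  assumes "finite V" "p \<in> polys V" "p \<noteq> 0" "\<And>v. v \<in> V \<Longrightarrow> infinite (S v)"
  shows "\<exists>\<sigma>. (\<forall>v\<in>V. \<sigma> v \<in> S v) \<and> ceval \<sigma> p \<noteq> 0"
  using assms
proof (induction V arbitrary: p)
  case empty
  then have "p \<in> polys {}" by simp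
  then obtain z where "p = pconst z"
  proof (induction arbitrary: thesis rule: polys_induct)
    case (add p q)
    then show ?case by (metis mconst_add pconst_eq_mconst)
  next
    case (mult p q)
    then show ?case by (metis mconst_mult pconst_eq_mconst)
  qed auto
  moreover have "z \<noteq> 0" using empty(2) \<open>p = pconst z\<close> by (auto simp: pconst_eq_mconst)
  ultimately show ?case by auto
next
  case (insert v V)
  have "uni v p \<noteq> 0" using insert.prems by simp
  then obtain k where k: "Polynomial.coeff (uni v p) k \<noteq> 0" by (auto simp: poly_eq_iff)
  have c: "coeffs_in (polys V) (uni v p)"
    using polys_insertE[OF insert.prems(1) insert.hyps(2)] .
  then obtain \<sigma> where \<sigma>: "\<forall>v\<in>V. \<sigma> v \<in> S v" "ceval \<sigma> (Polynomial.coeff (uni v p) k) \<noteq> 0"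
    using insert.IH[of "Polynomial.coeff (uni v p) k"] k insert.prems(3) by (auto simp: coeffs_in_def)
  let ?Q = "map_poly (ceval \<sigma>) (uni v p)"
  have "Polynomial.coeff ?Q k \<noteq> 0" using \<sigma>(2) by (simp add: coeff_map_poly)
  then have "?Q \<noteq> 0" by auto
  then have "finite {z. poly ?Q z = 0}" by (rule poly_roots_finite)
  then have "\<not> S v \<subseteq> {z. poly ?Q z = 0}"
    using insert.prems(3)[of v] finite_subset by auto
  then obtain z where z: "z \<in> S v" "poly ?Q z \<noteq> 0" by auto
  have "map_poly (ceval (\<sigma>(v := z))) (uni v p) = ?Q"
    using c insert.hyps(2)
    by (intro poly_eqI) (auto simp: coeff_map_poly coeffs_in_def intro!: peval_cong_vars[where V = V])
  then have "ceval (\<sigma>(v := z)) p \<noteq> 0" using z ceval_uni[of "\<sigma>(v := z)" p v] by simp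
  moreover have "\<forall>w\<in>insert v V. (\<sigma>(v := z)) w \<in> S w" using \<sigma>(1) z(1) by simp
  ultimately show ?case by blast
qed

lemma poly_identity_on_open:
  fixes S :: "((complex^'n) \<times> (complex^'n)) set"
  assumes S: "open S" "S \<noteq> {}" and p: "p \<in> polys xuvars" and zero: "\<And>z. z \<in> S \<Longrightarrow> ceval (at_pair z) p = 0"
  shows "p = 0"
proof (rule ccontr)
  assume nz: "p \<noteq> 0"
  obtain x u where "(x, u) \<in> S" using S(2) by auto
  then obtain A B where AB: "open A" "open B" "x \<in> A" "u \<in> B" "A \<times> B \<subseteq> S"
    using open_prod_elim[OF S(1)] by (metis mem_Sigma_iff)
  obtain A' where A': "\<And>i. open (A' i) \<and> x $ i \<in> A' i" "\<And>y. (\<forall>i. y $ i \<in> A' i) \<Longrightarrow> y \<in> A"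
    using AB(1,3) unfolding open_vec_def by metis
  obtain B' where B': "\<And>i. open (B' i) \<and> u $ i \<in> B' i" "\<And>y. (\<forall>i. y $ i \<in> B' i) \<Longrightarrow> y \<in> B"
    using AB(2,4) unfolding open_vec_def by metis
  define T where "T = (\<lambda>v. case v of Xv i \<Rightarrow> A' i | Uv i \<Rightarrow> B' i | _ \<Rightarrow> UNIV)"
  have inf: "infinite T'" if "open T'" "y \<in> T'" for T' :: "complex set" and y
    using that finite_imp_not_open by blast
  have "infinite (T v)" if "v \<in> xuvars" for v
    using that A'(1) B'(1) inf by (fastforce simp: xuvars_def T_def)
  moreover have "finite (xuvars :: 'n var set)" by (simp add: xuvars_def)
  ultimately obtain \<sigma> where \<sigma>: "\<forall>v\<in>xuvars. \<sigma> v \<in> T v" "ceval \<sigma> p \<noteq> 0"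
    using ceval_nonzero_on_grid[OF _ p nz] by blast
  define z where "z = ((\<chi> i. \<sigma> (Xv i)), (\<chi> i. \<sigma> (Uv i)))"
  have "\<sigma> (Xv k) \<in> A' k" "\<sigma> (Uv k) \<in> B' k" for k
    using bspec[OF \<sigma>(1), of "Xv k"] bspec[OF \<sigma>(1), of "Uv k"] by (simp_all add: xuvars_def T_def)
  then have "fst z \<in> A" "snd z \<in> B"
    by (auto intro!: A'(2) B'(2) simp: z_def)
  then have "z \<in> S" using AB(5) by (cases z) auto
  moreover have "ceval (at_pair z) p = ceval \<sigma> p"
    by (rule peval_cong_vars[OF p]) (auto simp: xuvars_def at_xu_def z_def)
  ultimately show False using zero \<sigma>(2) by simp
qed

text \<open>The mean value inequality, applied in one variable after the other, compares the second
  difference of \<phi> over a square of side h with \<open>h * h * a' 0 0\<close>, and in the other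
  order with \<open>h * h * b' 0 0\<close>. By continuity the errors are arbitrarily small relative
  to the square of h.\<close>

lemma symmetric_mixed_derivative:
  fixes \<phi> :: "complex \<Rightarrow> complex \<Rightarrow> complex"
  assumes r: "r > 0"
    and a: "\<And>z w. norm z < r \<Longrightarrow> norm w < r \<Longrightarrow> ((\<lambda>z. \<phi> z w) has_field_derivative a z w) (at z)"
    and b: "\<And>z w. norm z < r \<Longrightarrow> norm w < r \<Longrightarrow> ((\<lambda>w. \<phi> z w) has_field_derivative b z w) (at w)"
    and a': "\<And>z w. norm z < r \<Longrightarrow> norm w < r \<Longrightarrow> ((\<lambda>w. a z w) has_field_derivative a' z w) (at w)"
    and b': "\<And>z w. norm z < r \<Longrightarrow> norm w < r \<Longrightarrow> ((\<lambda>z. b z w) has_field_derivative b' z w) (at z)"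
    and cont: "((\<lambda>y. a' (fst y) (snd y)) \<longlongrightarrow> a' 0 0) (nhds (0, 0))"
      "((\<lambda>y. b' (fst y) (snd y)) \<longlongrightarrow> b' 0 0) (nhds (0, 0))"
  shows "a' 0 0 = b' 0 0"
proof -
  \<comment> \<open>Stated for arbitrary functions, so that it applies a second time with the
    variables exchanged.\<close>
  have bound: "norm (\<phi> h h - \<phi> h 0 - \<phi> 0 h + \<phi> 0 0 - h * h * a' 0 0) \<le> e * norm h * norm h"
    if \<phi>: "\<And>z w. norm z < d \<Longrightarrow> norm w < d \<Longrightarrow> ((\<lambda>z. \<phi> z w) has_field_derivative a z w) (at z)"
      "\<And>z w. norm z < d \<Longrightarrow> norm w < d \<Longrightarrow> ((\<lambda>w. a z w) has_field_derivative a' z w) (at w)"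
      "\<And>z w. norm z < d \<Longrightarrow> norm w < d \<Longrightarrow> norm (a' z w - a' 0 0) \<le> e"
      and h: "norm h < d" and e: "e > 0"
    for \<phi> a a' :: "complex \<Rightarrow> complex \<Rightarrow> complex" and h :: complex and d e :: real
  proof -
    have h0: "0 \<in> ball (0::complex) d" "h \<in> ball (0::complex) d"
      using h norm_ge_zero[of h] by (auto simp del: norm_ge_zero)
    have inner: "norm (a z h - a z 0 - h * a' 0 0) \<le> e * norm h" if z: "norm z < d" for z
    proof -
      have "norm ((a z h - h * a' 0 0) - (a z 0 - 0 * a' 0 0)) \<le> e * norm (h - 0)"
      proof (rule field_differentiable_bound[OF convex_ball _ _ h0(2,1)])
        show "((\<lambda>w. a z w - w * a' 0 0) has_field_derivative (a' z w - a' 0 0)) (at w within ball 0 d)"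
          if "w \<in> ball 0 d" for w
          using that z by (auto intro!: derivative_eq_intros DERIV_subset[OF \<phi>(2)])
        show "norm (a' z w - a' 0 0) \<le> e" if "w \<in> ball 0 d" for w
          using that z \<phi>(3) by auto
      qed
      moreover have "(a z h - h * a' 0 0) - (a z 0 - 0 * a' 0 0) = a z h - a z 0 - h * a' 0 0"
        by (simp add: algebra_simps)
      ultimately show ?thesis by (simp only: diff_zero)
    qed
    have "norm ((\<phi> h h - \<phi> h 0 - h * (h * a' 0 0)) - (\<phi> 0 h - \<phi> 0 0 - 0 * (h * a' 0 0))) \<le>
        (e * norm h) * norm (h - 0)"
    proof (rule field_differentiable_bound[OF convex_ball _ _ h0(2,1)])
      show "((\<lambda>z. \<phi> z h - \<phi> z 0 - z * (h * a' 0 0)) has_field_derivative (a z h - a z 0 - h * a' 0 0)) (at z within ball 0 d)"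
        if "z \<in> ball 0 d" for z
        using that h h0 by (auto intro!: derivative_eq_intros DERIV_subset[OF \<phi>(1)])
      show "norm (a z h - a z 0 - h * a' 0 0) \<le> e * norm h" if "z \<in> ball 0 d" for z
        using that inner by simp
    qed
    then show ?thesis by (simp add: algebra_simps)
  qed
  have "norm (a' 0 0 - b' 0 0) \<le> 2 * e" if e: "e > 0" for e
  proof -
    have "\<forall>\<^sub>F y in nhds (0, 0). dist (a' (fst y) (snd y)) (a' 0 0) < e \<and> dist (b' (fst y) (snd y)) (b' 0 0) < e"
      using cont e by (intro eventually_conj) (auto dest: tendstoD)
    then obtain S where S: "open S" "(0, 0) \<in> S"
      "\<And>y. y \<in> S \<Longrightarrow> dist (a' (fst y) (snd y)) (a' 0 0) < e \<and> dist (b' (fst y) (snd y)) (b' 0 0) < e"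
      unfolding eventually_nhds by blast
    obtain A B where AB: "open A" "open B" "(0, 0) \<in> A \<times> B" "A \<times> B \<subseteq> S"
      using open_prod_elim[OF S(1,2)] by blast
    obtain d1 d2 where d12: "d1 > 0" "d2 > 0" "ball 0 d1 \<subseteq> A" "ball 0 d2 \<subseteq> B"
      using AB by (metis mem_Sigma_iff open_contains_ball)
    define d where "d = min r (min d1 d2)"
    have d: "d > 0" "d \<le> r" using d12 r by (auto simp: d_def)
    have S': "norm (a' z w - a' 0 0) \<le> e \<and> norm (b' z w - b' 0 0) \<le> e" if "norm z < d" "norm w < d" for z w
    proof -
      have "z \<in> A" "w \<in> B" using that subsetD[OF d12(3), of z] subsetD[OF d12(4), of w] by (auto simp: d_def)
      then have "(z, w) \<in> S" using AB(4) by blast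
      from S(3)[OF this] show ?thesis by (simp add: dist_norm)
    qed
    define h where "h = complex_of_real (d / 2)"
    have h: "norm h < d" "h \<noteq> 0" using d by (auto simp: h_def)
    let ?\<Delta> = "\<phi> h h - \<phi> h 0 - \<phi> 0 h + \<phi> 0 0"
    have 1: "norm (?\<Delta> - h * h * a' 0 0) \<le> e * norm h * norm h"
      by (rule bound[of d \<phi> a a']) (use a a' d S' h e in auto)
    have "norm (\<phi> h h - \<phi> 0 h - \<phi> h 0 + \<phi> 0 0 - h * h * b' 0 0) \<le> e * norm h * norm h"
      by (rule bound[of d "\<lambda>w z. \<phi> z w" "\<lambda>w z. b z w" "\<lambda>w z. b' z w"]) (use b b' d S' h e in auto)
    then have 2: "norm (?\<Delta> - h * h * b' 0 0) \<le> e * norm h * norm h" by (simp add: algebra_simps)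
    have "(h * h) * (a' 0 0 - b' 0 0) = (?\<Delta> - h * h * b' 0 0) - (?\<Delta> - h * h * a' 0 0)"
      by (simp add: algebra_simps)
    then have "norm ((h * h) * (a' 0 0 - b' 0 0)) \<le> norm (?\<Delta> - h * h * b' 0 0) + norm (?\<Delta> - h * h * a' 0 0)"
      using norm_triangle_ineq4 by metis
    also have "\<dots> \<le> e * norm h * norm h + e * norm h * norm h" using 1 2 by linarith
    also have "\<dots> = (norm h * norm h) * (2 * e)" by (simp add: algebra_simps)
    finally have "(norm h * norm h) * norm (a' 0 0 - b' 0 0) \<le> (norm h * norm h) * (2 * e)"
      unfolding norm_mult .
    then show ?thesis using h by simp
  qed
  then have "norm (a' 0 0 - b' 0 0) \<le> 0"
    by (metis dense_ge field_sum_of_halves mult.commute mult_2_right half_gt_zero_iff)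
  then show ?thesis by simp
qed

lemma tendsto_ceval:
  assumes "\<And>v. ((\<lambda>y. \<sigma> y v) \<longlongrightarrow> l v) F"
  shows "((\<lambda>y. ceval (\<sigma> y) p) \<longlongrightarrow> ceval l p) F"
  by (induction p rule: poly_over_induct) (auto intro!: tendsto_intros assms)

lemma ceval_shift_has_derivative:
  "((\<lambda>z. ceval (\<sigma>(v := c + z)) p) has_field_derivative ceval (\<sigma>(v := c + z0)) (pdiff v p)) (at z0)"
  using ceval_has_derivative[of \<sigma> v p "z0 + c", unfolded DERIV_shift] by (simp add: add.commute)

text \<open>Complex homogeneity of the total derivative turns its restriction to the i-th coordinate
  line into multiplication by a complex number. Shifting the base point identifies that number with
  \<open>partial_x\<close>.\<close>

lemma partial_x_has_derivative:
  fixes f :: "(complex^'n) \<times> (complex^'n) \<Rightarrow> complex"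
  assumes "holomorphic_in W f" "(x + z0 *s axis i 1, u) \<in> W"
  shows "((\<lambda>z. f (x + z *s axis i 1, u)) has_field_derivative partial_x f i (x + z0 *s axis i 1) u) (at z0)"
proof -
  let ?e = "axis i 1 :: complex^'n"
  obtain f' where f': "(f has_derivative f') (at (x + z0 *s ?e, u))"
    "\<And>b h k. f' (b *s h, b *s k) = b * f' (h, k)"
    using assms by (auto simp: holomorphic_in_def)
  have lin: "bounded_linear (\<lambda>z. (z *s ?e, 0 :: complex^'n))"
  proof (rule bounded_linear_intro[where K = "norm ?e"])
    show "norm (z *s ?e, 0 :: complex^'n) \<le> norm z * norm ?e" for z
      by (simp add: norm_Pair norm_mult norm_vec_def L2_set_def power_mult_distrib
          sum_distrib_left[symmetric] real_sqrt_mult sum_nonneg)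
  qed (simp_all add: vec_eq_iff algebra_simps)
  have path: "((\<lambda>z. (x + z *s ?e, u)) has_derivative (\<lambda>z. (z *s ?e, 0))) (at z1)" for z1 :: complex
  proof -
    have "((\<lambda>z. (x, u) + (z *s ?e, 0)) has_derivative (\<lambda>z. 0 + (z *s ?e, 0))) (at z1)"
      by (intro has_derivative_add has_derivative_const bounded_linear_imp_has_derivative lin)
    then show ?thesis by simp
  qed
  have "((f \<circ> (\<lambda>z. (x + z *s ?e, u))) has_derivative (f' \<circ> (\<lambda>z. (z *s ?e, 0)))) (at z0)"
    by (rule diff_chain_at[OF path f'(1)])
  moreover have "f' \<circ> (\<lambda>z. (z *s ?e, 0)) = (*) (f' (?e, 0))"
    using f'(2)[of _ ?e 0] by (auto simp: fun_eq_iff mult.commute)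
  ultimately have D: "((\<lambda>z. f (x + z *s ?e, u)) has_field_derivative f' (?e, 0)) (at z0)"
    by (simp add: has_field_derivative_def o_def)
  then have "((\<lambda>z. f (x + (z0 + z) *s ?e, u)) has_field_derivative f' (?e, 0)) (at 0)"
    using DERIV_shift[of "\<lambda>z. f (x + z *s ?e, u)" _ 0 z0] by (simp add: add.commute)
  then have "partial_x f i (x + z0 *s ?e) u = f' (?e, 0)"
    unfolding partial_x_def by (intro DERIV_imp_deriv) (simp add: vector_add_ldistrib vector_sadd_rdistrib add.assoc)
  then show ?thesis using D by simp
qed

lemma ceval_continuous_pair: "continuous_on S (\<lambda>z. ceval (at_pair z) p)"
  unfolding continuous_on_def
proof (intro ballI tendsto_ceval)
  show "((\<lambda>z. at_pair z v) \<longlongrightarrow> at_pair z0 v) (at z0 within S)" for z0 v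
    by (cases v) (auto simp: at_xu_def intro!: tendsto_intros)
qed

text \<open>Where neither denominator vanishes on W, this is the symmetry of the mixed derivatives
  of f with denominators cleared. These points form a nonempty open set, so the identity holds
  between the polynomials.\<close>

lemma gradient_closed:
  fixes f :: "(complex^'n) \<times> (complex^'n) \<Rightarrow> complex"
  assumes W: "open W" "W \<noteq> {}" and hol: "holomorphic_in W f" and ij: "i \<noteq> j"
    and ri: "partial_repr W f i (Ni, Di)" and rj: "partial_repr W f j (Nj, Dj)"
  shows "Dj ^ 2 * wronskian (Xv j) Ni Di = Di ^ 2 * wronskian (Xv i) Nj Dj"
proof -
  have sub: "polys (insert (Uv k) xvars) \<subseteq> polys xuvars" for k :: 'n
    by (rule polys_mono) (auto simp: xuvars_def)
  have in_xu: "Ni \<in> polys xuvars" "Di \<in> polys xuvars" "Nj \<in> polys xuvars" "Dj \<in> polys xuvars"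
    using ri rj sub by (auto simp: partial_repr_def)
  have nz: "Di \<noteq> 0" "Dj \<noteq> 0" using ri rj by (auto simp: partial_repr_def)
  define W0 where "W0 = {z \<in> W. ceval (at_pair z) (Di * Dj) \<noteq> 0}"
  have W0: "open W0"
  proof -
    have "open {z :: (complex^'n) \<times> (complex^'n). ceval (at_pair z) (Di * Dj) \<noteq> 0}"
      by (intro open_Collect_neq ceval_continuous_pair continuous_intros)
    then have "open (W \<inter> {z. ceval (at_pair z) (Di * Dj) \<noteq> 0})" using W(1) by blast
    then show ?thesis by (simp add: W0_def Collect_conj_eq)
  qed
  have "W0 \<noteq> {}"
  proof
    assume "W0 = {}"
    then have "Di * Dj = 0"
      using in_xu by (intro poly_identity_on_open[OF W]) (auto simp: W0_def)
    then show False using nz by simp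
  qed
  have "ceval (at_pair y) (Dj ^ 2 * wronskian (Xv j) Ni Di - Di ^ 2 * wronskian (Xv i) Nj Dj) = 0"
    if y: "y \<in> W0" for y
  proof -
    obtain x u where xu: "y = (x, u)" by fastforce
    \<comment> \<open>The point y moved along the i-th and j-th coordinates of x; \<tau> gives its
      coordinates as updates of an assignment, to which differentiation along a single variable
      applies.\<close>
    define pt where "pt = (\<lambda>z w. (x + z *s axis i 1 + w *s axis j 1, u))"
    define \<tau> where "\<tau> = (\<lambda>z w. (at_xu x u)(Xv i := x $ i + z, Xv j := x $ j + w))"
    have \<tau>: "at_pair (pt z w) = \<tau> z w" for z w
      using ij by (auto simp: fun_eq_iff \<tau>_def pt_def at_xu_def axis_def split: var.splits)
    have cont_pt: "continuous_on UNIV (\<lambda>y. pt (fst y) (snd y))"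
    proof -
      have sc: "continuous_on UNIV (\<lambda>y. g y *s (axis k 1 :: complex^'n))" if "continuous_on UNIV g"
        for g :: "complex \<times> complex \<Rightarrow> complex" and k
        unfolding vector_scalar_mult_def by (intro continuous_on_vec_lambda continuous_intros that)
      show ?thesis unfolding pt_def by (intro continuous_intros sc)
    qed
    have "open ((\<lambda>y. pt (fst y) (snd y)) -` W0)"
      by (rule open_vimage[OF W0 cont_pt])
    moreover have "(0, 0) \<in> (\<lambda>y. pt (fst y) (snd y)) -` W0"
      using y by (simp add: pt_def xu)
    ultimately obtain A B where AB: "open A" "open B" "(0, 0) \<in> A \<times> B" "A \<times> B \<subseteq> (\<lambda>y. pt (fst y) (snd y)) -` W0"
      by (rule open_prod_elim)
    obtain d1 where d1: "d1 > 0" "ball 0 d1 \<subseteq> A" using AB(1,3) open_contains_ball by blast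
    obtain d2 where d2: "d2 > 0" "ball 0 d2 \<subseteq> B" using AB(2,3) open_contains_ball by blast
    define r where "r = min d1 d2"
    have r: "r > 0" using d1 d2 by (simp add: r_def)
    have ptW: "pt z w \<in> W" "ceval (\<tau> z w) Di \<noteq> 0" "ceval (\<tau> z w) Dj \<noteq> 0" if "norm z < r" "norm w < r" for z w
    proof -
      have "z \<in> A" "w \<in> B" using that subsetD[OF d1(2), of z] subsetD[OF d2(2), of w] by (auto simp: r_def)
      then have "pt z w \<in> W0" using subsetD[OF AB(4), of "(z, w)"] by simp
      then show "pt z w \<in> W" "ceval (\<tau> z w) Di \<noteq> 0" "ceval (\<tau> z w) Dj \<noteq> 0"
        by (auto simp: W0_def \<tau>)
    qed
    have pi: "partial_x f i (fst (pt z w)) u = ceval (\<tau> z w) Ni / ceval (\<tau> z w) Di"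
      and pj: "partial_x f j (fst (pt z w)) u = ceval (\<tau> z w) Nj / ceval (\<tau> z w) Dj"
      if "norm z < r" "norm w < r" for z w
      using ri rj ptW[OF that] unfolding partial_repr_def \<tau>[symmetric] by (auto simp: pt_def field_simps)
    define \<phi> where "\<phi> = (\<lambda>z w. f (pt z w))"
    have dz: "((\<lambda>z. ceval (\<tau> z w) p) has_field_derivative ceval (\<tau> z w) (pdiff (Xv i) p)) (at z)" for z w p
    proof -
      have eq: "\<tau> z w = ((at_xu x u)(Xv j := x $ j + w))(Xv i := x $ i + z)" for z
        using ij by (simp add: \<tau>_def fun_upd_twist)
      show ?thesis unfolding eq by (rule ceval_shift_has_derivative)
    qed
    have dw: "((\<lambda>w. ceval (\<tau> z w) p) has_field_derivative ceval (\<tau> z w) (pdiff (Xv j) p)) (at w)" for z w p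
      unfolding \<tau>_def by (rule ceval_shift_has_derivative)
    have lim\<tau>: "((\<lambda>y. ceval (\<tau> (fst y) (snd y)) p) \<longlongrightarrow> ceval (\<tau> 0 0) p) (nhds (0, 0))" for p
    proof (rule tendsto_ceval)
      fix v
      have "((\<lambda>y. x $ i + fst y) \<longlongrightarrow> x $ i + fst (0, 0 :: complex)) (nhds (0, 0 :: complex))"
        "((\<lambda>y. x $ j + snd y) \<longlongrightarrow> x $ j + snd (0 :: complex, 0)) (nhds (0 :: complex, 0))"
        by (intro tendsto_add tendsto_const tendsto_fst tendsto_snd filterlim_ident)+
      then show "((\<lambda>y. \<tau> (fst y) (snd y) v) \<longlongrightarrow> \<tau> 0 0 v) (nhds (0, 0))"
        by (cases "v = Xv i"; cases "v = Xv j") (simp_all add: \<tau>_def)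
    qed
    have nz0: "ceval (\<tau> 0 0) Di \<noteq> 0" "ceval (\<tau> 0 0) Dj \<noteq> 0" using ptW[of 0 0] r by auto
    let ?q = "\<lambda>v N D z w. ceval (\<tau> z w) (wronskian v N D) / ceval (\<tau> z w) D ^ 2"
    have "?q (Xv j) Ni Di 0 0 = ?q (Xv i) Nj Dj 0 0"
    proof (rule symmetric_mixed_derivative[OF r, of \<phi> "\<lambda>z w. ceval (\<tau> z w) Ni / ceval (\<tau> z w) Di"
          "\<lambda>z w. ceval (\<tau> z w) Nj / ceval (\<tau> z w) Dj" "?q (Xv j) Ni Di" "?q (Xv i) Nj Dj"])
      fix z w :: complex assume zw: "norm z < r" "norm w < r"
      have "((\<lambda>z. f ((x + w *s axis j 1) + z *s axis i 1, u)) has_field_derivative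
          partial_x f i ((x + w *s axis j 1) + z *s axis i 1) u) (at z)"
        using ptW(1)[OF zw] by (intro partial_x_has_derivative[OF hol]) (simp add: pt_def add_ac)
      then show "((\<lambda>z. \<phi> z w) has_field_derivative ceval (\<tau> z w) Ni / ceval (\<tau> z w) Di) (at z)"
        using pi[OF zw] by (simp add: \<phi>_def pt_def add_ac)
      have "((\<lambda>w. f ((x + z *s axis i 1) + w *s axis j 1, u)) has_field_derivative
          partial_x f j ((x + z *s axis i 1) + w *s axis j 1) u) (at w)"
        using ptW(1)[OF zw] by (intro partial_x_has_derivative[OF hol]) (simp add: pt_def)
      then show "((\<lambda>w. \<phi> z w) has_field_derivative ceval (\<tau> z w) Nj / ceval (\<tau> z w) Dj) (at w)"
        using pj[OF zw] by (simp add: \<phi>_def pt_def)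
      show "((\<lambda>w. ceval (\<tau> z w) Ni / ceval (\<tau> z w) Di) has_field_derivative ?q (Xv j) Ni Di z w) (at w)"
        using DERIV_divide[OF dw[where p = Ni] dw[where p = Di] ptW(2)[OF zw]]
        by (simp add: wronskian_def power2_eq_square mult.commute)
      show "((\<lambda>z. ceval (\<tau> z w) Nj / ceval (\<tau> z w) Dj) has_field_derivative ?q (Xv i) Nj Dj z w) (at z)"
        using DERIV_divide[OF dz[where p = Nj] dz[where p = Dj] ptW(3)[OF zw]]
        by (simp add: wronskian_def power2_eq_square mult.commute)
    next
      show "((\<lambda>y. ?q (Xv j) Ni Di (fst y) (snd y)) \<longlongrightarrow> ?q (Xv j) Ni Di 0 0) (nhds (0, 0))"
        using nz0 by (intro tendsto_divide tendsto_power lim\<tau>) auto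
      show "((\<lambda>y. ?q (Xv i) Nj Dj (fst y) (snd y)) \<longlongrightarrow> ?q (Xv i) Nj Dj 0 0) (nhds (0, 0))"
        using nz0 by (intro tendsto_divide tendsto_power lim\<tau>) auto
    qed
    moreover have "at_pair y = \<tau> 0 0" using \<tau>[of 0 0] by (simp add: pt_def xu)
    ultimately show ?thesis using nz0 by (simp add: field_simps)
  qed
  moreover have "Dj ^ 2 * wronskian (Xv j) Ni Di - Di ^ 2 * wronskian (Xv i) Nj Dj \<in> polys xuvars"
    using in_xu by (intro polys_diff polys_mult polys_power wronskian_in_polys)
  ultimately have "Dj ^ 2 * wronskian (Xv j) Ni Di - Di ^ 2 * wronskian (Xv i) Nj Dj = 0"
    using poly_identity_on_open[OF W0 \<open>W0 \<noteq> {}\<close>] by blast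
  then show ?thesis by simp
qed

section \<open>Generic cardinality of the fibers\<close>

lemma coeff_hom_aeval: "coeff_hom (aeval \<sigma>)"
  by unfold_locales (simp_all add: aeval_def)

lemma prime_poly_ideal_kernel: "prime_poly_ideal {p. aeval \<sigma> p = 0}"
proof -
  interpret h: coeff_hom "aeval \<sigma>" by (rule coeff_hom_aeval)
  show ?thesis by unfold_locales (auto simp: h.emb_0 h.emb_1 h.emb_add h.emb_mult)
qed

lemma coeffs_in_prod_linear:
  assumes "subring_set A" "\<And>k. k \<in># K \<Longrightarrow> g k \<in> A"
  shows "coeffs_in A (\<Prod>k\<in>#K. [:- g k, 1:])"
  using assms(2)
proof (induction K)
  case empty
  then show ?case using coeffs_in_ops(6)[OF assms(1) subring_setD(1)[OF assms(1)]] by (simp add: one_pCons)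
next
  case (add k K)
  have "g k \<in> A" using add.prems by simp
  then have "coeffs_in A [:- g k, 1:]"
    using subring_setD(1-3)[OF assms(1)] by (auto simp: coeffs_in_def coeff_pCons split: nat.splits)
  then show ?case using add by (simp add: coeffs_in_ops(3)[OF assms(1)] del: mult_pCons_left mult_pCons_right)
qed

text \<open>Over the algebraic closure of C(u), each coordinate of a point of F is a root of its
  relation, which leaves finitely many candidates. The roots are represented by variables, and the
  ideal of their algebraic relations is prime, being the kernel of a map to a field. It can
  therefore be specialized to complex values at all u where one polynomial g is nonzero.\<close>

lemma generic_fiber_cardinality:
  fixes F :: "((complex^'n) \<times> (complex^'n)) set"
  assumes F: "zclosed pair_coords F"
    and rel: "\<And>i. \<exists>R\<in>polys (insert (Xv i) (range Uv)). R \<noteq> 0 \<and> (\<forall>z\<in>F. ceval (at_pair z) R = 0)"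
  shows "\<exists>k. for_general vec_nth UNIV (\<lambda>u. finite {z \<in> F. snd z = u} \<and> card {z \<in> F. snd z = u} = k)"
proof -
  obtain E where E: "F = {a. \<forall>p\<in>E. ceval (pair_coords a) p = 0}" using F by (auto simp: zclosed_def)
  obtain R where R: "\<And>i. R i \<in> polys (insert (Xv i) (range Uv))" "\<And>i. R i \<noteq> 0"
    "\<And>i z. z \<in> F \<Longrightarrow> ceval (at_pair z) (R i) = 0"
    using rel by metis
  let ?V = "range Uv :: 'n var set"
  define RU where "RU = (\<lambda>i. uni (Xv i) (R i))"
  have RU_in: "coeffs_in (polys ?V) (RU i)" for i
    unfolding RU_def by (rule polys_insertE[OF R(1)]) auto
  define RK where "RK = (\<lambda>i. map_poly embed (RU i))"
  have RK0: "RK i \<noteq> 0" for i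
  proof -
    have "RU i \<noteq> 0" using R(2) by (simp add: RU_def)
    then have "Polynomial.coeff (RU i) (Polynomial.degree (RU i)) \<noteq> 0" by simp
    then have "Polynomial.coeff (RK i) (Polynomial.degree (RU i)) \<noteq> 0"
      by (simp add: RK_def coeff_map_poly)
    then show ?thesis by auto
  qed
  define lc where "lc = (\<lambda>i. Polynomial.lead_coeff (RU i))"
  have lc: "lc i \<in> polys ?V" "lc i \<noteq> 0" for i
    using RU_in[of i] R(2)[of i] by (auto simp: lc_def coeffs_in_def RU_def)
  have lcK: "Polynomial.lead_coeff (RK i) = embed (lc i)" for i
  proof -
    have "Polynomial.degree (RK i) = Polynomial.degree (RU i)"
      unfolding RK_def by (rule degree_map_poly) simp
    then show ?thesis by (simp add: RK_def lc_def coeff_map_poly)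
  qed
  have "\<exists>A. RK i = Polynomial.smult (embed (lc i)) (\<Prod>x\<in>#A. [:-x, 1:])" for i
    using alg_closed_imp_factorization[OF RK0[of i]] lcK by auto
  then obtain A where A: "\<And>i. RK i = Polynomial.smult (embed (lc i)) (\<Prod>x\<in>#A i. [:-x, 1:])" by metis
  \<comment> \<open>The roots for all coordinates are collected in one set, so that a root shared by
    several coordinates gets a single variable.\<close>
  define Y where "Y = (\<Union>i. set_mset (A i))"
  have "finite Y" by (simp add: Y_def)
  define r where "r = card Y"
  obtain ys where ys: "bij_betw ys {0..<r} Y"
    using ex_bij_betw_nat_finite[OF \<open>finite Y\<close>] unfolding r_def by blast
  define T where "T = (Sv ` {0..<r} :: 'n var set)"
  define \<sigma> where "\<sigma> = (\<lambda>v. case v of Uv j \<Rightarrow> gen (Uv j) | Sv k \<Rightarrow> (if k < r then ys k else 0) | _ \<Rightarrow> 0)"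
  define P where "P = {p. aeval \<sigma> p = 0}"
  interpret prime_poly_ideal P unfolding P_def by (rule prime_poly_ideal_kernel)
  interpret a: coeff_hom "aeval \<sigma>" by (rule coeff_hom_aeval)
  have \<sigma>V: "aeval \<sigma> p = embed p" if "p \<in> polys ?V" for p
  proof -
    have "aeval \<sigma> p = aeval gen p"
      unfolding aeval_def by (rule peval_cong_vars[OF that]) (auto simp: \<sigma>_def)
    then show ?thesis by (simp only: aeval_gen)
  qed
  have PV: "p = 0" if "p \<in> P" "p \<in> polys ?V" for p
    using that \<sigma>V by (simp add: P_def)
  (* The variable Sv k stands for the root ys k. A map xi chooses one root for every coordinate of x, and
     sub xi substitutes this choice. *)
  define pt where "pt = (\<lambda>\<xi>. case_sum (\<lambda>i. pvar (Sv (\<xi> i))) (\<lambda>j. pvar (Uv j)) :: 'n + 'n \<Rightarrow> 'n mpoly)"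
  define sub where "sub = (\<lambda>\<xi>. peval mconst (pt \<xi>) :: ('n + 'n, complex) poly_over \<Rightarrow> 'n mpoly)"
  define All where "All = {\<xi>. \<forall>i. \<xi> i < r \<and> ys (\<xi> i) \<in># A i}"
  define \<Xi> where "\<Xi> = {\<xi>\<in>All. \<forall>p\<in>E. sub \<xi> p \<in> P}"
  have sub_in: "sub \<xi> p \<in> polys (?V \<union> T)" if "\<xi> \<in> All" for \<xi> p
    unfolding sub_def
  proof (induction p rule: poly_over_induct)
    case (const z)
    then show ?case using polys_pconst[of z] by (simp add: pconst_eq_mconst)
  next
    case (var v)
    then show ?case using that by (cases v) (auto simp: pt_def All_def T_def)
  qed auto
  have "finite (PiE UNIV (\<lambda>_. {0..<r}) :: ('n \<Rightarrow> nat) set)" by (intro finite_PiE) auto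
  then have finAll: "finite All"
    by (rule finite_subset[rotated]) (auto simp: All_def PiE_def)
  have "\<forall>\<xi>\<in>All - \<Xi>. \<exists>q\<in>E. sub \<xi> q \<notin> P" by (auto simp: \<Xi>_def)
  then obtain q where q: "\<And>\<xi>. \<xi> \<in> All - \<Xi> \<Longrightarrow> q \<xi> \<in> E \<and> sub \<xi> (q \<xi>) \<notin> P" by metis
  \<comment> \<open>The value 1 on the diagonal lets the product in \<open>b\<close> run over all
    pairs.\<close>
  define dif where "dif = (\<lambda>(k, l). if k = l then 1 else pvar (Sv k) - pvar (Sv l) :: 'n mpoly)"
  \<comment> \<open>As long as \<open>b\<close> stays nonzero, the rejected candidates still violate
    an equation of F, distinct roots stay distinct, and the relations keep their leading
    coefficients.\<close>
  define b where "b = (\<Prod>\<xi>\<in>All - \<Xi>. sub \<xi> (q \<xi>)) * (\<Prod>kl\<in>{0..<r} \<times> {0..<r}. dif kl) * (\<Prod>i\<in>UNIV. lc i)"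
  have "dif kl \<notin> P" if mem: "kl \<in> {0..<r} \<times> {0..<r}" for kl
  proof -
    obtain k l where kl: "kl = (k, l)" "k < r" "l < r" using mem by auto
    show ?thesis
    proof (cases "k = l")
      case False
      then have "ys k \<noteq> ys l" using ys kl by (auto simp: bij_betw_def inj_on_def)
      moreover have "aeval \<sigma> (dif kl) = ys k - ys l"
        using kl False by (simp add: dif_def a.emb_diff) (simp add: \<sigma>_def)
      ultimately show ?thesis by (simp add: P_def)
    qed (use kl one in \<open>simp add: dif_def\<close>)
  qed
  moreover have "lc i \<notin> P" for i using PV lc by blast
  ultimately have bP: "b \<notin> P"
    unfolding b_def mult_iff using q by (metis (no_types, lifting) prod_notin)
  have b_in: "b \<in> polys (?V \<union> T)"
  proof -
    have "lc i \<in> polys (?V \<union> T)" for i using lc polys_mono[of ?V "?V \<union> T"] by auto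
    moreover have "dif kl \<in> polys (?V \<union> T)" if "kl \<in> {0..<r} \<times> {0..<r}" for kl
      using that by (auto simp: dif_def T_def intro!: polys_diff)
    ultimately show ?thesis
      unfolding b_def using sub_in by (intro polys_mult polys_prod) auto
  qed
  have "finite T" "T \<inter> ?V = {}" by (auto simp: T_def)
  then obtain g where g: "g \<in> polys ?V" "g \<notin> P"
    "\<forall>\<rho>. (\<forall>p\<in>P \<inter> polys ?V. ceval \<rho> p = 0) \<longrightarrow> ceval \<rho> g \<noteq> 0 \<longrightarrow>
      (\<exists>\<rho>'. (\<forall>v. v \<notin> T \<longrightarrow> \<rho>' v = \<rho> v) \<and> (\<forall>p\<in>P \<inter> polys (?V \<union> T). ceval \<rho>' p = 0) \<and> ceval \<rho>' b \<noteq> 0)"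
    using specialization_extends[OF _ _ b_in bP] by blast
  have g0: "g \<noteq> 0" using g(2) zero by auto
  define U where "U = {u :: complex^'n. ceval (at_xu 0 u) g \<noteq> 0}"
  have main: "finite {z \<in> F. snd z = u} \<and> card {z \<in> F. snd z = u} = card \<Xi>" if u: "u \<in> U" for u
  proof -
    have "\<forall>p\<in>P \<inter> polys ?V. ceval (at_xu 0 u) p = 0" using PV by fastforce
    then obtain \<rho> where \<rho>: "\<forall>v. v \<notin> T \<longrightarrow> \<rho> v = at_xu 0 u v" "\<forall>p\<in>P \<inter> polys (?V \<union> T). ceval \<rho> p = 0"
      "ceval \<rho> b \<noteq> 0"
      using g(3) u by (auto simp: U_def)
    have \<rho>U: "\<rho> (Uv j) = u $ j" for j using \<rho>(1) by (auto simp: T_def at_xu_def)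
    interpret c: coeff_hom "ceval \<rho>" by (rule coeff_hom_ceval)
    define pnt where "pnt = (\<lambda>\<xi>. (\<chi> i. \<rho> (Sv (\<xi> i)), u) :: (complex^'n) \<times> (complex^'n))"
    have ev_sub: "ceval (pair_coords (pnt \<xi>)) p = ceval \<rho> (sub \<xi> p)" for \<xi> p
    proof -
      have "pair_coords (pnt \<xi>) = (\<lambda>v. ceval \<rho> (pt \<xi> v))"
        by (auto simp: fun_eq_iff pnt_def pt_def \<rho>U split: sum.splits)
      then show ?thesis
        unfolding sub_def peval_peval[OF ceval.coeff_hom_axioms] by simp
    qed
    have nz: "ceval \<rho> (sub \<xi> (q \<xi>)) \<noteq> 0" if "\<xi> \<in> All - \<Xi>" for \<xi>
      using \<rho>(3) that finAll by (auto simp: b_def)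
    have nz_dif: "\<rho> (Sv k) \<noteq> \<rho> (Sv l)" if "k < r" "l < r" "k \<noteq> l" for k l
    proof -
      have "ceval \<rho> (dif (k, l)) \<noteq> 0" using \<rho>(3) that by (auto simp: b_def)
      then show ?thesis using that by (simp add: dif_def)
    qed
    have nz_lc: "ceval \<rho> (lc i) \<noteq> 0" for i using \<rho>(3) by (auto simp: b_def)
    have in_F: "pnt \<xi> \<in> F" if "\<xi> \<in> \<Xi>" for \<xi>
      unfolding E using that \<rho>(2) sub_in by (auto simp: ev_sub \<Xi>_def simp del: split_paired_All)
    have roots: "\<exists>k. k < r \<and> ys k \<in># A i \<and> x $ i = \<rho> (Sv k)" if x: "(x, u) \<in> F" for x i
    proof -
      define K where "K = image_mset (inv_into {0..<r} ys) (A i)"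
      have K: "k < r \<and> ys k \<in># A i" if k: "k \<in># K" for k
      proof -
        obtain y where y: "y \<in># A i" "k = inv_into {0..<r} ys y" using k by (auto simp: K_def)
        then have "y \<in> ys ` {0..<r}" using ys by (auto simp: bij_betw_def Y_def)
        then show ?thesis using y inv_into_into[of y ys "{0..<r}"] f_inv_into_f[of y ys "{0..<r}"] by auto
      qed
      \<comment> \<open>The factorization of the i-th relation, written with variables for the
        roots. The coefficients of Q vanish at the actual roots, so they are in P, and the
        factorization survives the specialization \<rho>.\<close>
      define Q where "Q = RU i - Polynomial.smult (lc i) (\<Prod>k\<in>#K. [:- pvar (Sv k), 1:])"
      have "(\<Prod>k\<in>#K. [:- aeval \<sigma> (pvar (Sv k)), 1:]) = (\<Prod>y\<in>#A i. [:- y, 1:])"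
      proof -
        have inv: "aeval \<sigma> (pvar (Sv (inv_into {0..<r} ys y))) = y" if "y \<in># A i" for y
        proof -
          have "y \<in> ys ` {0..<r}" using ys that by (auto simp: bij_betw_def Y_def)
          then show ?thesis using inv_into_into[of y ys "{0..<r}"] f_inv_into_f[of y ys "{0..<r}"]
            by (simp add: \<sigma>_def)
        qed
        have "(\<Prod>k\<in>#K. [:- aeval \<sigma> (pvar (Sv k)), 1:]) =
            (\<Prod>y\<in>#A i. [:- aeval \<sigma> (pvar (Sv (inv_into {0..<r} ys y))), 1:])"
          unfolding K_def by (simp only: image_mset.compositionality o_def)
        also have "\<dots> = (\<Prod>y\<in>#A i. [:- y, 1:])"
          by (intro arg_cong[where f = prod_mset] image_mset_cong) (simp only: inv)
        finally show ?thesis .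
      qed
      moreover have "map_poly (aeval \<sigma>) (RU i) = RK i"
        unfolding RK_def using RU_in[of i] \<sigma>V by (intro poly_eqI) (simp add: coeff_map_poly a.emb_0 coeffs_in_def)
      ultimately have "map_poly (aeval \<sigma>) Q = 0"
        unfolding Q_def a.map_poly_diff a.map_poly_smult a.map_poly_prod_linear
        using A[of i] \<sigma>V[OF lc(1)] by simp
      then have "coeffs_in P Q"
        by (auto simp: coeffs_in_def P_def coeff_map_poly a.emb_0 poly_eq_iff)
      moreover have "coeffs_in (polys (?V \<union> T)) Q"
      proof -
        have "coeffs_in (polys (?V \<union> T)) (RU i)" "lc i \<in> polys (?V \<union> T)"
          using RU_in[of i] lc(1)[of i] polys_mono[of ?V "?V \<union> T"] by (auto simp: coeffs_in_def)
        moreover have "pvar (Sv k) \<in> polys (?V \<union> T)" if "k \<in># K" for k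
          using K[OF that] by (auto simp: T_def)
        ultimately show ?thesis
          unfolding Q_def by (intro coeffs_in_ops coeffs_in_prod_linear subring_set_polys)
      qed
      ultimately have "map_poly (ceval \<rho>) Q = 0" using coeff_map_ceval_in_P[OF \<rho>(2)] by blast
      then have eq: "map_poly (ceval \<rho>) (RU i) = Polynomial.smult (ceval \<rho> (lc i)) (\<Prod>k\<in>#K. [:- \<rho> (Sv k), 1:])"
        unfolding Q_def c.map_poly_diff c.map_poly_smult c.map_poly_prod_linear by simp
      have "map_poly (ceval (at_pair (x, u))) (RU i) = map_poly (ceval \<rho>) (RU i)"
        using RU_in[of i]
        by (intro poly_eqI) (auto simp: coeff_map_poly coeffs_in_def \<rho>U at_xu_def intro!: peval_cong_vars[where V = ?V])
      then have "poly (map_poly (ceval \<rho>) (RU i)) (x $ i) = 0"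
        using R(3)[OF x, of i] ceval_uni[of "at_pair (x, u)" "R i" "Xv i"] by (simp add: RU_def at_xu_def)
      then have "poly (\<Prod>k\<in>#K. [:- \<rho> (Sv k), 1:]) (x $ i) = 0" using eq nz_lc[of i] by simp
      then have "\<exists>k. k \<in># K \<and> x $ i = \<rho> (Sv k)"
        by (induction K) auto
      then show ?thesis using K by blast
    qed
    have bij: "bij_betw pnt \<Xi> {z \<in> F. snd z = u}"
      unfolding bij_betw_def
    proof
      show "inj_on pnt \<Xi>"
      proof (rule inj_onI)
        fix \<xi> \<eta> assume *: "\<xi> \<in> \<Xi>" "\<eta> \<in> \<Xi>" "pnt \<xi> = pnt \<eta>"
        have "\<xi> i = \<eta> i" for i
        proof (rule ccontr)
          assume "\<xi> i \<noteq> \<eta> i"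
          moreover have "\<xi> i < r" "\<eta> i < r" using *(1,2) by (auto simp: \<Xi>_def All_def)
          moreover have "\<rho> (Sv (\<xi> i)) = \<rho> (Sv (\<eta> i))" using *(3) by (simp add: pnt_def vec_eq_iff)
          ultimately show False using nz_dif by blast
        qed
        then show "\<xi> = \<eta>" by auto
      qed
      show "pnt ` \<Xi> = {z \<in> F. snd z = u}"
      proof (intro equalityI subsetI)
        fix z assume "z \<in> pnt ` \<Xi>"
        then show "z \<in> {z \<in> F. snd z = u}" using in_F by (auto simp: pnt_def)
      next
        fix z assume z: "z \<in> {z \<in> F. snd z = u}"
        then obtain x where x: "z = (x, u)" "(x, u) \<in> F" by (cases z) auto
        from roots[OF x(2)] obtain \<xi> where \<xi>: "\<And>i. \<xi> i < r \<and> ys (\<xi> i) \<in># A i \<and> x $ i = \<rho> (Sv (\<xi> i))" by metis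
        have All: "\<xi> \<in> All" using \<xi> by (simp add: All_def)
        have pnt: "pnt \<xi> = (x, u)" using \<xi> by (simp add: pnt_def vec_eq_iff)
        have "\<xi> \<in> \<Xi>"
        proof (rule ccontr)
          assume "\<xi> \<notin> \<Xi>"
          then have *: "\<xi> \<in> All - \<Xi>" using All by simp
          then have "ceval (pair_coords (pnt \<xi>)) (q \<xi>) = 0"
            using x(2) q[OF *] unfolding E pnt by blast
          then show False using nz[OF *] by (simp only: ev_sub)
        qed
        then show "z \<in> pnt ` \<Xi>" using pnt x by (metis imageI)
      qed
    qed
    have "finite \<Xi>" using finAll by (rule finite_subset[rotated]) (auto simp: \<Xi>_def)
    then show ?thesis using bij_betw_finite[OF bij] bij_betw_same_card[OF bij] by simp
  qed
  have "zclosed vec_nth (- U)"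
  proof -
    define g' where "g' = peval mconst (\<lambda>v. case v of Uv j \<Rightarrow> mvar j | _ \<Rightarrow> 0) g"
    have "(\<lambda>v. ceval (vec_nth u) (case v of Uv j \<Rightarrow> mvar j | _ \<Rightarrow> 0)) = at_xu 0 u" for u :: "complex^'n"
      by (auto simp: fun_eq_iff at_xu_def split: var.splits)
    then have "ceval (vec_nth u) g' = ceval (at_xu 0 u) g" for u
      unfolding g'_def peval_peval[OF ceval.coeff_hom_axioms] by simp
    then show ?thesis unfolding zclosed_def by (intro exI[of _ "{g'}"]) (auto simp: U_def)
  qed
  moreover have "U \<noteq> {}"
  proof -
    obtain \<tau> where "ceval \<tau> g \<noteq> 0"
      using ceval_nonzero_on_grid[OF _ g(1) g0, of "\<lambda>_. UNIV"] infinite_UNIV_char_0 by auto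
    moreover have "ceval (at_xu 0 (\<chi> j. \<tau> (Uv j))) g = ceval \<tau> g"
      by (rule peval_cong_vars[OF g(1)]) (auto simp: at_xu_def)
    ultimately have "(\<chi> j. \<tau> (Uv j)) \<in> U" by (simp only: U_def mem_Collect_eq not_False_eq_True)
    then show ?thesis by blast
  qed
  ultimately show ?thesis
    using main unfolding for_general_def by (intro exI[of _ "card \<Xi>"] exI[of _ U]) simp
qed

section \<open>The optimization correspondence\<close>

lemma ceval_at_pair_eq_at_x:
  assumes "p \<in> polys xvars"
  shows "ceval (at_pair z) p = ceval (at_x (fst z)) p"
  by (rule peval_cong_vars[OF assms]) (auto simp: at_xu_def at_x_def)

lemma generators_in_ideal:
  assumes "g \<in> set gs"
  shows "g \<in> ideal_of gs"
proof -
  obtain l where l: "l < length gs" "g = gs ! l" using assms by (auto simp: in_set_conv_nth)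
  have "g = (\<Sum>k<length gs. (if k = l then 1 else 0) * gs ! k)"
    using l by (simp add: if_distrib[of "\<lambda>c. c * _"] cong: if_cong)
  then show ?thesis
    unfolding ideal_of_def by (intro CollectI exI[of _ "\<lambda>k. if k = l then 1 else 0"]) auto
qed

text \<open>The generators vanish at x, so by the product rule the differential at x of any element
  of the ideal is a combination of their differentials.\<close>

lemma in_tangent_space:
  fixes X :: "(complex^'n) set"
  assumes gs: "ideal_of gs = vanishing_ideal X" and x: "x \<in> X"
    and v: "\<forall>g\<in>set gs. (\<Sum>j\<in>UNIV. ceval (at_x x) (pdiff (Xv j) g) * v $ j) = 0"
  shows "v \<in> tangent_space X x"
  unfolding tangent_space_def
proof (intro CollectI ballI)
  fix p assume "p \<in> vanishing_ideal X"
  then obtain q where p: "p = (\<Sum>k<length gs. q k * gs ! k)"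
    unfolding gs[symmetric] ideal_of_def by blast
  have "ceval (at_x x) (gs ! k) = 0" if "k < length gs" for k
    using generators_in_ideal[of "gs ! k" gs] that x unfolding gs by (auto simp: vanishing_ideal_def)
  then have "ceval (at_x x) (pdiff (Xv j) p) = (\<Sum>k<length gs. ceval (at_x x) (q k) * ceval (at_x x) (pdiff (Xv j) (gs ! k)))" for j
    by (simp add: p derivation_sum[OF derivation_pdiff] pdiff_mult)
  then have "(\<Sum>j\<in>UNIV. ceval (at_x x) (pdiff (Xv j) p) * v $ j) =
      (\<Sum>j\<in>UNIV. \<Sum>k<length gs. ceval (at_x x) (q k) * (ceval (at_x x) (pdiff (Xv j) (gs ! k)) * v $ j))"
    by (simp add: sum_distrib_right mult.assoc)
  also have "\<dots> = (\<Sum>k<length gs. ceval (at_x x) (q k) * (\<Sum>j\<in>UNIV. ceval (at_x x) (pdiff (Xv j) (gs ! k)) * v $ j))"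
    by (subst sum.swap) (simp add: sum_distrib_left)
  also have "\<dots> = 0" using v by simp
  finally show "(\<Sum>j\<in>UNIV. ceval (at_x x) (pdiff (Xv j) p) * v $ j) = 0" .
qed

text \<open>If the Wronskian vanished, \<open>wronskian_ratio\<close> would write N/D without u_i.
  This gives the dependence on u_i the polynomial form used above.\<close>

lemma wronskian_nonzero:
  assumes N: "N \<in> polys (insert (Uv i) xvars)" and D: "D \<in> polys (insert (Uv i) xvars)" "D \<noteq> 0"
    and dep: "embed N / embed D \<notin> ratfuns xvars"
  shows "wronskian (Uv i) N D \<noteq> 0"
proof
  assume w: "wronskian (Uv i) N D = 0"
  have "embed N / embed D \<in> ratfuns xvars"
  proof (cases "N = 0")
    case True
    then show ?thesis unfolding ratfuns_def by (intro CollectI exI[of _ 0] exI[of _ 1]) simp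
  next
    case False
    have V: "insert (Uv i) xvars - {Uv i} = xvars" by auto
    from wronskian_ratio[of "{Uv i}", OF _ N D(1) False D(2)] w
    obtain a b where ab: "a \<in> polys xvars" "b \<in> polys xvars" "b \<noteq> 0" "a * D = b * N"
      unfolding V by auto
    have "embed a * embed D = embed b * embed N" using ab(4) by (simp flip: embed_mult)
    then have "embed N / embed D = embed a / embed b" using ab(3) D(2) by (simp add: field_simps)
    then show ?thesis unfolding ratfuns_def by (intro CollectI exI[of _ a] exI[of _ b]) (simp add: ab)
  qed
  then show False using dep by simp
qed

text \<open>A relation on the critical locus passes to its closure, since the zero set of
  \<open>R\<close> is Zariski closed.\<close>

lemma opt_correspondence_relation:
  fixes f :: "(complex^'n) \<times> (complex^'n) \<Rightarrow> complex" and X :: "(complex^'n) set"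
  assumes W: "open W" "W \<noteq> {}" and hol: "holomorphic_in W f" and gs_solv: "gradient_solvable W f"
    and gs: "set gs \<subseteq> polys xvars" "ideal_of gs = vanishing_ideal X"
  shows "\<exists>R\<in>polys (insert (Xv i) (range Uv)). R \<noteq> 0 \<and> (\<forall>z\<in>opt_correspondence W f X. ceval (at_pair z) R = 0)"
proof -
  define G where "G = {(x, u). (\<Prod>i\<in>UNIV. ceval (at_xu x u) (partial_D W f i)) \<noteq> 0 \<and> critical_point W f X u x}"
  have repr: "partial_repr W f k (partial_N W f k, partial_D W f k)" for k
  proof -
    have "\<exists>r. partial_repr W f k r" using gs_solv by (auto simp: gradient_solvable_def)
    then have "partial_repr W f k (SOME r. partial_repr W f k r)" by (rule someI_ex)
    then show ?thesis by (simp add: partial_N_def partial_D_def)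
  qed
  have N: "partial_N W f k \<in> polys (insert (Uv k) xvars)" and D: "partial_D W f k \<in> polys (insert (Uv k) xvars)"
    and Dnz: "partial_D W f k \<noteq> 0" for k
    using repr[of k] by (auto simp: partial_repr_def)
  have X: "fst z \<in> X" if "z \<in> G" for z
    using that by (auto simp: G_def critical_point_def smooth_locus_def)
  have DG: "ceval (at_pair z) (partial_D W f j) \<noteq> 0" if "z \<in> G" for z j
    using that by (auto simp: G_def)
  have "\<exists>R\<in>polys (insert (Xv i) (range Uv)). R \<noteq> 0 \<and> (\<forall>z\<in>G. ceval (at_pair z) R = 0)"
  proof (rule critical_relation[OF N D Dnz _ _ gs(1) _ DG])
    show "wronskian (Uv i) (partial_N W f i) (partial_D W f i) \<noteq> 0"
      using gs_solv by (intro wronskian_nonzero N D Dnz) (simp add: gradient_solvable_def)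
    show "partial_D W f l ^ 2 * wronskian (Xv l) (partial_N W f k) (partial_D W f k) =
        partial_D W f k ^ 2 * wronskian (Xv k) (partial_N W f l) (partial_D W f l)" for k l
      using gradient_closed[OF W hol _ repr repr] by (cases "k = l") auto
    show "ceval (at_pair z) g = 0" if "g \<in> set gs" "z \<in> G" for g z
    proof -
      have "g \<in> vanishing_ideal X" using generators_in_ideal[OF that(1)] gs(2) by simp
      then show ?thesis using X[OF that(2)] by (auto simp: vanishing_ideal_def ceval_at_pair_eq_at_x)
    qed
    show "(\<Sum>j\<in>UNIV. ceval (at_pair z) (partial_N W f j) / ceval (at_pair z) (partial_D W f j) * w j) = 0"
      if z: "z \<in> G" and w: "\<forall>g\<in>set gs. (\<Sum>j\<in>UNIV. ceval (at_pair z) (pdiff (Xv j) g) * w j) = 0" for z w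
    proof -
      have "(\<chi> j. w j) \<in> tangent_space X (fst z)"
        using w gs(1) by (intro in_tangent_space[OF gs(2) X[OF z]])
          (auto simp: ceval_at_pair_eq_at_x pdiff_in_polys subset_iff)
      moreover have "critical_point W f X (snd z) (fst z)" using z by (auto simp: G_def)
      ultimately show ?thesis unfolding critical_point_def by fastforce
    qed
  qed
  then obtain R where R: "R \<in> polys (insert (Xv i) (range Uv))" "R \<noteq> 0" "\<And>z. z \<in> G \<Longrightarrow> ceval (at_pair z) R = 0"
    by blast
  define R' where "R' = peval mconst (\<lambda>v. case v of Xv i \<Rightarrow> mvar (Inl i) | Uv i \<Rightarrow> mvar (Inr i) | _ \<Rightarrow> 0) R"
  have "(\<lambda>v. ceval (pair_coords z) (case v of Xv i \<Rightarrow> mvar (Inl i) | Uv i \<Rightarrow> mvar (Inr i) | _ \<Rightarrow> 0)) = at_pair z"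
    for z :: "(complex^'n) \<times> (complex^'n)"
    by (auto simp: fun_eq_iff at_xu_def split: var.splits prod.splits)
  then have R': "ceval (pair_coords z) R' = ceval (at_pair z) R" for z
    unfolding R'_def peval_peval[OF ceval.coeff_hom_axioms] by simp
  have "zclosed pair_coords {z. ceval (at_pair z) R = 0}"
    unfolding zclosed_def by (intro exI[of _ "{R'}"]) (simp add: R')
  moreover have "G \<subseteq> {z. ceval (at_pair z) R = 0}" using R(3) by blast
  ultimately have "opt_correspondence W f X \<subseteq> {z. ceval (at_pair z) R = 0}"
    unfolding opt_correspondence_def zclosure_def G_def[symmetric] by (intro hull_minimal)
  then show ?thesis using R(1,2) by blast
qed

text \<open>An intersection of closed sets is cut out by all the polynomials vanishing on it, since
  these include the equations of every member.\<close>

lemma zclosed_zclosure: "zclosed crd (zclosure crd S)"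
  unfolding zclosure_def
proof (rule hull_in)
  fix T assume T: "\<forall>S\<in>T. zclosed crd S"
  let ?I = "{p. \<forall>a\<in>\<Inter>T. ceval (crd a) p = 0}"
  have "a \<in> S" if a: "\<forall>p\<in>?I. ceval (crd a) p = 0" and S: "S \<in> T" for a S
  proof -
    have "zclosed crd S" using T S by simp
    then obtain P where P: "S = {a. \<forall>p\<in>P. ceval (crd a) p = 0}" by (auto simp: zclosed_def)
    have "P \<subseteq> ?I" using S by (auto simp: P)
    then show "a \<in> S" using a by (auto simp: P)
  qed
  then have "\<Inter>T = {a. \<forall>p\<in>?I. ceval (crd a) p = 0}" by auto
  then show "zclosed crd (\<Inter>T)" unfolding zclosed_def by blast
qed

theorem corollary3p9:
  fixes X :: "(complex^'n) set"
    and f :: "(complex^'n) \<times> (complex^'n) \<Rightarrow> complex"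
    and W :: "((complex^'n) \<times> (complex^'n)) set"
    and c :: nat
  assumes "irreducible_variety X"
    and "zcodim X = c"
    and "open W" and "connected W" and "W \<noteq> {}"
    and "holomorphic_in W f"
    and "gradient_solvable W f"
    and "compatible W f X c"
  shows "\<exists>k. for_general vec_nth UNIV (\<lambda>u.
    finite {z \<in> opt_correspondence W f X. snd z = u} \<and>
    card {z \<in> opt_correspondence W f X. snd z = u} = k)"
proof (rule generic_fiber_cardinality)
  show "zclosed pair_coords (opt_correspondence W f X)"
    unfolding opt_correspondence_def by (rule zclosed_zclosure)
  obtain gs where "set gs \<subseteq> polys xvars" "ideal_of gs = vanishing_ideal X"
    using assms(8) unfolding compatible_def by blast
  then show "\<exists>R\<in>polys (insert (Xv i) (range Uv)). R \<noteq> 0 \<and>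
      (\<forall>z\<in>opt_correspondence W f X. ceval (at_pair z) R = 0)" for i
    by (rule opt_correspondence_relation[OF assms(3,5,6,7)])
qed

end
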